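(* Let $N\in\mathbb N$, $s\in(0,1)$, $N>2s$, $2^*_s=2N/(N-2s)$, $\alpha,\beta>1$, $2<\alpha+\beta<2^*_s$, $0<p\le q<1$, $\theta>0$. Let $a\in L^{\frac{2}{1+p}}(\mathbb R^N)$, $b\in L^{\frac{2}{1+q}}(\mathbb R^N)$ with $a(x),b(x)>0$ for all $x\in\mathbb R^N$. Let $V_1,V_2:\mathbb R^N\to\mathbb R$ be continuous with $V_i(x)\ge V_0>0$ for all $x$ (for some constant $V_0$) and $|\{x\in\mathbb R^N: V_i(x)\le M\}|<+\infty$ for all $M>0$, $i=1,2$. Then the system $(S_\lambda)$ has at least two weak solutions $(u,v)$ and $(z,w)$ for each $\lambda\in(0,\lambda^* )$. Furthermore, the functions $u,v,z$ and $w$ are strictly positive a.e. in $\mathbb R^N$.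
   Context: All integrals are over $\mathbb R^N$; $|\cdot|$ of a set is Lebesgue measure. $X=X_1\times X_2$, $X_j=\{u\in H^s(\mathbb R^N):\int V_ju^2dx<\infty\}$, with inner product $\langle(u,v),(\varphi,\psi)\rangle=\iint\frac{[u(x)-u(y)][\varphi(x)-\varphi(y)]+[v(x)-v(y)][\psi(x)-\psi(y)]}{|x-y|^{N+2s}}dxdy+\int V_1u\varphi+V_2v\psi\,dx$ and norm $\|(u,v)\|^2=\langle(u,v),(u,v)\rangle$. The system $(S_\lambda)$ is $(-\Delta)^su+V_1(x)u=\lambda\frac{a(x)}{u^p}+\frac{\alpha}{\alpha+\beta}\theta|u|^{\alpha-2}u|v|^\beta$, $\ (-\Delta)^sv+V_2(x)v=\lambda\frac{b(x)}{v^q}+\frac{\beta}{\alpha+\beta}\theta|u|^\alpha|v|^{\beta-2}v$ in $\mathbb R^N$. A pair $(u,v)\in X$ is a weak solution of $(S_\lambda)$ if for every $(\varphi_1,\varphi_2)\in X$ (all integrals being well defined and finite, with $|0|^{-p}=|0|^{-q}=+\infty$) $\langle(u,v),(\varphi_1,\varphi_2)\rangle-\frac{\theta}{\alpha+\beta}\int(\alpha|u|^{\alpha-2}u\varphi_1|v|^\beta+\beta|u|^\alpha|v|^{\beta-2}v\varphi_2)dx-\lambda\int(a|u|^{-p}\varphi_1+b|v|^{-q}\varphi_2)dx=0.$ $\mathcal A=\{(u,v)\in X:\int|u|^\alpha|v|^\beta dx>0\}$. For $(u,v)\in\mathcal A$, $R_n(u,v)=\dfrac{\|(u,v)\|^2-\theta\int|u|^\alpha|v|^\beta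 dx}{\int a|u|^{1-p}dx+\int b|v|^{1-q}dx}$, and $\lambda^*=\inf_{(u,v)\in\mathcal A}\max_{t>0}R_n(tu,tv)$. *)

theory Defs
  imports "HOL-Analysis.Analysis"
begin

text \<open>
  Functions on $R^N$ are represented by functions on \<open>real^'n\<close> with \<open>N = CARD('n)\<close>. Elements of
  the function spaces are Lebesgue measurable functions, not equivalence classes, so that equality
  in these spaces is equality almost everywhere.
\<close>

definition Lp :: "real \<Rightarrow> (real^'n \<Rightarrow> real) set" where
  "Lp r = {f. f \<in> borel_measurable lebesgue \<and> integrable lebesgue (\<lambda>x. \<bar>f x\<bar> powr r)}"

text \<open>
  Integrands of the Gagliardo double integral. The diagonal, where the quotient is
  \<open>0 / 0 = 0\<close>, is a null set. A double integral is the integral with respect to Lebesgue measure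
  on \<open>(real^'n) \<times> (real^'n)\<close>.
\<close>

definition gagliardo :: "real \<Rightarrow> (real^'n \<Rightarrow> real) \<Rightarrow> (real^'n \<Rightarrow> real) \<Rightarrow>
    (real^'n) \<times> (real^'n) \<Rightarrow> real" where
  "gagliardo s u \<phi> = (\<lambda>(x, y).
     (u x - u y) * (\<phi> x - \<phi> y) / norm (x - y) powr (real CARD('n) + 2 * s))"

definition gagliardo2 :: "real \<Rightarrow> (real^'n \<Rightarrow> real) \<times> (real^'n \<Rightarrow> real) \<Rightarrow>
    (real^'n \<Rightarrow> real) \<times> (real^'n \<Rightarrow> real) \<Rightarrow> (real^'n) \<times> (real^'n) \<Rightarrow> real" where
  "gagliardo2 s = (\<lambda>(u, v) (\<phi>, \<psi>) (x, y).
     ((u x - u y) * (\<phi> x - \<phi> y) + (v x - v y) * (\<psi> x - \<psi> y))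
       / norm (x - y) powr (real CARD('n) + 2 * s))"

definition Hs :: "real \<Rightarrow> (real^'n \<Rightarrow> real) set" where
  "Hs s = {u. u \<in> Lp 2 \<and> integrable lebesgue (gagliardo s u u)}"

definition X1 :: "real \<Rightarrow> (real^'n \<Rightarrow> real) \<Rightarrow> (real^'n \<Rightarrow> real) set" where
  "X1 s V = {u \<in> Hs s. integrable lebesgue (\<lambda>x. V x * (u x)\<^sup>2)}"

definition X :: "real \<Rightarrow> (real^'n \<Rightarrow> real) \<Rightarrow> (real^'n \<Rightarrow> real) \<Rightarrow>
    ((real^'n \<Rightarrow> real) \<times> (real^'n \<Rightarrow> real)) set" where
  "X s V1 V2 = X1 s V1 \<times> X1 s V2"

definition X_inner :: "real \<Rightarrow> (real^'n \<Rightarrow> real) \<Rightarrow> (real^'n \<Rightarrow> real) \<Rightarrow>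
    (real^'n \<Rightarrow> real) \<times> (real^'n \<Rightarrow> real) \<Rightarrow> (real^'n \<Rightarrow> real) \<times> (real^'n \<Rightarrow> real) \<Rightarrow> real" where
  "X_inner s V1 V2 = (\<lambda>(u, v) (\<phi>, \<psi>).
     integral\<^sup>L lebesgue (gagliardo2 s (u, v) (\<phi>, \<psi>))
     + (LINT x|lebesgue. V1 x * u x * \<phi> x + V2 x * v x * \<psi> x))"

definition X_norm :: "real \<Rightarrow> (real^'n \<Rightarrow> real) \<Rightarrow> (real^'n \<Rightarrow> real) \<Rightarrow>
    (real^'n \<Rightarrow> real) \<times> (real^'n \<Rightarrow> real) \<Rightarrow> real" where
  "X_norm s V1 V2 w = sqrt (X_inner s V1 V2 w w)"

text \<open>The power \<open>\<bar>t\<bar>\<^sup>-\<^sup>r\<close> with the convention \<open>\<bar>0\<bar>\<^sup>-\<^sup>r = \<infinity>\<close> (HOL has \<open>0 powr x = 0\<close>).\<close>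

definition neg_pow :: "real \<Rightarrow> real \<Rightarrow> ereal" where
  "neg_pow t r = (if t = 0 then \<infinity> else ereal (\<bar>t\<bar> powr (- r)))"

text \<open>
  An extended-real integrand has a well-defined and finite integral if it is measurable and its
  absolute value has finite integral. It is then finite almost everywhere, so \<open>real_of_ereal\<close>
  changes it only on a null set. Products use \<open>\<infinity> * 0 = 0\<close>, and \<open>\<infinity> + (-\<infinity>) = \<infinity>\<close> in \<open>ereal\<close> is still
  of infinite absolute value, so that integrability excludes it almost everywhere.
\<close>

definition ext_integrable :: "(real^'n \<Rightarrow> ereal) \<Rightarrow> bool" where
  "ext_integrable f \<longleftrightarrow> f \<in> borel_measurable lebesgue \<and> (\<integral>\<^sup>+ x. e2ennreal \<bar>f x\<bar> \<partial>lebesgue) < \<infinity>"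

definition ext_integral :: "(real^'n \<Rightarrow> ereal) \<Rightarrow> real" where
  "ext_integral f = (LINT x|lebesgue. real_of_ereal (f x))"

definition coupling_integrand :: "real \<Rightarrow> real \<Rightarrow>
    (real^'n \<Rightarrow> real) \<times> (real^'n \<Rightarrow> real) \<Rightarrow> (real^'n \<Rightarrow> real) \<times> (real^'n \<Rightarrow> real) \<Rightarrow>
    real^'n \<Rightarrow> real" where
  "coupling_integrand \<alpha> \<beta> = (\<lambda>(u, v) (\<phi>1, \<phi>2) x.
     \<alpha> * \<bar>u x\<bar> powr (\<alpha> - 2) * u x * \<phi>1 x * \<bar>v x\<bar> powr \<beta>
     + \<beta> * \<bar>u x\<bar> powr \<alpha> * \<bar>v x\<bar> powr (\<beta> - 2) * v x * \<phi>2 x)"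

definition singular_integrand :: "real \<Rightarrow> real \<Rightarrow> (real^'n \<Rightarrow> real) \<Rightarrow> (real^'n \<Rightarrow> real) \<Rightarrow>
    (real^'n \<Rightarrow> real) \<times> (real^'n \<Rightarrow> real) \<Rightarrow> (real^'n \<Rightarrow> real) \<times> (real^'n \<Rightarrow> real) \<Rightarrow>
    real^'n \<Rightarrow> ereal" where
  "singular_integrand p q a b = (\<lambda>(u, v) (\<phi>1, \<phi>2) x.
     ereal (a x) * neg_pow (u x) p * ereal (\<phi>1 x) + ereal (b x) * neg_pow (v x) q * ereal (\<phi>2 x))"

text \<open>
  Weak solutions of the system $(S_\lambda)$, with \<open>l\<close> for $\lambda$:
  $(-\Delta)^s u + V_1 u = \lambda a u^{-p} + \frac{\alpha}{\alpha+\beta}\theta |u|^{\alpha-2} u |v|^\beta$,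
  $(-\Delta)^s v + V_2 v = \lambda b v^{-q} + \frac{\beta}{\alpha+\beta}\theta |u|^\alpha |v|^{\beta-2} v$.
\<close>

definition weak_solution :: "real \<Rightarrow> (real^'n \<Rightarrow> real) \<Rightarrow> (real^'n \<Rightarrow> real) \<Rightarrow>
    real \<Rightarrow> real \<Rightarrow> real \<Rightarrow> real \<Rightarrow> real \<Rightarrow> (real^'n \<Rightarrow> real) \<Rightarrow> (real^'n \<Rightarrow> real) \<Rightarrow> real \<Rightarrow>
    (real^'n \<Rightarrow> real) \<times> (real^'n \<Rightarrow> real) \<Rightarrow> bool" where
  "weak_solution s V1 V2 \<theta> \<alpha> \<beta> p q a b l = (\<lambda>(u, v).
     (u, v) \<in> X s V1 V2 \<and>
     (\<forall>(\<phi>1, \<phi>2) \<in> X s V1 V2.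
        integrable lebesgue (gagliardo2 s (u, v) (\<phi>1, \<phi>2)) \<and>
        integrable lebesgue (\<lambda>x. V1 x * u x * \<phi>1 x + V2 x * v x * \<phi>2 x) \<and>
        integrable lebesgue (coupling_integrand \<alpha> \<beta> (u, v) (\<phi>1, \<phi>2)) \<and>
        ext_integrable (singular_integrand p q a b (u, v) (\<phi>1, \<phi>2)) \<and>
        X_inner s V1 V2 (u, v) (\<phi>1, \<phi>2)
          - \<theta> / (\<alpha> + \<beta>) * integral\<^sup>L lebesgue (coupling_integrand \<alpha> \<beta> (u, v) (\<phi>1, \<phi>2))
          - l * ext_integral (singular_integrand p q a b (u, v) (\<phi>1, \<phi>2)) = 0))"

definition admissible :: "real \<Rightarrow> (real^'n \<Rightarrow> real) \<Rightarrow> (real^'n \<Rightarrow> real) \<Rightarrow> real \<Rightarrow> real \<Rightarrow>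
    ((real^'n \<Rightarrow> real) \<times> (real^'n \<Rightarrow> real)) set" where
  "admissible s V1 V2 \<alpha> \<beta> =
     {(u, v) \<in> X s V1 V2. (LINT x|lebesgue. \<bar>u x\<bar> powr \<alpha> * \<bar>v x\<bar> powr \<beta>) > 0}"

definition rayleigh :: "real \<Rightarrow> (real^'n \<Rightarrow> real) \<Rightarrow> (real^'n \<Rightarrow> real) \<Rightarrow>
    real \<Rightarrow> real \<Rightarrow> real \<Rightarrow> real \<Rightarrow> real \<Rightarrow> (real^'n \<Rightarrow> real) \<Rightarrow> (real^'n \<Rightarrow> real) \<Rightarrow>
    (real^'n \<Rightarrow> real) \<times> (real^'n \<Rightarrow> real) \<Rightarrow> real" where
  "rayleigh s V1 V2 \<theta> \<alpha> \<beta> p q a b = (\<lambda>(u, v).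
     ((X_norm s V1 V2 (u, v))\<^sup>2 - \<theta> * (LINT x|lebesgue. \<bar>u x\<bar> powr \<alpha> * \<bar>v x\<bar> powr \<beta>))
       / ((LINT x|lebesgue. a x * \<bar>u x\<bar> powr (1 - p)) + (LINT x|lebesgue. b x * \<bar>v x\<bar> powr (1 - q))))"

text \<open>
  The extremal parameter. The inner maximum over \<open>t > 0\<close> is written as a supremum, and both
  extrema are taken in \<open>ereal\<close>, where they exist unconditionally.
\<close>

definition lambda_star :: "real \<Rightarrow> (real^'n \<Rightarrow> real) \<Rightarrow> (real^'n \<Rightarrow> real) \<Rightarrow>
    real \<Rightarrow> real \<Rightarrow> real \<Rightarrow> real \<Rightarrow> real \<Rightarrow> (real^'n \<Rightarrow> real) \<Rightarrow> (real^'n \<Rightarrow> real) \<Rightarrow> ereal" where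
  "lambda_star s V1 V2 \<theta> \<alpha> \<beta> p q a b =
     (INF (u, v) \<in> admissible s V1 V2 \<alpha> \<beta>. SUP t \<in> {0<..}.
        ereal (rayleigh s V1 V2 \<theta> \<alpha> \<beta> p q a b (\<lambda>x. t * u x, \<lambda>x. t * v x)))"

end

theory Submission
  imports Defs "HOL-Complex_Analysis.Great_Picard"
begin

text \<open>
  Solutions are sought as minimizers of the energy \<open>J\<close> on the two pieces of the Nehari manifold.
  Along a ray \<open>t \<mapsto> t w\<close> the derivative of \<open>J\<close> is \<open>t F\<close> where \<open>F\<close> is a concave function of \<open>ln t\<close>;
  \<open>\<lambda> < \<lambda>\<^sup>*\<close> ensures that \<open>F\<close> is somewhere positive on each ray with \<open>\<integral>\<bar>u\<bar>\<^sup>\<alpha>\<bar>v\<bar>\<^sup>\<beta> > 0\<close>. So \<open>J\<close> has one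
  local minimum and one local maximum on such a ray, and no degenerate critical points.
  The embeddings into \<open>L\<^sup>2\<close> and \<open>L\<^sup>\<alpha>\<^sup>+\<^sup>\<beta>\<close> being compact, all parts of \<open>J\<close> except the norm are weakly
  continuous, and Fatou's lemma along almost everywhere convergent sequences replaces weak lower
  semicontinuity of the norm; both minima are attained, at nonnegative pairs. Comparing \<open>J\<close> there with \<open>J\<close>
  at suitably rescaled perturbations, first in nonnegative directions, bounds the difference
  quotients of the singular terms, which yields positivity and the integrability of \<open>a u\<^sup>-\<^sup>p \<phi>\<close>; then all
  directions are admissible, with dominated convergence, and the Euler-Lagrange equation follows. The two
  solutions differ because the second derivative of \<open>J\<close> along the ray has opposite signs.
\<close>

subsection \<open>The fibering method\<close>

text \<open>Four different powers of \<open>t\<close> occur along a ray, so the extrema of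
  \<open>J\<close> there have no closed form; the variable \<open>ln t\<close> turns powers into
  exponentials, and concavity replaces computation. The extremal parameter enters only through
  \<open>F\<close>: the Rayleigh quotient at \<open>t w\<close> exceeds \<lambda> exactly when
  \<open>F w (ln t) > 0\<close>. Two obstacles shape the rest. The norm is only lower semicontinuous
  along weak limits, so the limit of a minimizing sequence may leave the Nehari manifold; hence one
  constraint set is relaxed to inequalities, and in both cases the limit is moved along its ray
  afterwards. And \<open>J\<close> is not differentiable where \<open>u\<close> or \<open>v\<close>
  vanishes, so neither multipliers nor an implicit function are at hand; minimality is exploited
  only as an inequality along sequences. All exponents of the functionals lie strictly below the
  critical one. Therefore a weak-type decay of superlevel sets, obtained by elementary means, can
  take the place of the strong Sobolev inequality, and compactness is reduced to averages over
  dyadic cubes.\<close>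

lemma powr_exp_eq: "exp (x::real) powr y = exp (y * x)"
  by (simp add: powr_def)

lemma exp_convex_le:
  fixes x y k :: real
  assumes "0 \<le> t" "t \<le> 1"
  shows "exp (k * ((1 - t) * x + t * y)) \<le> (1 - t) * exp (k * x) + t * exp (k * y)"
proof -
  have "convex_on UNIV (exp :: real \<Rightarrow> real)"
    using exp_convex by blast
  from convex_onD[OF this assms, of "k * x" "k * y"]
  show ?thesis by (simp add: algebra_simps)
qed

lemma exp_gt_linear_eventually:
  fixes k c :: real assumes "k > 0" "c > 0"
  shows "\<exists>y. \<forall>x\<ge>y. c * exp (k * x) > M"
proof -
  have "filterlim (\<lambda>x. c * exp (k * x)) at_top at_top"
    by (intro filterlim_tendsto_pos_mult_at_top[OF tendsto_const \<open>c > 0\<close>]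
        filterlim_compose[OF exp_at_top]
        filterlim_tendsto_pos_mult_at_top[OF tendsto_const \<open>k > 0\<close>] filterlim_ident)
  then show ?thesis
    by (simp add: filterlim_at_top_dense eventually_at_top_linorder)
qed

lemma concave_point:
  fixes x y z :: real assumes "x < y" "y < z"
  obtains t where "0 < t" "t < 1" "y = (1 - t) * x + t * z"
proof
  show "0 < (y - x) / (z - x)" "(y - x) / (z - x) < 1" using assms by simp_all
  have "(1 - u) * x + u * z = x + u * (z - x)" for u by algebra
  then have "(1 - (y - x) / (z - x)) * x + (y - x) / (z - x) * z = x + (y - x) / (z - x) * (z - x)" .
  also have "\<dots> = y" using assms by simp
  finally show "y = (1 - (y - x) / (z - x)) * x + (y - x) / (z - x) * z" by simp
qed

text \<open>A linear term beats powers with exponents below 1. Used with \<open>a = A w\<close> and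
  the exponents \<open>(1-p)/2\<close>, \<open>(1-q)/2\<close> at which the singular terms
  grow.\<close>

lemma coercive:
  fixes k K x y c :: real
  assumes "k > 0" "x < 1" "y < 1"
  obtains B where "B \<ge> 0" "\<And>a. a \<ge> B \<Longrightarrow> c < k * a - K * (a powr x + a powr y)"
proof -
  have "((\<lambda>a::real. k - K * (a powr (x - 1) + a powr (y - 1))) \<longlongrightarrow> k - K * (0 + 0)) at_top"
    using assms by (intro tendsto_intros tendsto_neg_powr filterlim_ident) auto
  then have 1: "\<forall>\<^sub>F a in at_top. k / 2 < k - K * (a powr (x - 1) + a powr (y - 1))"
    using assms(1) by (intro order_tendstoD(1)) auto
  have "filterlim (\<lambda>a. k / 2 * a) at_top at_top"
    using assms(1) by (intro filterlim_tendsto_pos_mult_at_top[OF tendsto_const] filterlim_ident) auto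
  then have 2: "\<forall>\<^sub>F a in at_top. c < k / 2 * a" by (simp add: filterlim_at_top_dense)
  have "\<forall>\<^sub>F a in at_top. c < k * a - K * (a powr x + a powr y)"
    using 1 2 eventually_gt_at_top[of 0]
  proof eventually_elim
    case (elim a)
    have "a * a powr (x - 1) = a powr x" "a * a powr (y - 1) = a powr y"
      using elim(3) by (simp_all add: powr_diff)
    then have "k * a - K * (a powr x + a powr y) = (k - K * (a powr (x - 1) + a powr (y - 1))) * a"
      by (simp add: algebra_simps)
    moreover have "k / 2 * a < (k - K * (a powr (x - 1) + a powr (y - 1))) * a"
      using elim by (intro mult_strict_right_mono) auto
    ultimately show ?case using elim(2) by linarith
  qed
  then obtain B where "\<And>a. a \<ge> B \<Longrightarrow> c < k * a - K * (a powr x + a powr y)"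
    by (auto simp: eventually_at_top_linorder)
  then show ?thesis using that[of "max B 0"] by auto
qed

lemma minimizing_sequence:
  fixes f :: "'b \<Rightarrow> real"
  assumes "M \<noteq> {}" "bdd_below (f ` M)"
  obtains u where "\<And>n::nat. u n \<in> M" "(\<lambda>n. f (u n)) \<longlonglongrightarrow> Inf (f ` M)"
proof -
  have "\<exists>x\<in>M. f x < Inf (f ` M) + inverse (Suc n)" for n
    using cInf_lessD[of "f ` M" "Inf (f ` M) + inverse (Suc n)"] assms by auto
  then obtain u where u: "\<And>n. u n \<in> M" "\<And>n. f (u n) < Inf (f ` M) + inverse (Suc n)" by metis
  have "(\<lambda>n. f (u n)) \<longlonglongrightarrow> Inf (f ` M)"
  proof (rule tendsto_sandwich)
    show "\<forall>\<^sub>F n in sequentially. Inf (f ` M) \<le> f (u n)"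
      using u(1) assms(2) by (auto intro!: always_eventually cInf_lower)
    show "\<forall>\<^sub>F n in sequentially. f (u n) \<le> Inf (f ` M) + inverse (Suc n)"
      using u(2) by (auto intro!: always_eventually less_imp_le)
    show "(\<lambda>n. Inf (f ` M) + inverse (Suc n)) \<longlonglongrightarrow> Inf (f ` M)"
      using tendsto_add[OF tendsto_const LIMSEQ_inverse_real_of_nat, of "Inf (f ` M)"] by simp
  qed (rule tendsto_const)
  then show ?thesis using that u(1) by blast
qed

text \<open>Only homogeneity of degrees 2, \<gamma>, 1 - p, 1 - q, bounds on the unit ball, weak
  compactness and the position of \<lambda> enter the minimization, so it is carried out for
  abstract functionals. \<open>Wp\<close> stands for the nonnegative pairs:
  \<open>weak_compact\<close> may put the limit there because absolute values change none of
  \<open>C\<close>, \<open>P\<close>, \<open>Q\<close> and do not increase \<open>A\<close>. The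
  number \<open>L\<close> records that \<open>A\<close> can drop in the limit.\<close>

locale fibering =
  fixes W Wp :: "'w set" and scl :: "real \<Rightarrow> 'w \<Rightarrow> 'w"
    and A C P Q :: "'w \<Rightarrow> real" and \<theta> \<gamma> p q l :: real
  assumes params: "\<theta> > 0" "l > 0" "\<gamma> > 2" "0 < p" "p < 1" "0 < q" "q < 1"
    and Wp_subset: "Wp \<subseteq> W"
    and scl_W: "\<And>t w. t > 0 \<Longrightarrow> w \<in> W \<Longrightarrow> scl t w \<in> W"
    and scl_Wp: "\<And>t w. t > 0 \<Longrightarrow> w \<in> Wp \<Longrightarrow> scl t w \<in> Wp"
    and A_scl: "\<And>t w. t > 0 \<Longrightarrow> w \<in> W \<Longrightarrow> A (scl t w) = t powr 2 * A w"
    and C_scl: "\<And>t w. t > 0 \<Longrightarrow> w \<in> W \<Longrightarrow> C (scl t w) = t powr \<gamma> * C w"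
    and P_scl: "\<And>t w. t > 0 \<Longrightarrow> w \<in> W \<Longrightarrow> P (scl t w) = t powr (1 - p) * P w"
    and Q_scl: "\<And>t w. t > 0 \<Longrightarrow> w \<in> W \<Longrightarrow> Q (scl t w) = t powr (1 - q) * Q w"
    and A_nonneg: "\<And>w. w \<in> W \<Longrightarrow> 0 \<le> A w"
    and C_nonneg: "\<And>w. w \<in> W \<Longrightarrow> 0 \<le> C w"
    and P_nonneg: "\<And>w. w \<in> W \<Longrightarrow> 0 \<le> P w"
    and Q_nonneg: "\<And>w. w \<in> W \<Longrightarrow> 0 \<le> Q w"
    and unit_bound: "\<exists>K. \<forall>w\<in>W. A w \<le> 1 \<longrightarrow> C w \<le> K \<and> P w \<le> K \<and> Q w \<le> K"
    and PQ_pos: "\<And>w. w \<in> W \<Longrightarrow> 0 < A w \<Longrightarrow> 0 < P w + Q w"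
    and weak_compact: "\<And>wn B. (\<And>n::nat. wn n \<in> W) \<Longrightarrow> (\<And>n. A (wn n) \<le> B) \<Longrightarrow>
      \<exists>r w L. strict_mono (r::nat\<Rightarrow>nat) \<and> w \<in> Wp \<and> (\<lambda>n. A (wn (r n))) \<longlonglongrightarrow> L \<and> A w \<le> L \<and>
        (\<lambda>n. C (wn (r n))) \<longlonglongrightarrow> C w \<and> (\<lambda>n. P (wn (r n))) \<longlonglongrightarrow> P w \<and> (\<lambda>n. Q (wn (r n))) \<longlonglongrightarrow> Q w"
    and below_extremal: "\<And>w. w \<in> W \<Longrightarrow> 0 < C w \<Longrightarrow>
      \<exists>t>0. l * (t powr (1 - p) * P w + t powr (1 - q) * Q w) < t powr 2 * A w - \<theta> * t powr \<gamma> * C w"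
    and C_pos_ex: "\<exists>w\<in>W. 0 < C w"
begin

definition J :: "'w \<Rightarrow> real" where
  "J w = A w / 2 - \<theta> / \<gamma> * C w - l / (1 - p) * P w - l / (1 - q) * Q w"

text \<open>With \<open>t = e\<^sup>\<sigma>\<close>, \<open>F w \<sigma> = t\<^sup>-\<^sup>1 d/dt J(t w)\<close>. In the variable \<open>\<sigma>\<close> it is concave.\<close>

definition F :: "'w \<Rightarrow> real \<Rightarrow> real" where
  "F w \<sigma> = A w - \<theta> * C w * exp ((\<gamma> - 2) * \<sigma>) - l * P w * exp (- (1 + p) * \<sigma>) - l * Q w * exp (- (1 + q) * \<sigma>)"

text \<open>The derivative of \<open>F w\<close> at 0. It does not contain \<open>A\<close>, hence
  it passes to weak limits exactly, whereas \<open>F w\<close> can drop.\<close>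

definition F' :: "'w \<Rightarrow> real" where
  "F' w = - (\<gamma> - 2) * \<theta> * C w + (1 + p) * l * P w + (1 + q) * l * Q w"

abbreviation S :: "real \<Rightarrow> 'w \<Rightarrow> 'w" where "S \<sigma> w \<equiv> scl (exp \<sigma>) w"

lemma S_W: "w \<in> W \<Longrightarrow> S \<sigma> w \<in> W" and S_Wp: "w \<in> Wp \<Longrightarrow> S \<sigma> w \<in> Wp"
  using scl_W scl_Wp by auto

lemma S_simps:
  assumes "w \<in> W"
  shows "A (S \<sigma> w) = exp (2 * \<sigma>) * A w" "C (S \<sigma> w) = exp (\<gamma> * \<sigma>) * C w"
    "P (S \<sigma> w) = exp ((1 - p) * \<sigma>) * P w" "Q (S \<sigma> w) = exp ((1 - q) * \<sigma>) * Q w"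
  using assms by (simp_all add: A_scl C_scl P_scl Q_scl powr_exp_eq)

lemma J_S:
  assumes "w \<in> W"
  shows "J (S \<sigma> w) = exp (2 * \<sigma>) * A w / 2 - \<theta> / \<gamma> * (exp (\<gamma> * \<sigma>) * C w)
     - l / (1 - p) * (exp ((1 - p) * \<sigma>) * P w) - l / (1 - q) * (exp ((1 - q) * \<sigma>) * Q w)"
  unfolding J_def S_simps[OF assms] ..

lemma J_S_0: assumes "w \<in> W" shows "J (S 0 w) = J w"
  unfolding J_S[OF assms] by (simp add: J_def)

text \<open>Rescaling translates the logarithmic variable, and the positive factor keeps signs; a
  zero of \<open>F w\<close> can thus always be moved to 0.\<close>

lemma F_S: assumes "w \<in> W" shows "F (S \<tau> w) \<sigma> = exp (2 * \<tau>) * F w (\<sigma> + \<tau>)"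
proof -
  have *: "exp x * (c * exp y) = exp z * (c * exp u) " if "x + y = z + u" for x y z u c :: real
    using that by (metis exp_add mult.left_commute)
  have "\<theta> * (exp (\<gamma> * \<tau>) * C w) * exp ((\<gamma> - 2) * \<sigma>) = exp (2*\<tau>) * (\<theta> * C w * exp ((\<gamma> - 2) * (\<sigma> + \<tau>)))"
    using *[of "\<gamma> * \<tau>" "(\<gamma>-2)*\<sigma>" "2*\<tau>" "(\<gamma>-2)*(\<sigma>+\<tau>)" "\<theta> * C w"] by (simp add: algebra_simps)
  moreover have "l * (exp ((1 - p) * \<tau>) * P w) * exp (- (1 + p) * \<sigma>) = exp (2*\<tau>) * (l * P w * exp (- (1 + p) * (\<sigma> + \<tau>)))"
    using *[of "(1 - p) * \<tau>" "- (1 + p) * \<sigma>" "2*\<tau>" "- (1 + p) * (\<sigma> + \<tau>)" "l * P w"] by (simp add: algebra_simps)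
  moreover have "l * (exp ((1 - q) * \<tau>) * Q w) * exp (- (1 + q) * \<sigma>) = exp (2*\<tau>) * (l * Q w * exp (- (1 + q) * (\<sigma> + \<tau>)))"
    using *[of "(1 - q) * \<tau>" "- (1 + q) * \<sigma>" "2*\<tau>" "- (1 + q) * (\<sigma> + \<tau>)" "l * Q w"] by (simp add: algebra_simps)
  ultimately show ?thesis
    unfolding F_def S_simps[OF assms] by (simp only: right_diff_distrib)
qed

lemma DERIV_J_S:
  assumes "w \<in> W"
  shows "((\<lambda>\<sigma>. J (S \<sigma> w)) has_real_derivative exp (2 * \<sigma>) * F w \<sigma>) (at \<sigma>)"
proof -
  have 1: "exp (2*\<sigma>) * exp ((\<gamma>-2)*\<sigma>) = exp (\<gamma>*\<sigma>)" "exp (2*\<sigma>) * exp (-(1+p)*\<sigma>) = exp ((1-p)*\<sigma>)"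
    "exp (2*\<sigma>) * exp (-(1+q)*\<sigma>) = exp ((1-q)*\<sigma>)"
    by (simp_all add: exp_add[symmetric] algebra_simps)
  have "exp (2 * \<sigma>) * F w \<sigma> = exp (2*\<sigma>) * A w - \<theta> * C w * (exp (2*\<sigma>) * exp ((\<gamma>-2)*\<sigma>))
    - l * P w * (exp (2*\<sigma>) * exp (-(1+p)*\<sigma>)) - l * Q w * (exp (2*\<sigma>) * exp (-(1+q)*\<sigma>))"
    unfolding F_def by (simp add: right_diff_distrib mult_ac)
  then have 2: "exp (2 * \<sigma>) * F w \<sigma> = exp (2*\<sigma>) * A w - \<theta> * C w * exp (\<gamma>*\<sigma>)
    - l * P w * exp ((1-p)*\<sigma>) - l * Q w * exp ((1-q)*\<sigma>)" unfolding 1 .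
  have "((\<lambda>\<sigma>. J (S \<sigma> w)) has_real_derivative
     exp (2 * \<sigma>) * 2 * A w / 2 - \<theta> / \<gamma> * (exp (\<gamma> * \<sigma>) * \<gamma> * C w)
     - l / (1 - p) * (exp ((1 - p) * \<sigma>) * (1-p) * P w) - l / (1 - q) * (exp ((1 - q) * \<sigma>) * (1-q) * Q w)) (at \<sigma>)"
    unfolding J_S[OF assms] by (auto intro!: derivative_eq_intros)
  moreover have "exp (2 * \<sigma>) * 2 * A w / 2 - \<theta> / \<gamma> * (exp (\<gamma> * \<sigma>) * \<gamma> * C w)
     - l / (1 - p) * (exp ((1 - p) * \<sigma>) * (1-p) * P w) - l / (1 - q) * (exp ((1 - q) * \<sigma>) * (1-q) * Q w)
    = exp (2 * \<sigma>) * F w \<sigma>"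
    unfolding 2 using params by (simp add: mult_ac)
  ultimately show ?thesis by simp
qed

section \<open>Monotonicity of the energy along a ray\<close>

lemma J_S_mono:
  assumes "w \<in> W" "x \<le> y" "\<And>\<sigma>. x < \<sigma> \<Longrightarrow> \<sigma> < y \<Longrightarrow> 0 \<le> F w \<sigma>"
  shows "J (S x w) \<le> J (S y w)"
proof (cases "x = y")
  case False
  then have "x < y" using assms by simp
  then obtain z where z: "x < z" "z < y" "J (S y w) - J (S x w) = (y - x) * (exp (2*z) * F w z)"
    using MVT2[of x y "\<lambda>\<sigma>. J (S \<sigma> w)" "\<lambda>z. exp (2*z) * F w z"] DERIV_J_S[OF assms(1)] by blast
  have "0 \<le> (y - x) * (exp (2*z) * F w z)" using z assms by simp
  then show ?thesis using z by simp
qed simp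

lemma J_S_antimono:
  assumes "w \<in> W" "x \<le> y" "\<And>\<sigma>. x < \<sigma> \<Longrightarrow> \<sigma> < y \<Longrightarrow> F w \<sigma> \<le> 0"
  shows "J (S y w) \<le> J (S x w)"
proof (cases "x = y")
  case False
  then have "x < y" using assms by simp
  then obtain z where z: "x < z" "z < y" "J (S y w) - J (S x w) = (y - x) * (exp (2*z) * F w z)"
    using MVT2[of x y "\<lambda>\<sigma>. J (S \<sigma> w)" "\<lambda>z. exp (2*z) * F w z"] DERIV_J_S[OF assms(1)] by blast
  have "(y - x) * (exp (2*z) * F w z) \<le> 0" using z assms
    by (simp add: mult_nonneg_nonpos)
  then show ?thesis using z by simp
qed simp

lemma J_S_strict_antimono:
  assumes "w \<in> W" "x < y" "\<And>\<sigma>. x < \<sigma> \<Longrightarrow> \<sigma> < y \<Longrightarrow> F w \<sigma> < 0"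
  shows "J (S y w) < J (S x w)"
proof -
  obtain z where z: "x < z" "z < y" "J (S y w) - J (S x w) = (y - x) * (exp (2*z) * F w z)"
    using MVT2[of x y "\<lambda>\<sigma>. J (S \<sigma> w)" "\<lambda>z. exp (2*z) * F w z"] DERIV_J_S[OF assms(1)] assms(2) by blast
  have "(y - x) * (exp (2*z) * F w z) < 0" using z assms
    by (simp add: mult_pos_neg)
  then show ?thesis using z by simp
qed

lemma F_cont: "continuous_on D (F w)"
  unfolding F_def by (intro continuous_intros)

text \<open>\<open>F w\<close> is a constant minus nonnegative multiples of exponentials of linear
  functions, each of them convex.\<close>

lemma F_concave:
  assumes "w \<in> W" "0 \<le> t" "t \<le> 1"
  shows "(1 - t) * F w x + t * F w y \<le> F w ((1 - t) * x + t * y)"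
proof -
  have a: "c * exp (k * ((1 - t) * x + t * y)) \<le> c * ((1 - t) * exp (k * x) + t * exp (k * y))"
    if "c \<ge> 0" for c k :: real
    using exp_convex_le[OF assms(2,3)] that by (rule mult_left_mono)
  have "\<theta> * C w \<ge> 0" "l * P w \<ge> 0" "l * Q w \<ge> 0"
    using params C_nonneg P_nonneg Q_nonneg assms(1) by simp_all
  note b = a[OF this(1), of "\<gamma> - 2"] a[OF this(2), of "- (1 + p)"] a[OF this(3), of "- (1 + q)"]
  have "(1 - t) * F w x + t * F w y = A w
    - \<theta> * C w * ((1 - t) * exp ((\<gamma> - 2) * x) + t * exp ((\<gamma> - 2) * y))
    - l * P w * ((1 - t) * exp (- (1 + p) * x) + t * exp (- (1 + p) * y))
    - l * Q w * ((1 - t) * exp (- (1 + q) * x) + t * exp (- (1 + q) * y))"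
    unfolding F_def by algebra
  also have "\<dots> \<le> F w ((1 - t) * x + t * y)"
    unfolding F_def using b by linarith
  finally show ?thesis .
qed

text \<open>A concave function lies below its tangent; here this is \<open>exp x \<ge> 1 + x\<close>
  in each term. It turns the sign conditions at 0 in \<open>Mplus\<close> and \<open>Mminus\<close>
  into statements on half-lines.\<close>

lemma F_tangent: assumes "w \<in> W" shows "F w \<sigma> \<le> F w 0 + F' w * \<sigma>"
proof -
  have a: "c * (1 + k * \<sigma>) \<le> c * exp (k * \<sigma>)" if "c \<ge> 0" for c k :: real
    using exp_ge_add_one_self[of "k * \<sigma>"] that by (rule mult_left_mono)
  have "\<theta> * C w \<ge> 0" "l * P w \<ge> 0" "l * Q w \<ge> 0"
    using params C_nonneg P_nonneg Q_nonneg assms(1) by simp_all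
  note b = a[OF this(1), of "\<gamma> - 2"] a[OF this(2), of "- (1 + p)"] a[OF this(3), of "- (1 + q)"]
  have "F w 0 + F' w * \<sigma> = A w - \<theta> * C w * (1 + (\<gamma> - 2) * \<sigma>) - l * P w * (1 + - (1 + p) * \<sigma>)
     - l * Q w * (1 + - (1 + q) * \<sigma>)"
    unfolding F_def F'_def by (simp add: algebra_simps)
  then show ?thesis unfolding F_def using b by linarith
qed

lemma F_between_pos:
  assumes "w \<in> W" "x < y" "y < z" "0 \<le> F w x" "0 \<le> F w z" "0 < F w x \<or> 0 < F w z"
  shows "0 < F w y"
proof -
  obtain t where t: "0 < t" "t < 1" "y = (1 - t) * x + t * z" using concave_point assms by metis
  have "0 < (1 - t) * F w x + t * F w z"
    using t assms by (auto intro: add_pos_nonneg add_nonneg_pos)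
  also have "\<dots> \<le> F w y" using F_concave[of w t x z] t assms by auto
  finally show ?thesis .
qed

text \<open>By homogeneity the bound for \<open>A w \<le> 1\<close> rescales to a power of
  \<open>A w\<close> with half the degree as exponent, \<open>A\<close> itself having degree
  2.\<close>

lemma bound_by_A:
  obtains K where "K > 0" "\<And>w. w \<in> W \<Longrightarrow> C w \<le> K * A w powr (\<gamma>/2)"
    "\<And>w. w \<in> W \<Longrightarrow> P w \<le> K * A w powr ((1-p)/2)" "\<And>w. w \<in> W \<Longrightarrow> Q w \<le> K * A w powr ((1-q)/2)"
proof -
  obtain K0 where K0: "\<And>w. w \<in> W \<Longrightarrow> A w \<le> 1 \<Longrightarrow> C w \<le> K0 \<and> P w \<le> K0 \<and> Q w \<le> K0"
    using unit_bound by blast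
  define K where "K = max K0 1"
  have K: "K > 0" "\<And>w. w \<in> W \<Longrightarrow> A w \<le> 1 \<Longrightarrow> C w \<le> K \<and> P w \<le> K \<and> Q w \<le> K"
    using K0 unfolding K_def by fastforce+
  have gen: "f w \<le> K * A w powr (k/2)" if w: "w \<in> W" and k: "k > 0"
    and f: "\<And>v. v \<in> W \<Longrightarrow> A v \<le> 1 \<Longrightarrow> f v \<le> K" "\<And>v. v \<in> W \<Longrightarrow> 0 \<le> f v"
      "\<And>t v. t > 0 \<Longrightarrow> v \<in> W \<Longrightarrow> f (scl t v) = t powr k * f v" for f :: "'w \<Rightarrow> real" and w k
  proof (cases "A w = 0")
    case True
    have "f w \<le> 0"
    proof (rule ccontr)
      assume "\<not> f w \<le> 0"
      then have fw: "f w > 0" by simp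
      \<comment> \<open>A ray with \<open>A = 0\<close> stays in the unit ball, while
        \<open>f\<close> would grow beyond \<open>K\<close> along it.\<close>
      obtain y where y: "f w * exp (k * y) > K" using exp_gt_linear_eventually[OF k fw, of K] by blast
      have "f (S y w) \<le> K" using f(1)[of "S y w"] S_W[OF w] S_simps(1)[OF w, of y] True by simp
      moreover have "f (S y w) = exp (k * y) * f w" using f(3)[of "exp y" w] w by (simp add: powr_exp_eq)
      ultimately show False using y by (simp add: mult.commute)
    qed
    then show ?thesis using True by simp
  next
    case False
    then have Aw: "A w > 0" using A_nonneg[OF w] by simp
    \<comment> \<open>Normalizes to \<open>A (scl t w) = 1\<close>.\<close>
    define t where "t = A w powr (-1/2)"
    have t: "t > 0" unfolding t_def using Aw by simp
    have "t powr 2 * A w = A w powr (-1) * A w powr 1" unfolding t_def powr_powr using Aw by simp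
    then have t2: "t powr 2 * A w = 1" unfolding powr_add[symmetric] using Aw by simp
    have "f (scl t w) \<le> K" using f(1)[of "scl t w"] scl_W[OF t w] A_scl[OF t w] t2 by simp
    then have le: "t powr k * f w \<le> K" using f(3)[OF t w] by simp
    have inv: "A w powr (k/2) * t powr k = 1"
    proof -
      have "t powr k = A w powr (- (k/2))" unfolding t_def powr_powr by simp
      then show ?thesis using Aw by (simp add: powr_minus)
    qed
    have "A w powr (k/2) * (t powr k * f w) \<le> A w powr (k/2) * K"
      by (rule mult_left_mono[OF le]) simp
    then show ?thesis using inv by (metis mult.assoc mult.commute mult.right_neutral)
  qed
  show ?thesis
  proof (rule that[OF K(1)])
    show "C w \<le> K * A w powr (\<gamma>/2)" if "w \<in> W" for w
      using gen[OF that, of \<gamma> C] params K(2) C_nonneg C_scl by auto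
    show "P w \<le> K * A w powr ((1-p)/2)" if "w \<in> W" for w
      using gen[OF that, of "1-p" P] params K(2) P_nonneg P_scl by auto
    show "Q w \<le> K * A w powr ((1-q)/2)" if "w \<in> W" for w
      using gen[OF that, of "1-q" Q] params K(2) Q_nonneg Q_scl by auto
  qed
qed

lemma A_zero: assumes "w \<in> W" "A w = 0" shows "C w = 0" "P w = 0" "Q w = 0"
proof -
  obtain K where "K > 0" "\<And>w. w \<in> W \<Longrightarrow> C w \<le> K * A w powr (\<gamma>/2)"
    "\<And>w. w \<in> W \<Longrightarrow> P w \<le> K * A w powr ((1-p)/2)" "\<And>w. w \<in> W \<Longrightarrow> Q w \<le> K * A w powr ((1-q)/2)"
    using bound_by_A by blast
  then show "C w = 0" "P w = 0" "Q w = 0"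
    using assms C_nonneg P_nonneg Q_nonneg by (fastforce intro: antisym)+
qed

lemma C_pos_A_pos: "w \<in> W \<Longrightarrow> 0 < C w \<Longrightarrow> 0 < A w"
  using A_zero A_nonneg by (metis less_eq_real_def less_irrefl)

text \<open>For \<open>C w > 0\<close> this is \<open>below_extremal\<close>, the only place where
  the size of \<lambda> matters. Rays with \<open>C w = 0\<close> are not admissible for the
  extremal parameter; there \<open>F w\<close> tends to \<open>A w > 0\<close> at large
  scales.\<close>

lemma F_pos_ex: assumes w: "w \<in> W" "0 < A w" shows "\<exists>\<sigma>. 0 < F w \<sigma>"
proof (cases "C w = 0")
  case False
  then obtain t where t: "t > 0"
    "l * (t powr (1 - p) * P w + t powr (1 - q) * Q w) < t powr 2 * A w - \<theta> * t powr \<gamma> * C w"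
    using below_extremal[OF w(1)] C_nonneg[OF w(1)] by fastforce
  define \<sigma> where "\<sigma> = ln t"
  have te: "t = exp \<sigma>" using t unfolding \<sigma>_def by simp
  have "F (S \<sigma> w) 0 > 0"
    using t(2) unfolding F_def S_simps[OF w(1)] te powr_exp_eq by (simp add: algebra_simps)
  then have "0 < F w \<sigma>" unfolding F_S[OF w(1)] by (simp add: zero_less_mult_iff)
  then show ?thesis ..
next
  case True
  have lim: "((\<lambda>\<sigma>. exp (- k * \<sigma>)) \<longlongrightarrow> 0) at_top" if "k > 0" for k :: real
    using that by (intro filterlim_compose[OF exp_at_bot]
      filterlim_tendsto_neg_mult_at_bot[OF tendsto_const] filterlim_ident) auto
  have "(F w \<longlongrightarrow> A w - 0 - l * P w * 0 - l * Q w * 0) at_top"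
    unfolding F_def True using params by (intro tendsto_intros lim) auto
  then have "\<forall>\<^sub>F \<sigma> in at_top. 0 < F w \<sigma>" using w(2) order_tendstoD(1) by fastforce
  then show ?thesis by (auto simp: eventually_at_top_linorder)
qed

text \<open>At small scales the singular terms dominate; \<open>PQ_pos\<close> ensures that at least
  one of them is present.\<close>

lemma F_neg_left: assumes w: "w \<in> W" "0 < A w" shows "\<exists>\<sigma><y. F w \<sigma> < 0"
proof -
  have PQ: "P w > 0 \<or> Q w > 0" using PQ_pos[OF w] by linarith
  have nn: "\<theta> * C w * exp ((\<gamma> - 2) * \<sigma>) \<ge> 0" "l * P w * exp (- (1 + p) * \<sigma>) \<ge> 0"
    "l * Q w * exp (- (1 + q) * \<sigma>) \<ge> 0" for \<sigma>
    using params C_nonneg P_nonneg Q_nonneg w(1) by simp_all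
  have 1: "F w \<sigma> \<le> A w - l * P w * exp ((1 + p) * (- \<sigma>))" for \<sigma>
    using nn[of \<sigma>] unfolding F_def by (simp only: minus_mult_commute)
  have 2: "F w \<sigma> \<le> A w - l * Q w * exp ((1 + q) * (- \<sigma>))" for \<sigma>
    using nn[of \<sigma>] unfolding F_def by (simp only: minus_mult_commute)
  obtain k c where kc: "k > 0" "c > 0" "\<And>\<sigma>. F w \<sigma> \<le> A w - c * exp (k * (- \<sigma>))"
  proof (cases "P w > 0")
    case True
    then show thesis using that[of "1 + p" "l * P w"] params 1 by simp
  next
    case False
    then show thesis using that[of "1 + q" "l * Q w"] params 2 PQ by simp
  qed
  obtain x where x: "\<And>z. z \<ge> x \<Longrightarrow> c * exp (k * z) > A w"
    using exp_gt_linear_eventually[OF kc(1,2)] by blast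
  have "F w (- max x (1 - y)) < 0"
    using kc(3)[of "- max x (1 - y)"] x[of "max x (1 - y)"] by simp
  then show ?thesis by (intro exI[of _ "- max x (1 - y)"]) simp
qed

text \<open>At large scales the coupling term dominates, its degree \<gamma> being above 2.\<close>

lemma F_neg_right: assumes w: "w \<in> W" "0 < C w" shows "\<exists>\<sigma>>y. F w \<sigma> < 0"
proof -
  have kc: "\<theta> * C w > 0" "\<gamma> - 2 > 0" using params w by simp_all
  obtain x where x: "\<And>z. z \<ge> x \<Longrightarrow> \<theta> * C w * exp ((\<gamma> - 2) * z) > A w"
    using exp_gt_linear_eventually[OF kc(2,1)] by blast
  have nn: "l * P w * exp (- (1 + p) * \<sigma>) \<ge> 0" "l * Q w * exp (- (1 + q) * \<sigma>) \<ge> 0" for \<sigma>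
    using params P_nonneg Q_nonneg w by simp_all
  have "F w \<sigma> \<le> A w - \<theta> * C w * exp ((\<gamma> - 2) * \<sigma>)" for \<sigma>
    using nn[of \<sigma>] unfolding F_def by linarith
  from this[of "max x (1 + y)"] x[of "max x (1 + y)"] have "F w (max x (1 + y)) < 0" by simp
  then show ?thesis by (intro exI[of _ "max x (1 + y)"]) simp
qed

text \<open>The zero comes from the intermediate value theorem; concavity makes it the only sign
  change to the left of \<open>\<sigma>0\<close>.\<close>

lemma first_zero:
  assumes w: "w \<in> W" "0 < A w" and pos: "0 < F w \<sigma>0"
  obtains \<sigma>1 where "\<sigma>1 < \<sigma>0" "F w \<sigma>1 = 0" "\<And>\<sigma>. \<sigma> < \<sigma>1 \<Longrightarrow> F w \<sigma> < 0"
    "\<And>\<sigma>. \<sigma>1 < \<sigma> \<Longrightarrow> \<sigma> \<le> \<sigma>0 \<Longrightarrow> 0 < F w \<sigma>"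
proof -
  obtain x where x: "x < \<sigma>0" "F w x < 0" using F_neg_left[OF w] by blast
  obtain \<sigma>1 where z: "x \<le> \<sigma>1" "\<sigma>1 \<le> \<sigma>0" "F w \<sigma>1 = 0"
    using IVT'[of "F w" x 0 \<sigma>0] x pos F_cont by fastforce
  have lt: "\<sigma>1 < \<sigma>0" using z pos by (metis less_eq_real_def less_irrefl)
  show ?thesis
  proof (rule that[OF lt z(3)])
    show "F w \<sigma> < 0" if "\<sigma> < \<sigma>1" for \<sigma>
      using F_between_pos[OF w(1) that lt] pos z(3) by fastforce
    show "0 < F w \<sigma>" if "\<sigma>1 < \<sigma>" "\<sigma> \<le> \<sigma>0" for \<sigma>
      using F_between_pos[OF w(1) that(1), of \<sigma>0] that pos z(3) by fastforce
  qed
qed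

lemma last_zero:
  assumes w: "w \<in> W" "0 < C w" and pos: "0 < F w \<sigma>0"
  obtains \<sigma>1 where "\<sigma>0 < \<sigma>1" "F w \<sigma>1 = 0" "\<And>\<sigma>. \<sigma>1 < \<sigma> \<Longrightarrow> F w \<sigma> < 0"
    "\<And>\<sigma>. \<sigma>0 \<le> \<sigma> \<Longrightarrow> \<sigma> < \<sigma>1 \<Longrightarrow> 0 < F w \<sigma>"
proof -
  obtain x where x: "\<sigma>0 < x" "F w x < 0" using F_neg_right[OF w] by blast
  obtain \<sigma>1 where z: "\<sigma>0 \<le> \<sigma>1" "\<sigma>1 \<le> x" "F w \<sigma>1 = 0"
    using IVT2'[of "F w" x 0 \<sigma>0] x pos F_cont by fastforce
  have lt: "\<sigma>0 < \<sigma>1" using z pos by (metis less_eq_real_def less_irrefl)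
  show ?thesis
  proof (rule that[OF lt z(3)])
    show "F w \<sigma> < 0" if "\<sigma>1 < \<sigma>" for \<sigma>
      using F_between_pos[OF w(1) lt that] pos z(3) by fastforce
    show "0 < F w \<sigma>" if "\<sigma>0 \<le> \<sigma>" "\<sigma> < \<sigma>1" for \<sigma>
      using F_between_pos[OF w(1), of \<sigma>0 \<sigma> \<sigma>1] that pos z(3) by fastforce
  qed
qed

text \<open>The tangent inequality at a zero \<open>\<tau>\<close>. A single point with
  \<open>F w \<sigma> > 0\<close> forces \<open>F' (S \<tau> w)\<close> to have strictly the sign of
  \<open>\<sigma> - \<tau>\<close>, which excludes degenerate critical points.\<close>

lemma F'_S_tangent:
  assumes "w \<in> W" "F w \<tau> = 0"
  shows "exp (2 * \<tau>) * F w \<sigma> \<le> F' (S \<tau> w) * (\<sigma> - \<tau>)"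
  using F_tangent[OF S_W[OF assms(1)], of \<tau> "\<sigma> - \<tau>"] assms by (simp add: F_S)

section \<open>Quasi-minimality and the constraint sets\<close>

definition conv :: "(nat \<Rightarrow> 'w) \<Rightarrow> 'w \<Rightarrow> bool" where
  "conv wn w \<longleftrightarrow> (\<lambda>n. A (wn n)) \<longlonglongrightarrow> A w \<and> (\<lambda>n. C (wn n)) \<longlonglongrightarrow> C w \<and>
     (\<lambda>n. P (wn n)) \<longlonglongrightarrow> P w \<and> (\<lambda>n. Q (wn n)) \<longlonglongrightarrow> Q w"

text \<open>This replaces the differentiation of the projection onto the Nehari manifold: along every
  approximating family the energy can only increase, up to rescaling both sides by a common factor
  tending to 1.\<close>

definition quasi_minimal :: "'w \<Rightarrow> bool" where
  "quasi_minimal w \<longleftrightarrow> (\<forall>wn. (\<forall>n. wn n \<in> W) \<longrightarrow> conv wn w \<longrightarrow>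
     (\<exists>\<sigma>. \<sigma> \<longlonglongrightarrow> 0 \<and> (\<forall>\<^sub>F n in sequentially. J (S (\<sigma> n) w) \<le> J (S (\<sigma> n) (wn n)))))"

text \<open>Inequalities instead of \<open>F w 0 = 0\<close>: as \<open>F\<close> can only drop and
  \<open>F'\<close> is continuous under weak convergence, the set contains the weak limits of its
  bounded sequences.\<close>

definition Mplus :: "'w set" where "Mplus = {w \<in> W. F w 0 \<le> 0 \<and> 0 \<le> F' w}"

text \<open>Here the constraint stays an equation; a weak limit may leave the set and is then moved
  along its ray to the last zero of \<open>F\<close>.\<close>

definition Mminus :: "'w set" where "Mminus = {w \<in> W. 0 < C w \<and> F w 0 = 0 \<and> F' w \<le> 0}"

text \<open>The defect \<open>L - A w\<close> of weak convergence enters additively; with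
  \<open>L = A w\<close> this is plain convergence.\<close>

lemma F_tendsto:
  assumes "(\<lambda>n. A (wn n)) \<longlonglongrightarrow> L" "(\<lambda>n. C (wn n)) \<longlonglongrightarrow> C w" "(\<lambda>n. P (wn n)) \<longlonglongrightarrow> P w"
    "(\<lambda>n. Q (wn n)) \<longlonglongrightarrow> Q w"
  shows "(\<lambda>n. F (wn n) \<sigma>) \<longlonglongrightarrow> F w \<sigma> + (L - A w)"
proof -
  have "(\<lambda>n. F (wn n) \<sigma>) \<longlonglongrightarrow> L - \<theta> * C w * exp ((\<gamma> - 2) * \<sigma>) - l * P w * exp (- (1 + p) * \<sigma>) - l * Q w * exp (- (1 + q) * \<sigma>)"
    unfolding F_def by (intro tendsto_intros assms)
  then show ?thesis by (simp add: F_def algebra_simps)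
qed

lemma J_tendsto:
  assumes "(\<lambda>n. A (wn n)) \<longlonglongrightarrow> L" "(\<lambda>n. C (wn n)) \<longlonglongrightarrow> C w" "(\<lambda>n. P (wn n)) \<longlonglongrightarrow> P w"
    "(\<lambda>n. Q (wn n)) \<longlonglongrightarrow> Q w"
  shows "(\<lambda>n. J (wn n)) \<longlonglongrightarrow> J w + (L - A w) / 2"
proof -
  have "(\<lambda>n. J (wn n)) \<longlonglongrightarrow> L / 2 - \<theta> / \<gamma> * C w - l / (1 - p) * P w - l / (1 - q) * Q w"
    unfolding J_def by (intro tendsto_intros assms) auto
  then show ?thesis by (simp add: J_def algebra_simps diff_divide_distrib)
qed

lemma F'_tendsto:
  assumes "(\<lambda>n. C (wn n)) \<longlonglongrightarrow> C w" "(\<lambda>n. P (wn n)) \<longlonglongrightarrow> P w" "(\<lambda>n. Q (wn n)) \<longlonglongrightarrow> Q w"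
  shows "(\<lambda>n. F' (wn n)) \<longlonglongrightarrow> F' w"
  unfolding F'_def by (intro tendsto_intros assms)

lemma bounded_functionals:
  assumes "B \<ge> 0"
  obtains K where "\<And>w. w \<in> W \<Longrightarrow> A w \<le> B \<Longrightarrow> C w \<le> K \<and> P w \<le> K \<and> Q w \<le> K" "K \<ge> 0"
proof -
  obtain K where K: "K > 0" "\<And>w. w \<in> W \<Longrightarrow> C w \<le> K * A w powr (\<gamma>/2)"
    "\<And>w. w \<in> W \<Longrightarrow> P w \<le> K * A w powr ((1-p)/2)" "\<And>w. w \<in> W \<Longrightarrow> Q w \<le> K * A w powr ((1-q)/2)"
    using bound_by_A by blast
  have m: "K * A w powr k \<le> K * B powr k" if "w \<in> W" "A w \<le> B" "k > 0" for w k
    using K(1) that A_nonneg by (intro mult_left_mono powr_mono2) auto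
  show ?thesis
  proof (rule that[of "K * B powr (\<gamma>/2) + K * B powr ((1-p)/2) + K * B powr ((1-q)/2)"])
    fix w assume w: "w \<in> W" "A w \<le> B"
    have n: "0 \<le> K * B powr k" for k using K(1) by simp
    show "C w \<le> K * B powr (\<gamma>/2) + K * B powr ((1-p)/2) + K * B powr ((1-q)/2) \<and>
      P w \<le> K * B powr (\<gamma>/2) + K * B powr ((1-p)/2) + K * B powr ((1-q)/2) \<and>
      Q w \<le> K * B powr (\<gamma>/2) + K * B powr ((1-p)/2) + K * B powr ((1-q)/2)"
      using K(2-4)[OF w(1)] m[OF w, of "\<gamma>/2"] m[OF w, of "(1-p)/2"] m[OF w, of "(1-q)/2"] params
        n[of "\<gamma>/2"] n[of "(1-p)/2"] n[of "(1-q)/2"] by simp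
  qed (use K in simp)
qed

text \<open>\<open>F' w \<ge> 0\<close> bounds the coupling term by the singular terms, and then
  \<open>F w 0 \<le> 0\<close> bounds \<open>A\<close> by them. Since they grow slower than
  \<open>A\<close>, the whole set is bounded.\<close>

lemma PQ_bound_Mplus:
  assumes "w \<in> Mplus" shows "A w \<le> (2 / (\<gamma> - 2) + 1) * l * (P w + Q w)"
proof -
  have w: "w \<in> W" "A w \<le> \<theta> * C w + l * P w + l * Q w"
    "(\<gamma> - 2) * (\<theta> * C w) \<le> (1 + p) * (l * P w) + (1 + q) * (l * Q w)"
    using assms unfolding Mplus_def F_def F'_def by (auto simp: algebra_simps)
  have "(1 + p) * (l * P w) \<le> 2 * (l * P w)" "(1 + q) * (l * Q w) \<le> 2 * (l * Q w)"
    using params P_nonneg[OF w(1)] Q_nonneg[OF w(1)] by (intro mult_right_mono; simp)+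
  with w(3) have "(\<gamma> - 2) * (\<theta> * C w) \<le> 2 * l * (P w + Q w)" by (simp add: algebra_simps)
  then have "\<theta> * C w \<le> 2 * l * (P w + Q w) / (\<gamma> - 2)" using params by (simp add: field_simps)
  then show ?thesis using w(2) by (simp add: algebra_simps add_divide_distrib)
qed

lemma Mplus_bounded: obtains B where "B \<ge> 0" "\<And>w. w \<in> Mplus \<Longrightarrow> A w \<le> B"
proof -
  obtain K where K: "K > 0" "\<And>w. w \<in> W \<Longrightarrow> C w \<le> K * A w powr (\<gamma>/2)"
    "\<And>w. w \<in> W \<Longrightarrow> P w \<le> K * A w powr ((1-p)/2)" "\<And>w. w \<in> W \<Longrightarrow> Q w \<le> K * A w powr ((1-q)/2)"
    using bound_by_A by blast
  define c where "c = (2 / (\<gamma> - 2) + 1) * l"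
  have c: "c > 0" unfolding c_def using params by (simp add: add_pos_pos)
  have small: "(1-p)/2 < 1" "(1-q)/2 < 1" using params by simp_all
  obtain B where B: "B \<ge> 0" "\<And>a. a \<ge> B \<Longrightarrow> 0 < 1 * a - (c * K) * (a powr ((1-p)/2) + a powr ((1-q)/2))"
    using coercive[OF zero_less_one small, of 0 "c * K"] by blast
  show ?thesis
  proof (rule that[OF B(1)])
    fix w assume w: "w \<in> Mplus"
    then have "w \<in> W" unfolding Mplus_def by simp
    have "A w \<le> c * (P w + Q w)" using PQ_bound_Mplus[OF w] unfolding c_def by simp
    also have "\<dots> \<le> c * (K * A w powr ((1-p)/2) + K * A w powr ((1-q)/2))"
      using K(3,4)[OF \<open>w \<in> W\<close>] c by (intro mult_left_mono) auto
    finally have "\<not> (0 < 1 * A w - (c * K) * (A w powr ((1-p)/2) + A w powr ((1-q)/2)))"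
      by (simp add: algebra_simps)
    then show "A w \<le> B" using B(2)[of "A w"] by (meson linorder_le_cases)
  qed
qed

lemma J_lower:
  assumes "w \<in> W" "A w \<le> B" "C w \<le> K \<and> P w \<le> K \<and> Q w \<le> K"
  shows "J w \<ge> - (\<theta> / \<gamma> * K) - l / (1 - p) * K - l / (1 - q) * K"
proof -
  have "\<theta> / \<gamma> * C w \<le> \<theta> / \<gamma> * K" "l / (1 - p) * P w \<le> l / (1 - p) * K" "l / (1 - q) * Q w \<le> l / (1 - q) * K"
    using assms params by (intro mult_left_mono; simp)+
  then show ?thesis unfolding J_def using A_nonneg[OF assms(1)] by linarith
qed

lemma first_zero_Mplus:
  assumes w: "w \<in> W" and F: "F w \<sigma> = 0" "\<sigma> < \<sigma>0" "0 < F w \<sigma>0"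
  shows "S \<sigma> w \<in> Mplus" "0 < F' (S \<sigma> w)"
proof -
  have "0 < exp (2 * \<sigma>) * F w \<sigma>0" using F by simp
  also have "\<dots> \<le> F' (S \<sigma> w) * (\<sigma>0 - \<sigma>)" using F'_S_tangent[OF w F(1)] .
  finally show *: "0 < F' (S \<sigma> w)" using F(2) by (simp add: zero_less_mult_iff)
  show "S \<sigma> w \<in> Mplus" unfolding Mplus_def using S_W[OF w] F_S[OF w, of \<sigma> 0] F * by simp
qed

lemma last_zero_Mminus:
  assumes w: "w \<in> W" "0 < C w" and F: "F w \<sigma> = 0" "\<sigma>0 < \<sigma>" "0 < F w \<sigma>0"
  shows "S \<sigma> w \<in> Mminus" "F' (S \<sigma> w) < 0"
proof -
  have "0 < exp (2 * \<sigma>) * F w \<sigma>0" using F by simp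
  also have "\<dots> \<le> F' (S \<sigma> w) * (\<sigma>0 - \<sigma>)" using F'_S_tangent[OF w(1) F(1)] .
  finally show *: "F' (S \<sigma> w) < 0" using F(2) by (simp add: zero_less_mult_iff)
  have "0 < C (S \<sigma> w)" using S_simps(2)[OF w(1)] w(2) by simp
  then show "S \<sigma> w \<in> Mminus" unfolding Mminus_def using S_W[OF w(1)] F_S[OF w(1), of \<sigma> 0] F * by simp
qed

text \<open>Among the scales up to \<open>\<sigma>0\<close> the energy on a ray is smallest at the
  first zero of \<open>F\<close>, and \<open>0 \<le> \<sigma>0\<close> places \<open>w\<close>
  itself among these scales.\<close>

lemma Mplus_below:
  assumes w: "w \<in> W" "0 < A w" and pos: "0 < F w \<sigma>0" "0 \<le> \<sigma>0"
  obtains v where "v \<in> Mplus" "J v \<le> J w"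
proof -
  obtain \<sigma>1 where s: "\<sigma>1 < \<sigma>0" "F w \<sigma>1 = 0" "\<And>\<sigma>. \<sigma> < \<sigma>1 \<Longrightarrow> F w \<sigma> < 0"
    "\<And>\<sigma>. \<sigma>1 < \<sigma> \<Longrightarrow> \<sigma> \<le> \<sigma>0 \<Longrightarrow> 0 < F w \<sigma>"
    using first_zero[OF w pos(1)] by blast
  have "J (S \<sigma>1 w) \<le> J (S 0 w)"
  proof (cases "\<sigma>1 \<le> 0")
    case True
    then show ?thesis using s pos(2) by (intro J_S_mono[OF w(1)]) (auto intro: less_imp_le)
  next
    case False
    then show ?thesis using s by (intro J_S_antimono[OF w(1)]) (auto intro: less_imp_le)
  qed
  then show ?thesis using that first_zero_Mplus[OF w(1) s(2,1) pos(1)] J_S_0[OF w(1)] by metis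
qed

text \<open>The weak limit is only known to lie in the relaxed set; moving it to the first zero of
  \<open>F\<close> does not raise the energy and makes \<open>F'\<close> strictly positive.\<close>

lemma ex_quasi_minimal_plus:
  "\<exists>w\<in>Wp. 0 < A w \<and> 0 < F' w \<and> quasi_minimal w"
proof -
  obtain B where B: "B \<ge> 0" "\<And>w. w \<in> Mplus \<Longrightarrow> A w \<le> B" using Mplus_bounded by blast
  obtain K where K: "\<And>w. w \<in> W \<Longrightarrow> A w \<le> B \<Longrightarrow> C w \<le> K \<and> P w \<le> K \<and> Q w \<le> K"
    using bounded_functionals[OF B(1)] by metis
  have MW: "w \<in> W" if "w \<in> Mplus" for w using that unfolding Mplus_def by simp
  have bdd: "bdd_below (J ` Mplus)"
    using J_lower[OF MW B(2) K[OF MW B(2)]] by (intro bdd_belowI2) blast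
  define c where "c = Inf (J ` Mplus)"
  have c_le: "c \<le> J w" if "w \<in> Mplus" for w
    unfolding c_def using bdd that by (intro cInf_lower) auto
  obtain w0 where w0: "w0 \<in> W" "0 < C w0" using C_pos_ex by blast
  have Aw0: "0 < A w0" using C_pos_A_pos[OF w0] .
  obtain \<sigma>0 where \<sigma>0: "0 < F w0 \<sigma>0" using F_pos_ex[OF w0(1) Aw0] by blast
  obtain \<sigma>1 where s: "\<sigma>1 < \<sigma>0" "F w0 \<sigma>1 = 0" "\<And>\<sigma>. \<sigma> < \<sigma>1 \<Longrightarrow> F w0 \<sigma> < 0"
    using first_zero[OF w0(1) Aw0 \<sigma>0] by metis
  have ne: "S \<sigma>1 w0 \<in> Mplus" using first_zero_Mplus[OF w0(1) s(2,1) \<sigma>0] by simp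
  \<comment> \<open>Along a ray \<open>J\<close> starts from the limit 0 at small scales and
    decreases strictly up to the first zero of \<open>F\<close>. Negativity keeps the minimizer away
    from \<open>A w = 0\<close>.\<close>
  have neg: "c < 0"
  proof -
    have lim: "((\<lambda>\<sigma>. exp (k * \<sigma>)) \<longlongrightarrow> 0) at_bot" if "k > 0" for k :: real
      using that by (intro filterlim_compose[OF exp_at_bot] filterlim_tendsto_pos_mult_at_bot[OF tendsto_const] filterlim_ident) auto
    have "((\<lambda>\<sigma>. J (S \<sigma> w0)) \<longlongrightarrow> 0 * A w0 / 2 - \<theta> / \<gamma> * (0 * C w0) - l / (1 - p) * (0 * P w0) - l / (1 - q) * (0 * Q w0)) at_bot"
      unfolding J_S[OF w0(1)] using params by (intro tendsto_intros lim) auto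
    then have "((\<lambda>\<sigma>. J (S \<sigma> w0)) \<longlongrightarrow> 0) at_bot" by simp
    moreover have "\<forall>\<^sub>F \<sigma> in at_bot. J (S (\<sigma>1 - 1) w0) \<le> J (S \<sigma> w0)"
      unfolding eventually_at_bot_linorder
      by (intro exI[of _ "\<sigma>1 - 1"] allI impI J_S_antimono[OF w0(1)]) (auto intro!: less_imp_le[OF s(3)])
    ultimately have "J (S (\<sigma>1 - 1) w0) \<le> 0" by (rule tendsto_lowerbound) simp
    moreover have "J (S \<sigma>1 w0) < J (S (\<sigma>1 - 1) w0)"
      by (rule J_S_strict_antimono[OF w0(1)]) (auto intro: s(3))
    ultimately show ?thesis using c_le[OF ne] by linarith
  qed
  obtain u where u: "\<And>n. u n \<in> Mplus" "(\<lambda>n. J (u n)) \<longlonglongrightarrow> c"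
    using minimizing_sequence[OF _ bdd] ne unfolding c_def by blast
  obtain r w L where r: "strict_mono r" "w \<in> Wp" "(\<lambda>n. A (u (r n))) \<longlonglongrightarrow> L" "A w \<le> L"
    "(\<lambda>n. C (u (r n))) \<longlonglongrightarrow> C w" "(\<lambda>n. P (u (r n))) \<longlonglongrightarrow> P w" "(\<lambda>n. Q (u (r n))) \<longlonglongrightarrow> Q w"
    using weak_compact[of u B, OF MW[OF u(1)] B(2)[OF u(1)]] by blast
  have w: "w \<in> W" using r(2) Wp_subset by blast
  have "F w 0 + (L - A w) \<le> 0"
    using u(1) by (intro tendsto_upperbound[OF F_tendsto[OF r(3,5-7)]]) (auto simp: Mplus_def)
  then have F0: "F w 0 \<le> 0" using r(4) by linarith
  have F'0: "0 \<le> F' w"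
    using u(1) by (intro tendsto_lowerbound[OF F'_tendsto[OF r(5-7)]]) (auto simp: Mplus_def)
  have "J w + (L - A w) / 2 = c"
    using J_tendsto[OF r(3,5-7)] LIMSEQ_subseq_LIMSEQ[OF u(2) r(1)] by (auto simp: o_def intro: LIMSEQ_unique)
  moreover have "0 \<le> (L - A w) / 2" using r(4) by simp
  ultimately have Jw: "J w \<le> c" by (metis add_increasing2 dual_order.refl)
  have Aw: "0 < A w"
  proof (rule ccontr)
    assume "\<not> 0 < A w"
    then have "A w = 0" using A_nonneg[OF w] by simp
    then have "J w = 0" unfolding J_def using A_zero[OF w] by simp
    then show False using Jw neg by simp
  qed
  obtain \<tau>0 where \<tau>0: "0 < F w \<tau>0" using F_pos_ex[OF w Aw] by blast
  obtain \<tau>1 where t: "\<tau>1 < \<tau>0" "F w \<tau>1 = 0" "\<And>\<sigma>. \<sigma> < \<tau>1 \<Longrightarrow> F w \<sigma> < 0"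
    "\<And>\<sigma>. \<tau>1 < \<sigma> \<Longrightarrow> \<sigma> \<le> \<tau>0 \<Longrightarrow> 0 < F w \<sigma>" using first_zero[OF w Aw \<tau>0] by metis
  have np: "F w \<sigma> \<le> 0" if "\<sigma> \<le> 0" for \<sigma>
    using F_tangent[OF w, of \<sigma>] F0 mult_nonneg_nonpos[OF F'0 that] by linarith
  \<comment> \<open>The tangent bound makes \<open>F w\<close> nonpositive left of 0, while it is
    positive immediately right of its first zero.\<close>
  have t1: "0 \<le> \<tau>1"
  proof (rule ccontr)
    assume "\<not> 0 \<le> \<tau>1"
    then have "\<tau>1 < min 0 \<tau>0" using t(1) by simp
    then show False using t(4)[of "min 0 \<tau>0"] np[of "min 0 \<tau>0"] by simp
  qed
  define v where "v = S \<tau>1 w"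
  have v: "v \<in> Wp" "v \<in> W" unfolding v_def using S_Wp[OF r(2)] S_W[OF w] by auto
  have "J v \<le> J (S 0 w)" unfolding v_def using t1 t(3)
    by (intro J_S_antimono[OF w]) (auto intro: less_imp_le)
  then have Jv: "J v \<le> c" using Jw J_S_0[OF w] by simp
  have F'v: "0 < F' v" unfolding v_def using first_zero_Mplus[OF w t(2,1) \<tau>0] by simp
  have Av: "0 < A v" unfolding v_def using S_simps(1)[OF w] Aw by simp
  \<comment> \<open>A witness of \<open>F v d > 0\<close>. This open condition survives for
    \<open>wn n\<close>, so that \<open>Mplus_below\<close> applies to them.\<close>
  define d where "d = \<tau>0 - \<tau>1"
  have d: "d > 0" "0 < F v d" unfolding d_def v_def using t(1) \<tau>0 F_S[OF w] by simp_all
  have "quasi_minimal v"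
    unfolding quasi_minimal_def conv_def
  proof (intro allI impI exI conjI)
    fix wn assume wn: "\<forall>n. wn n \<in> W" and lim: "(\<lambda>n. A (wn n)) \<longlonglongrightarrow> A v \<and> (\<lambda>n. C (wn n)) \<longlonglongrightarrow> C v \<and>
       (\<lambda>n. P (wn n)) \<longlonglongrightarrow> P v \<and> (\<lambda>n. Q (wn n)) \<longlonglongrightarrow> Q v"
    \<comment> \<open>At this minimum the factor 1 suffices: eventually each \<open>wn n\<close> has
      a point of \<open>Mplus\<close> below it in energy.\<close>
    show "(\<lambda>_::nat. 0::real) \<longlonglongrightarrow> 0" by simp
    have "(\<lambda>n. F (wn n) d) \<longlonglongrightarrow> F v d" using F_tendsto[of wn "A v" v d] lim by simp
    then have "\<forall>\<^sub>F n in sequentially. 0 < F (wn n) d" using d(2) order_tendstoD(1) by blast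
    moreover have "\<forall>\<^sub>F n in sequentially. 0 < A (wn n)" using lim Av order_tendstoD(1) by blast
    ultimately show "\<forall>\<^sub>F n in sequentially. J (S 0 v) \<le> J (S 0 (wn n))"
    proof eventually_elim
      case (elim n)
      have wnW: "wn n \<in> W" using wn by simp
      obtain z where "z \<in> Mplus" "J z \<le> J (wn n)" using Mplus_below[OF wnW elim(2,1)] d(1) by auto
      then have "J v \<le> J (wn n)" using c_le Jv by force
      then show ?case using J_S_0[OF wnW] J_S_0[OF v(2)] by simp
    qed
  qed
  then show ?thesis using v Av F'v by blast
qed

text \<open>Points of \<open>Mminus\<close> maximize \<open>J\<close> on the relevant part of their
  rays. This is used twice: the minimizing sequence is compared with its rescaling by the factor
  that projects the limit, and rescalings of the minimizer are compared with the minimizer.\<close>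

lemma ex_quasi_minimal_minus:
  "\<exists>w\<in>Wp. 0 < A w \<and> F' w < 0 \<and> quasi_minimal w"
proof -
  obtain K where K: "K > 0" "\<And>w. w \<in> W \<Longrightarrow> C w \<le> K * A w powr (\<gamma>/2)"
    "\<And>w. w \<in> W \<Longrightarrow> P w \<le> K * A w powr ((1-p)/2)" "\<And>w. w \<in> W \<Longrightarrow> Q w \<le> K * A w powr ((1-q)/2)"
    using bound_by_A by blast
  have M: "w \<in> W" "0 < C w" "A w = \<theta> * C w + l * P w + l * Q w"
    "(1 + p) * (l * P w) + (1 + q) * (l * Q w) \<le> (\<gamma> - 2) * (\<theta> * C w)"
    if "w \<in> Mminus" for w using that unfolding Mminus_def F_def F'_def by (auto simp: algebra_simps)
  \<comment> \<open>Eliminating the coupling term by \<open>F w 0 = 0\<close> leaves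
    \<open>k * A w\<close> minus singular terms as a lower bound for \<open>J\<close>, hence
    coercivity.\<close>
  define k where "k = 1/2 - 1/\<gamma>"
  define K' where "K' = l / (1 - p) + l / (1 - q)"
  have k: "k > 0" unfolding k_def using params by (simp add: field_simps)
  have K': "K' > 0" unfolding K'_def using params by (simp add: add_pos_pos)
  have Jge: "k * A w - (K' * K) * (A w powr ((1-p)/2) + A w powr ((1-q)/2)) \<le> J w" if "w \<in> Mminus" for w
  proof -
    have nn: "0 \<le> P w" "0 \<le> Q w" using M(1)[OF that] P_nonneg Q_nonneg by auto
    have "\<theta> / \<gamma> * C w = (A w - l * P w - l * Q w) / \<gamma>" using M(3)[OF that] by simp
    then have "J w = k * A w + l * P w / \<gamma> + l * Q w / \<gamma> - l / (1 - p) * P w - l / (1 - q) * Q w"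
      unfolding J_def k_def by (simp only: diff_divide_distrib left_diff_distrib) simp
    moreover have "0 \<le> l * P w / \<gamma>" "0 \<le> l * Q w / \<gamma>" using nn params by simp_all
    moreover have "l / (1 - p) * P w \<le> K' * P w" "l / (1 - q) * Q w \<le> K' * Q w"
      unfolding K'_def using nn params by (intro mult_right_mono; simp)+
    ultimately have 1: "k * A w - (K' * P w + K' * Q w) \<le> J w" by linarith
    have "K' * P w \<le> K' * (K * A w powr ((1-p)/2))" "K' * Q w \<le> K' * (K * A w powr ((1-q)/2))"
      using K(3,4)[OF M(1)[OF that]] K' by (intro mult_left_mono; simp)+
    then show ?thesis using 1 by (simp add: algebra_simps)
  qed
  have small: "(1-p)/2 < 1" "(1-q)/2 < 1" using params by simp_all
  have coer: "\<exists>B\<ge>0. \<forall>w\<in>Mminus. J w \<le> c \<longrightarrow> A w \<le> B" for c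
  proof -
    obtain B where B: "B \<ge> 0" "\<And>a. a \<ge> B \<Longrightarrow> c < k * a - (K' * K) * (a powr ((1-p)/2) + a powr ((1-q)/2))"
      using coercive[OF k small, of c "K' * K"] by blast
    then show ?thesis using Jge by (intro exI[of _ B]) (smt (verit))
  qed
  have bdd: "bdd_below (J ` Mminus)"
  proof -
    obtain B where B: "B \<ge> 0" "\<And>w. w \<in> Mminus \<Longrightarrow> J w \<le> 0 \<Longrightarrow> A w \<le> B" using coer[of 0] by blast
    obtain K1 where K1: "\<And>w. w \<in> W \<Longrightarrow> A w \<le> B \<Longrightarrow> C w \<le> K1 \<and> P w \<le> K1 \<and> Q w \<le> K1"
      using bounded_functionals[OF B(1)] by metis
    show ?thesis
    proof (rule bdd_belowI2)
      fix w assume w: "w \<in> Mminus"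
      show "min 0 (- (\<theta> / \<gamma> * K1) - l / (1 - p) * K1 - l / (1 - q) * K1) \<le> J w"
      proof (cases "J w \<le> 0")
        case True
        then show ?thesis using J_lower[OF M(1)[OF w] B(2)[OF w] K1[OF M(1)[OF w] B(2)[OF w]]] by simp
      qed simp
    qed
  qed
  define c where "c = Inf (J ` Mminus)"
  have c_le: "c \<le> J w" if "w \<in> Mminus" for w
    unfolding c_def using bdd that by (intro cInf_lower) auto
  obtain w0 where w0: "w0 \<in> W" "0 < C w0" using C_pos_ex by blast
  obtain \<sigma>0 where \<sigma>0: "0 < F w0 \<sigma>0" using F_pos_ex[OF w0(1) C_pos_A_pos[OF w0]] by blast
  have ne: "Mminus \<noteq> {}"
    using last_zero[OF w0 \<sigma>0] last_zero_Mminus[OF w0] \<sigma>0 by (metis empty_iff)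
  obtain u where u: "\<And>n. u n \<in> Mminus" "(\<lambda>n. J (u n)) \<longlonglongrightarrow> c"
    using minimizing_sequence[OF ne bdd] unfolding c_def by blast
  obtain b where b: "\<And>n. J (u n) \<le> b"
    using Bseq_bdd_above[OF convergent_imp_Bseq] u(2) unfolding convergent_def bdd_above_def
    by (metis rangeI)
  obtain B where B: "\<And>n. A (u n) \<le> B" using coer[of b] u(1) b by blast
  obtain r w L where r: "strict_mono r" "w \<in> Wp" "(\<lambda>n. A (u (r n))) \<longlonglongrightarrow> L" "A w \<le> L"
    "(\<lambda>n. C (u (r n))) \<longlonglongrightarrow> C w" "(\<lambda>n. P (u (r n))) \<longlonglongrightarrow> P w" "(\<lambda>n. Q (u (r n))) \<longlonglongrightarrow> Q w"
    using weak_compact[of u B, OF M(1)[OF u(1)] B] by blast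
  have w: "w \<in> W" using r(2) Wp_subset by blast
  \<comment> \<open>Solves \<open>(\<gamma> - 1) * \<theta> * K * \<delta> powr (\<gamma>/2 - 1) =
    1\<close>. Comparing \<open>A v \<le> (\<gamma> - 1) * \<theta> * C v\<close> with
    \<open>C v \<le> K * A v powr (\<gamma>/2)\<close> gives \<open>\<delta> \<le> A v\<close>. The
    resulting lower bound for \<open>C\<close> is weakly continuous, so the limit keeps
    \<open>C w > 0\<close>.\<close>
  define \<delta> where "\<delta> = (1 / ((\<gamma> - 1) * \<theta> * K)) powr (1 / (\<gamma>/2 - 1))"
  have gK: "(\<gamma> - 1) * \<theta> * K > 0" using params K(1) by simp
  have \<delta>: "\<delta> > 0" unfolding \<delta>_def using params K(1) by simp
  have Cge: "\<delta> / ((\<gamma> - 1) * \<theta>) \<le> C v" if v: "v \<in> Mminus" for v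
  proof -
    have nn: "0 \<le> P v" "0 \<le> Q v" using M(1)[OF v] P_nonneg Q_nonneg by auto
    have "1 * (l * P v) \<le> (1 + p) * (l * P v)" "1 * (l * Q v) \<le> (1 + q) * (l * Q v)"
      using params nn by (intro mult_right_mono; simp)+
    then have AC: "A v \<le> (\<gamma> - 1) * \<theta> * C v" using M(3,4)[OF v] by (simp add: algebra_simps)
    have Av: "0 < A v" using C_pos_A_pos M[OF v] by blast
    have "(\<gamma> - 1) * \<theta> * C v \<le> (\<gamma> - 1) * \<theta> * (K * A v powr (\<gamma>/2))"
      using K(2)[OF M(1)[OF v]] params by (intro mult_left_mono) auto
    moreover have "A v powr (\<gamma>/2) = A v powr (\<gamma>/2 - 1) * A v"
      using Av by (simp add: powr_diff)
    ultimately have "A v * 1 \<le> A v * ((\<gamma> - 1) * \<theta> * K * A v powr (\<gamma>/2 - 1))"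
      using AC by (simp add: mult_ac)
    then have "1 \<le> (\<gamma> - 1) * \<theta> * K * A v powr (\<gamma>/2 - 1)" using Av by (simp only: mult_le_cancel_left_pos)
    then have "1 / ((\<gamma> - 1) * \<theta> * K) \<le> A v powr (\<gamma>/2 - 1)"
      using gK by (simp add: divide_le_eq mult.commute)
    then have "\<delta> \<le> (A v powr (\<gamma>/2 - 1)) powr (1 / (\<gamma>/2 - 1))"
      unfolding \<delta>_def using params gK by (intro powr_mono2) auto
    also have "\<dots> = A v" using params Av by (simp add: powr_powr)
    finally have "\<delta> \<le> (\<gamma> - 1) * \<theta> * C v" using AC by simp
    then show ?thesis using params by (simp add: divide_le_eq mult_ac)
  qed
  have "\<delta> / ((\<gamma> - 1) * \<theta>) \<le> C w"
    using Cge[OF u(1)] by (intro tendsto_lowerbound[OF r(5)]) auto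
  moreover have "0 < \<delta> / ((\<gamma> - 1) * \<theta>)" using \<delta> params by simp
  ultimately have Cw: "0 < C w" by linarith
  obtain \<tau>0 where \<tau>0: "0 < F w \<tau>0" using F_pos_ex[OF w C_pos_A_pos[OF w Cw]] by blast
  obtain \<tau>1 where t: "\<tau>0 < \<tau>1" "F w \<tau>1 = 0" "\<And>\<sigma>. \<tau>1 < \<sigma> \<Longrightarrow> F w \<sigma> < 0"
    "\<And>\<sigma>. \<tau>0 \<le> \<sigma> \<Longrightarrow> \<sigma> < \<tau>1 \<Longrightarrow> 0 < F w \<sigma>" using last_zero[OF w Cw \<tau>0] by metis
  define v where "v = S \<tau>1 w"
  have v: "v \<in> Wp" "v \<in> W" unfolding v_def using S_Wp[OF r(2)] S_W[OF w] by auto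
  have vM: "v \<in> Mminus" "F' v < 0" unfolding v_def using last_zero_Mminus[OF w Cw t(2,1) \<tau>0] by auto
  \<comment> \<open>From a point with \<open>F z\<close> positive on, \<open>F z\<close> is
    nonnegative up to 0 and nonpositive afterwards, so \<open>J\<close> peaks at
    \<open>z\<close>.\<close>
  have max_le: "J (S \<sigma> z) \<le> J z" if z: "z \<in> Mminus" and pos: "0 < F z \<sigma>'" and le: "\<sigma>' \<le> \<sigma>" for z \<sigma>' \<sigma>
  proof -
    have zW: "z \<in> W" and F0: "F z 0 = 0" and F'0: "F' z \<le> 0" using z unfolding Mminus_def by auto
    have right: "F z x \<le> 0" if "0 \<le> x" for x
      using F_tangent[OF zW, of x] F0 mult_nonpos_nonneg[OF F'0 that] by linarith
    have "\<sigma>' < 0" using right[of \<sigma>'] pos by force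
    have "J (S \<sigma> z) \<le> J (S 0 z)"
    proof (cases "\<sigma> \<le> 0")
      case True
      have "0 \<le> F z x" if "\<sigma> < x" "x < 0" for x
        using F_between_pos[OF zW, of \<sigma>' x 0] that le pos F0 by force
      then show ?thesis using True by (intro J_S_mono[OF zW]) auto
    next
      case False
      then show ?thesis using right by (intro J_S_antimono[OF zW]) auto
    qed
    then show ?thesis using J_S_0[OF zW] by simp
  qed
  \<comment> \<open>Eventually \<open>F (u (r n))\<close> is positive at \<open>\<tau>0\<close>, so
    rescaling by \<open>exp \<tau>1\<close> cannot raise the energy of \<open>u (r n)\<close>. In
    the limit the rescaled energies exceed \<open>J v\<close> by a nonnegative multiple of
    \<open>L - A w\<close>.\<close>
  have "J v \<le> c"
  proof -
    have "\<forall>\<^sub>F n in sequentially. 0 < F (u (r n)) \<tau>0"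
      using order_tendstoD(1)[OF F_tendsto[OF r(3,5-7), of \<tau>0]] \<tau>0 r(4) by simp
    then have ev: "\<forall>\<^sub>F n in sequentially. J (S \<tau>1 (u (r n))) \<le> J (u (r n))"
      by eventually_elim (use max_le[OF u(1)] t(1) in auto)
    have "(\<lambda>n. exp (2 * \<tau>1) * A (u (r n)) / 2 - \<theta> / \<gamma> * (exp (\<gamma> * \<tau>1) * C (u (r n)))
     - l / (1 - p) * (exp ((1 - p) * \<tau>1) * P (u (r n))) - l / (1 - q) * (exp ((1 - q) * \<tau>1) * Q (u (r n))))
      \<longlonglongrightarrow> exp (2 * \<tau>1) * L / 2 - \<theta> / \<gamma> * (exp (\<gamma> * \<tau>1) * C w)
     - l / (1 - p) * (exp ((1 - p) * \<tau>1) * P w) - l / (1 - q) * (exp ((1 - q) * \<tau>1) * Q w)"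
      by (intro tendsto_intros r) auto
    then have lim: "(\<lambda>n. J (S \<tau>1 (u (r n)))) \<longlonglongrightarrow> J v + exp (2 * \<tau>1) * (L - A w) / 2"
      unfolding v_def J_S[OF w] J_S[OF M(1)[OF u(1)]] by (simp add: algebra_simps diff_divide_distrib)
    have "J v + exp (2 * \<tau>1) * (L - A w) / 2 \<le> c"
      by (rule tendsto_le[OF _ LIMSEQ_subseq_LIMSEQ[OF u(2) r(1), unfolded o_def] lim ev]) simp
    moreover have "0 \<le> exp (2 * \<tau>1) * (L - A w) / 2" using r(4) by simp
    ultimately show ?thesis by linarith
  qed
  then have Jv: "J v = c" using c_le[OF vM(1)] by simp
  define d where "d = \<tau>1 - \<tau>0"
  have d: "d > 0" "\<And>\<sigma>. - d \<le> \<sigma> \<Longrightarrow> \<sigma> < 0 \<Longrightarrow> 0 < F v \<sigma>" "\<And>\<sigma>. 0 < \<sigma> \<Longrightarrow> F v \<sigma> < 0"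
    unfolding d_def v_def F_S[OF w] using t by (auto simp: mult_pos_neg)
  have "quasi_minimal v"
    unfolding quasi_minimal_def
  proof (intro allI impI)
    fix wn assume wn: "\<forall>n. wn n \<in> W" and cv: "conv wn v"
    have Flim: "(\<lambda>n. F (wn n) \<sigma>) \<longlonglongrightarrow> F v \<sigma>" for \<sigma>
      using F_tendsto[of wn "A v" v \<sigma>] cv unfolding conv_def by simp
    have Cpos: "\<forall>\<^sub>F n in sequentially. 0 < C (wn n)"
      using cv M(2)[OF vM(1)] order_tendstoD(1) unfolding conv_def by blast
    have Fpos: "\<forall>\<^sub>F n in sequentially. 0 < F (wn n) (- d)"
      using order_tendstoD(1)[OF Flim d(2)] d(1) by simp
    \<comment> \<open>\<open>\<sigma> n\<close> will be the last zero of \<open>F (wn n)\<close>,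
      the scale that brings the perturbed point back to \<open>Mminus\<close>. It tends to 0 because
      \<open>F (wn n)\<close> is eventually positive at \<open>- e'\<close> and negative at
      \<open>e'\<close>.\<close>
    define good where "good n \<sigma> \<longleftrightarrow> F (wn n) \<sigma> = 0 \<and> (\<forall>x>\<sigma>. F (wn n) x < 0) \<and>
      (\<forall>x. - d \<le> x \<longrightarrow> x < \<sigma> \<longrightarrow> 0 < F (wn n) x) \<and> S \<sigma> (wn n) \<in> Mminus" for n \<sigma>
    define \<sigma> where "\<sigma> n = (SOME x. good n x)" for n
    have ev: "\<forall>\<^sub>F n in sequentially. good n (\<sigma> n)"
      using Cpos Fpos
    proof eventually_elim
      case (elim n)
      obtain x where x: "- d < x" "F (wn n) x = 0" "\<And>y. x < y \<Longrightarrow> F (wn n) y < 0"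
        "\<And>y. - d \<le> y \<Longrightarrow> y < x \<Longrightarrow> 0 < F (wn n) y"
        using last_zero[OF _ elim] wn by metis
      then have "good n x" unfolding good_def using last_zero_Mminus[OF _ elim(1) x(2,1) elim(2)] wn by auto
      then show ?case unfolding \<sigma>_def by (rule someI)
    qed
    have lim: "\<sigma> \<longlonglongrightarrow> 0"
    proof (rule LIMSEQ_I)
      fix e :: real assume "e > 0"
      \<comment> \<open>Halving keeps \<open>- e'\<close> inside the interval on which
        \<open>F v\<close> is known to be positive.\<close>
      define e' where "e' = min e d / 2"
      have e': "0 < e'" "e' < e" "- d < - e'" unfolding e'_def using \<open>e > 0\<close> d(1) by auto
      have "\<forall>\<^sub>F n in sequentially. 0 < F (wn n) (- e')"
        using order_tendstoD(1)[OF Flim d(2)] e' by simp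
      moreover have "\<forall>\<^sub>F n in sequentially. F (wn n) e' < 0"
        using order_tendstoD(2)[OF Flim d(3)] e' by simp
      ultimately have "\<forall>\<^sub>F n in sequentially. norm (\<sigma> n - 0) < e"
        using ev
      proof eventually_elim
        case (elim n)
        have "- e' < \<sigma> n"
        proof (rule ccontr)
          assume "\<not> - e' < \<sigma> n"
          then have "F (wn n) (- e') \<le> 0" using elim(3) unfolding good_def
            by (metis less_eq_real_def linorder_not_less)
          then show False using elim(1) by simp
        qed
        moreover have "\<sigma> n \<le> e'"
        proof (rule ccontr)
          assume "\<not> \<sigma> n \<le> e'"
          then have "0 < F (wn n) e'" using elim(3) e' d(1) unfolding good_def by auto
          then show False using elim(2) by simp
        qed
        ultimately show ?case using e' by simp
      qed
      then show "\<exists>no. \<forall>n\<ge>no. norm (\<sigma> n - 0) < e" by (simp add: eventually_sequentially)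
    qed
    have "\<forall>\<^sub>F n in sequentially. - d < \<sigma> n" using order_tendstoD(1)[OF lim] d(1) by simp
    with ev have "\<forall>\<^sub>F n in sequentially. J (S (\<sigma> n) v) \<le> J (S (\<sigma> n) (wn n))"
    proof eventually_elim
      case (elim n)
      have "J (S (\<sigma> n) v) \<le> J v"
      proof (rule max_le[OF vM(1)])
        \<comment> \<open>A point of \<open>[- d, 0)\<close> not to the right of
          \<open>\<sigma> n\<close>, as \<open>max_le\<close> requires.\<close>
        show "0 < F v (max (- d) (min (\<sigma> n) (- d / 2)))" using d by (intro d(2)) auto
        show "max (- d) (min (\<sigma> n) (- d / 2)) \<le> \<sigma> n" using elim(2) by simp
      qed
      also have "\<dots> \<le> J (S (\<sigma> n) (wn n))" using Jv c_le elim(1) unfolding good_def by simp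
      finally show ?case .
    qed
    with lim show "\<exists>\<sigma>. \<sigma> \<longlonglongrightarrow> 0 \<and> (\<forall>\<^sub>F n in sequentially. J (S (\<sigma> n) v) \<le> J (S (\<sigma> n) (wn n)))" by blast
  qed
  moreover have "0 < A v" using C_pos_A_pos M[OF vM(1)] by blast
  ultimately show ?thesis using v vM by blast
qed

end

subsection \<open>Lebesgue measurability on the product\<close>

lemma fst_snd_borel_measurable [measurable]:
  "fst \<in> borel_measurable (borel :: ('a::euclidean_space \<times> 'b::euclidean_space) measure)"
  "snd \<in> borel_measurable (borel :: ('a::euclidean_space \<times> 'b::euclidean_space) measure)"
  by (intro borel_measurable_continuous_onI continuous_intros)+

text \<open>Elements of the spaces are only Lebesgue measurable, and the double integral lives on
  the completed product. Measurability between completions requires preimages of null sets to be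
  null, here that \<open>S \<times> UNIV\<close> is null.\<close>

lemma measurable_fst_lebesgue:
  "fst \<in> measurable (lebesgue :: ('a::euclidean_space \<times> 'b::euclidean_space) measure) lebesgue"
proof -
  have mf: "fst \<in> measurable (lborel :: ('a \<times> 'b) measure) (lborel :: 'a measure)"
    by (simp add: fst_snd_borel_measurable)
  have "null_sets (lborel :: 'a measure) \<subseteq> null_sets (distr (lebesgue :: ('a \<times> 'b) measure) lborel fst)"
  proof
    fix S :: "'a set" assume S: "S \<in> null_sets lborel"
    then have S': "S \<in> sets lborel" by auto
    have *: "fst -` S = S \<times> (UNIV :: 'b set)" by auto
    have "emeasure (lborel :: ('a \<times> 'b) measure) (S \<times> UNIV) = emeasure lborel S * emeasure lborel (UNIV :: 'b set)"
      unfolding lborel_prod[symmetric] using S' by (intro lborel.emeasure_pair_measure_Times) auto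
    also have "\<dots> = 0" using S by auto
    finally have 0: "emeasure (lborel :: ('a \<times> 'b) measure) (S \<times> UNIV) = 0" .
    have m: "S \<times> (UNIV::'b set) \<in> sets (lborel :: ('a \<times> 'b) measure)"
      unfolding lborel_prod[symmetric] using S' by auto
    have "emeasure (distr (lebesgue :: ('a \<times> 'b) measure) lborel fst) S = emeasure lebesgue (S \<times> (UNIV :: 'b set))"
      using S' measurable_completion[OF mf] by (subst emeasure_distr) (auto simp: *)
    also have "\<dots> = 0" using 0 m by simp
    finally show "S \<in> null_sets (distr (lebesgue :: ('a \<times> 'b) measure) lborel fst)"
      using S' by (auto intro: null_setsI)
  qed
  then show ?thesis
    using measurable_completion[OF mf] by (intro completion.measurable_completion2) auto
qed

lemma measurable_swap_lebesgue:
  "prod.swap \<in> measurable (lebesgue :: ('a::euclidean_space \<times> 'b::euclidean_space) measure) lebesgue"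
proof -
  have m: "prod.swap \<in> measurable (lborel :: ('a \<times> 'b) measure) (lborel :: ('b \<times> 'a) measure)"
    unfolding lborel_prod[symmetric] prod.swap_def by measurable
  have e: "distr (lborel :: ('a \<times> 'b) measure) lborel prod.swap = (lborel :: ('b \<times> 'a) measure)"
  proof -
    have "prod.swap = (\<lambda>(x :: 'a, y :: 'b). (y, x))" by auto
    then show ?thesis using lborel_pair.distr_pair_swap[where 'a='b and 'b='a, symmetric] by (simp only: lborel_prod)
  qed
  show ?thesis
  proof (intro completion.measurable_completion2 subsetI)
    show "prod.swap \<in> measurable (lebesgue :: ('a \<times> 'b) measure) (lborel :: ('b \<times> 'a) measure)"
      using m by (rule measurable_completion)
    fix S :: "('b \<times> 'a) set" assume S: "S \<in> null_sets lborel"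
    then have "S \<in> null_sets (distr (lborel :: ('a \<times> 'b) measure) lborel prod.swap)" using e by simp
    then show "S \<in> null_sets (distr (lebesgue :: ('a \<times> 'b) measure) lborel prod.swap)"
      by (simp add: distr_completion[OF m])
  qed
qed

lemma measurable_snd_lebesgue:
  "snd \<in> measurable (lebesgue :: ('a::euclidean_space \<times> 'b::euclidean_space) measure) lebesgue"
  using measurable_comp[OF measurable_swap_lebesgue measurable_fst_lebesgue]
  by (simp add: comp_def)

text \<open>For Borel functions, since Lebesgue measure on the product is the completion of the
  product measure; iterated integrals are therefore taken of Borel representatives.\<close>

lemma tonelli_lborel:
  fixes f :: "'a::euclidean_space \<times> 'b::euclidean_space \<Rightarrow> ennreal"
  assumes "f \<in> borel_measurable borel"
  shows "(\<integral>\<^sup>+z. f z \<partial>lborel) = (\<integral>\<^sup>+x. \<integral>\<^sup>+y. f (x, y) \<partial>lborel \<partial>lborel)"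
    "(\<integral>\<^sup>+z. f z \<partial>lborel) = (\<integral>\<^sup>+y. \<integral>\<^sup>+x. f (x, y) \<partial>lborel \<partial>lborel)"
proof -
  have m: "f \<in> borel_measurable (lborel \<Otimes>\<^sub>M lborel)" using assms by (simp add: lborel_prod)
  show "(\<integral>\<^sup>+z. f z \<partial>lborel) = (\<integral>\<^sup>+x. \<integral>\<^sup>+y. f (x, y) \<partial>lborel \<partial>lborel)"
    using lborel.nn_integral_fst[OF m] by (simp add: lborel_prod)
  show "(\<integral>\<^sup>+z. f z \<partial>lborel) = (\<integral>\<^sup>+y. \<integral>\<^sup>+x. f (x, y) \<partial>lborel \<partial>lborel)"
    using lborel_pair.nn_integral_snd[OF m] by (simp add: lborel_prod)
qed

lemma AE_lebesgue_fst:
  assumes "AE x in lebesgue. P x"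
  shows "AE z in (lebesgue :: ('a::euclidean_space \<times> 'b::euclidean_space) measure). P (fst z)"
proof -
  have "AE x in lborel. P x" using assms by (simp add: AE_completion_iff)
  then obtain N where N: "N \<in> null_sets lborel" "{x. \<not> P x} \<subseteq> N"
    unfolding eventually_ae_filter by auto
  have "emeasure (lborel :: ('a \<times> 'b) measure) (N \<times> UNIV) = emeasure lborel N * emeasure lborel (UNIV :: 'b set)"
    unfolding lborel_prod[symmetric] using N by (intro lborel.emeasure_pair_measure_Times) auto
  also have "\<dots> = 0" using N by auto
  finally have "N \<times> UNIV \<in> null_sets (lborel :: ('a \<times> 'b) measure)"
    using N(1) unfolding lborel_prod[symmetric] by (intro null_setsI) auto
  then have "AE z in (lborel :: ('a \<times> 'b) measure). P (fst z)"
    by (rule AE_I') (use N(2) in auto)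
  then show ?thesis by (rule AE_completion)
qed

lemma AE_lebesgue_snd:
  assumes "AE x in lebesgue. P x"
  shows "AE z in (lebesgue :: ('a::euclidean_space \<times> 'b::euclidean_space) measure). P (snd z)"
proof -
  have "AE x in lborel. P x" using assms by (simp add: AE_completion_iff)
  then obtain N where N: "N \<in> null_sets lborel" "{x. \<not> P x} \<subseteq> N"
    unfolding eventually_ae_filter by auto
  have "emeasure (lborel :: ('a \<times> 'b) measure) (UNIV \<times> N) = emeasure lborel (UNIV :: 'a set) * emeasure lborel N"
    unfolding lborel_prod[symmetric] using N by (intro lborel.emeasure_pair_measure_Times) auto
  also have "\<dots> = 0" using N by auto
  finally have "UNIV \<times> N \<in> null_sets (lborel :: ('a \<times> 'b) measure)"
    using N(1) unfolding lborel_prod[symmetric] by (intro null_setsI) auto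
  then have "AE z in (lborel :: ('a \<times> 'b) measure). P (snd z)"
    by (rule AE_I') (use N(2) in auto)
  then show ?thesis by (rule AE_completion)
qed

section \<open>Pointwise algebra of the Gagliardo quotient\<close>

lemma gagliardo_measurable [measurable]:
  assumes "u \<in> borel_measurable lebesgue" "\<phi> \<in> borel_measurable lebesgue"
  shows "gagliardo s u \<phi> \<in> borel_measurable lebesgue"
proof -
  have [measurable]: "(\<lambda>z. u (fst z)) \<in> borel_measurable lebesgue" "(\<lambda>z. u (snd z)) \<in> borel_measurable lebesgue"
    "(\<lambda>z. \<phi> (fst z)) \<in> borel_measurable lebesgue" "(\<lambda>z. \<phi> (snd z)) \<in> borel_measurable lebesgue"
    using assms measurable_compose[OF measurable_fst_lebesgue] measurable_compose[OF measurable_snd_lebesgue] by blast+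
  have "(\<lambda>z::(real^'n) \<times> (real^'n). norm (fst z - snd z) powr (real CARD('n) + 2 * s)) \<in> borel_measurable borel"
    by measurable
  then have [measurable]: "(\<lambda>z::(real^'n) \<times> (real^'n). norm (fst z - snd z) powr (real CARD('n) + 2 * s)) \<in> borel_measurable lebesgue"
    by (intro measurable_completion) simp
  show ?thesis unfolding gagliardo_def case_prod_beta by measurable
qed

text \<open>An exceptional set \<open>N\<close> in one variable affects the quotient only on
  \<open>N \<times> UNIV\<close> and \<open>UNIV \<times> N\<close>, which are null.\<close>

lemma gagliardo_AE_cong:
  assumes "AE x in lebesgue. u x = u' x" "AE x in lebesgue. \<phi> x = \<phi>' x"
  shows "AE z in lebesgue. gagliardo s u \<phi> z = gagliardo s u' \<phi>' z"
  using AE_lebesgue_fst[OF assms(1)] AE_lebesgue_snd[OF assms(1)] AE_lebesgue_fst[OF assms(2)] AE_lebesgue_snd[OF assms(2)]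
  by eventually_elim (simp add: gagliardo_def split_beta)

lemma gagliardo_nonneg: "0 \<le> gagliardo s u u z"
  by (cases z) (simp add: gagliardo_def)

lemma gagliardo_zero: "gagliardo s (\<lambda>x. 0) \<phi> = (\<lambda>z. 0)"
  by (auto simp: gagliardo_def)

lemma borel_representative:
  fixes u :: "'a::euclidean_space \<Rightarrow> real"
  assumes "u \<in> borel_measurable lebesgue"
  obtains u' where "u' \<in> borel_measurable borel" "AE x in lebesgue. u x = u' x"
proof -
  obtain u' where "u' \<in> borel_measurable lborel" "AE x in lborel. u x = u' x"
    using completion_ex_borel_measurable_real[of u lborel] assms by auto
  then show ?thesis using that by (auto intro: AE_completion)
qed

lemma abs_mult_le_squares: "\<bar>a * b\<bar> \<le> a\<^sup>2 + (b::real)\<^sup>2"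
proof -
  have "2 * (\<bar>a\<bar> * \<bar>b\<bar>) \<le> a\<^sup>2 + b\<^sup>2" using sum_squares_bound[of "\<bar>a\<bar>" "\<bar>b\<bar>"] by simp
  moreover have "0 \<le> \<bar>a\<bar> * \<bar>b\<bar>" by simp
  ultimately show ?thesis unfolding abs_mult by linarith
qed

lemma gagliardo_le: "\<bar>gagliardo s u \<phi> z\<bar> \<le> gagliardo s u u z + gagliardo s \<phi> \<phi> z"
proof -
  obtain x y where z: "z = (x, y)" by fastforce
  have "\<bar>gagliardo s u \<phi> z\<bar> = \<bar>(u x - u y) * (\<phi> x - \<phi> y)\<bar> / norm (x - y) powr (real CARD('a) + 2 * s)"
    unfolding gagliardo_def z by simp
  also have "\<dots> \<le> ((u x - u y)\<^sup>2 + (\<phi> x - \<phi> y)\<^sup>2) / norm (x - y) powr (real CARD('a) + 2 * s)"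
    by (intro divide_right_mono abs_mult_le_squares) simp
  finally show ?thesis unfolding gagliardo_def z by (simp add: add_divide_distrib power2_eq_square)
qed

lemma gagliardo_add_scale:
  "gagliardo s (\<lambda>x. u x + e * \<phi> x) (\<lambda>x. u x + e * \<phi> x) z
     = gagliardo s u u z + 2 * e * gagliardo s u \<phi> z + e\<^sup>2 * gagliardo s \<phi> \<phi> z"
proof -
  obtain x y where z: "z = (x, y)" by fastforce
  have *: "(u x + e * \<phi> x - (u y + e * \<phi> y)) * (u x + e * \<phi> x - (u y + e * \<phi> y)) =
    (u x - u y) * (u x - u y) + 2 * e * ((u x - u y) * (\<phi> x - \<phi> y)) + e\<^sup>2 * ((\<phi> x - \<phi> y) * (\<phi> x - \<phi> y))"
    by algebra
  show ?thesis unfolding z gagliardo_def using * by (simp add: add_divide_distrib)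
qed

lemma gagliardo_abs_le: "gagliardo s (\<lambda>x. \<bar>u x\<bar>) (\<lambda>x. \<bar>u x\<bar>) z \<le> gagliardo s u u z"
proof -
  obtain x y where z: "z = (x, y)" by fastforce
  have "\<bar>\<bar>u x\<bar> - \<bar>u y\<bar>\<bar> \<le> \<bar>u x - u y\<bar>" by simp
  then have "(\<bar>u x\<bar> - \<bar>u y\<bar>) * (\<bar>u x\<bar> - \<bar>u y\<bar>) \<le> (u x - u y) * (u x - u y)"
    unfolding power2_eq_square[symmetric] by (metis abs_le_square_iff)
  then show ?thesis unfolding z gagliardo_def by (simp add: divide_right_mono)
qed

subsection \<open>The spaces \<open>X1 s V\<close>\<close>

text \<open>One component of the system; instantiated once for each potential.\<close>

locale potential =
  fixes s :: real and V :: "real^'n \<Rightarrow> real" and V0 :: real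
  assumes s: "0 < s" "s < 1" "real CARD('n) > 2 * s"
    and V_cont: "continuous_on UNIV V" and V0: "V0 > 0" "\<And>x. V x \<ge> V0"
    and V_finite: "\<And>M. M > 0 \<Longrightarrow> emeasure lebesgue {x. V x \<le> M} < \<infinity>"
begin

lemma V_borel [measurable]: "V \<in> borel_measurable borel"
  using V_cont by (rule borel_measurable_continuous_onI)

lemma V_lebesgue [measurable]: "V \<in> borel_measurable lebesgue"
  using V_borel by (intro measurable_completion) simp

lemma V_nonneg: "0 \<le> V x"
  using V0 by (meson less_imp_le order_trans)

lemma X1_iff: "u \<in> X1 s V \<longleftrightarrow> u \<in> borel_measurable lebesgue \<and> integrable lebesgue (\<lambda>x. (u x)\<^sup>2) \<and>
    integrable lebesgue (gagliardo s u u) \<and> integrable lebesgue (\<lambda>x. V x * (u x)\<^sup>2)"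
  unfolding X1_def Hs_def Lp_def by (auto simp: powr_numeral)

lemma X1_D:
  assumes "u \<in> X1 s V"
  shows "u \<in> borel_measurable lebesgue" "integrable lebesgue (\<lambda>x. (u x)\<^sup>2)"
    "integrable lebesgue (gagliardo s u u)" "integrable lebesgue (\<lambda>x. V x * (u x)\<^sup>2)"
  using assms X1_iff by auto

definition form :: "(real^'n \<Rightarrow> real) \<Rightarrow> (real^'n \<Rightarrow> real) \<Rightarrow> real" where
  "form u \<phi> = integral\<^sup>L lebesgue (gagliardo s u \<phi>) + (LINT x|lebesgue. V x * u x * \<phi> x)"

lemma form_integrable:
  assumes "u \<in> X1 s V" "\<phi> \<in> X1 s V"
  shows "integrable lebesgue (gagliardo s u \<phi>)" "integrable lebesgue (\<lambda>x. V x * u x * \<phi> x)"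
proof -
  note [measurable] = X1_D(1)[OF assms(1)] X1_D(1)[OF assms(2)]
  show "integrable lebesgue (gagliardo s u \<phi>)"
    using Bochner_Integration.integrable_add[OF X1_D(3)[OF assms(1)] X1_D(3)[OF assms(2)]]
    by (rule Bochner_Integration.integrable_bound) (use gagliardo_le[of s u \<phi>] in \<open>auto simp: gagliardo_nonneg\<close>)
  show "integrable lebesgue (\<lambda>x. V x * u x * \<phi> x)"
    using Bochner_Integration.integrable_add[OF X1_D(4)[OF assms(1)] X1_D(4)[OF assms(2)]]
  proof (rule Bochner_Integration.integrable_bound, measurable, intro AE_I2)
    fix x
    have "norm (V x * u x * \<phi> x) = V x * \<bar>u x * \<phi> x\<bar>" using V_nonneg by (simp add: abs_mult)
    also have "\<dots> \<le> V x * ((u x)\<^sup>2 + (\<phi> x)\<^sup>2)"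
      using V_nonneg abs_mult_le_squares by (intro mult_left_mono)
    also have "\<dots> \<le> norm (V x * (u x)\<^sup>2 + V x * (\<phi> x)\<^sup>2)" by (simp add: distrib_left)
    finally show "norm (V x * u x * \<phi> x) \<le> norm (V x * (u x)\<^sup>2 + V x * (\<phi> x)\<^sup>2)" .
  qed
qed

text \<open>\<open>V \<ge> V0 > 0\<close> turns the weighted bound into square
  integrability.\<close>

lemma X1_I:
  assumes "u \<in> borel_measurable lebesgue" "integrable lebesgue (gagliardo s u u)"
    "integrable lebesgue (\<lambda>x. V x * (u x)\<^sup>2)"
  shows "u \<in> X1 s V"
proof -
  note [measurable] = assms(1)
  have "integrable lebesgue (\<lambda>x. (u x)\<^sup>2)"
    using integrable_mult_left[OF assms(3), of "1 / V0"]
  proof (rule Bochner_Integration.integrable_bound, measurable, intro AE_I2)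
    fix x
    have "V0 * (u x)\<^sup>2 \<le> V x * (u x)\<^sup>2" using V0 by (intro mult_right_mono) auto
    then have "(u x)\<^sup>2 \<le> V x * (u x)\<^sup>2 / V0" using V0(1) by (simp add: field_simps)
    also have "\<dots> \<le> norm (V x * (u x)\<^sup>2 * (1 / V0))" using V0(1) V_nonneg by (simp add: abs_mult)
    finally show "norm ((u x)\<^sup>2) \<le> norm (V x * (u x)\<^sup>2 * (1 / V0))" by simp
  qed
  then show ?thesis using assms X1_iff by blast
qed

lemma X1_add_scale:
  assumes "u \<in> X1 s V" "\<phi> \<in> X1 s V"
  shows "(\<lambda>x. u x + e * \<phi> x) \<in> X1 s V"
proof (rule X1_I)
  note [measurable] = X1_D(1)[OF assms(1)] X1_D(1)[OF assms(2)]
  show "(\<lambda>x. u x + e * \<phi> x) \<in> borel_measurable lebesgue" by measurable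
  show "integrable lebesgue (gagliardo s (\<lambda>x. u x + e * \<phi> x) (\<lambda>x. u x + e * \<phi> x))"
    unfolding gagliardo_add_scale[abs_def]
    using X1_D(3)[OF assms(1)] X1_D(3)[OF assms(2)] form_integrable(1)[OF assms] by simp
  have "(\<lambda>x. V x * (u x + e * \<phi> x)\<^sup>2) = (\<lambda>x. V x * (u x)\<^sup>2 + (2 * e) * (V x * u x * \<phi> x) + e\<^sup>2 * (V x * (\<phi> x)\<^sup>2))"
    by (auto simp: power2_eq_square algebra_simps)
  then show "integrable lebesgue (\<lambda>x. V x * (u x + e * \<phi> x)\<^sup>2)"
    using X1_D(4)[OF assms(1)] X1_D(4)[OF assms(2)] form_integrable(2)[OF assms] by simp
qed

lemma form_add_scale:
  assumes "u \<in> X1 s V" "\<phi> \<in> X1 s V"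
  shows "form (\<lambda>x. u x + e * \<phi> x) (\<lambda>x. u x + e * \<phi> x) = form u u + 2 * e * form u \<phi> + e\<^sup>2 * form \<phi> \<phi>"
proof -
  note i = X1_D(3)[OF assms(1)] X1_D(3)[OF assms(2)] form_integrable(1)[OF assms]
  note j = form_integrable(2)[OF assms(1,1)] form_integrable(2)[OF assms(2,2)] form_integrable(2)[OF assms]
  have "(\<lambda>x. V x * (u x + e * \<phi> x) * (u x + e * \<phi> x)) =
     (\<lambda>x. V x * u x * u x + (2 * e) * (V x * u x * \<phi> x) + e\<^sup>2 * (V x * \<phi> x * \<phi> x))"
    by (auto simp: power2_eq_square algebra_simps)
  moreover have "gagliardo s (\<lambda>x. u x + e * \<phi> x) (\<lambda>x. u x + e * \<phi> x) =
     (\<lambda>z. gagliardo s u u z + 2 * e * gagliardo s u \<phi> z + e\<^sup>2 * gagliardo s \<phi> \<phi> z)"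
    by (rule ext) (rule gagliardo_add_scale)
  ultimately show ?thesis unfolding form_def using i j by (simp add: distrib_left)
qed

lemma X1_zero: "(\<lambda>x. 0) \<in> X1 s V"
  by (rule X1_I) (auto simp: gagliardo_zero)

lemma form_zero: "form (\<lambda>x. 0) \<phi> = 0"
  unfolding form_def by (simp add: gagliardo_zero)

lemma X1_scale: assumes "u \<in> X1 s V" shows "(\<lambda>x. t * u x) \<in> X1 s V"
  using X1_add_scale[OF X1_zero assms, of t] by simp

lemma form_scale: assumes "u \<in> X1 s V" shows "form (\<lambda>x. t * u x) (\<lambda>x. t * u x) = t\<^sup>2 * form u u"
  using form_add_scale[OF X1_zero assms, of t] form_zero by simp

lemma X1_diff: "u \<in> X1 s V \<Longrightarrow> v \<in> X1 s V \<Longrightarrow> (\<lambda>x. u x - v x) \<in> X1 s V"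
  using X1_add_scale[of u v "-1"] by simp

lemma form_nonneg: "0 \<le> form u u"
  unfolding form_def using V_nonneg
  by (auto intro!: add_nonneg_nonneg Bochner_Integration.integral_nonneg simp: gagliardo_nonneg mult.assoc)

text \<open>The parallelogram law with its nonnegative second term dropped.\<close>

lemma form_diff_le:
  assumes "u \<in> X1 s V" "v \<in> X1 s V"
  shows "form (\<lambda>x. u x - v x) (\<lambda>x. u x - v x) \<le> 2 * (form u u + form v v)"
  using form_add_scale[OF assms, of "-1"] form_add_scale[OF assms, of 1]
    form_nonneg[of "\<lambda>x. u x + v x"] by simp

lemma X1_abs: assumes "u \<in> X1 s V" shows "(\<lambda>x. \<bar>u x\<bar>) \<in> X1 s V"
proof (rule X1_I)
  note [measurable] = X1_D(1)[OF assms(1)]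
  show "(\<lambda>x. \<bar>u x\<bar>) \<in> borel_measurable lebesgue" by measurable
  then show "integrable lebesgue (gagliardo s (\<lambda>x. \<bar>u x\<bar>) (\<lambda>x. \<bar>u x\<bar>))"
    using X1_D(3)[OF assms] gagliardo_abs_le[of s u]
    by (intro Bochner_Integration.integrable_bound[OF X1_D(3)[OF assms]]) (auto simp: gagliardo_nonneg)
  show "integrable lebesgue (\<lambda>x. V x * \<bar>u x\<bar>\<^sup>2)" using X1_D(4)[OF assms] by simp
qed

lemma X1_AE_cong:
  assumes "u \<in> X1 s V" "u' \<in> borel_measurable lebesgue" "AE x in lebesgue. u x = u' x"
  shows "u' \<in> X1 s V"
proof (rule X1_I[OF assms(2)])
  note [measurable] = X1_D(1)[OF assms(1)] assms(2)
  show "integrable lebesgue (gagliardo s u' u')"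
    using X1_D(3)[OF assms(1)]
    by (rule integrable_cong_AE_imp) (use gagliardo_AE_cong[OF assms(3,3), of s] in \<open>auto\<close>)
  have "AE x in lebesgue. V x * (u' x)\<^sup>2 = V x * (u x)\<^sup>2" using assms(3) by eventually_elim simp
  then show "integrable lebesgue (\<lambda>x. V x * (u' x)\<^sup>2)"
    by (intro integrable_cong_AE_imp[OF X1_D(4)[OF assms(1)]] borel_measurable_times borel_measurable_power
      assms(2) V_lebesgue) (auto elim!: eventually_mono)
qed

lemma form_AE_cong:
  assumes "u \<in> borel_measurable lebesgue" "u' \<in> borel_measurable lebesgue" "AE x in lebesgue. u x = u' x"
  shows "form u u = form u' u'"
proof -
  note [measurable] = assms(1,2)
  have "AE x in lebesgue. V x * u x * u x = V x * u' x * u' x" using assms(3) by eventually_elim simp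
  then have "(LINT x|lebesgue. V x * u x * u x) = (LINT x|lebesgue. V x * u' x * u' x)"
    by (intro integral_cong_AE) measurable
  moreover have "integral\<^sup>L lebesgue (gagliardo s u u) = integral\<^sup>L lebesgue (gagliardo s u' u')"
    by (intro integral_cong_AE gagliardo_AE_cong assms) measurable
  ultimately show ?thesis unfolding form_def by simp
qed

lemma form_bounds:
  assumes "u \<in> X1 s V" "form u u \<le> B"
  shows "(\<integral>\<^sup>+z. ennreal (gagliardo s u u z) \<partial>lborel) \<le> ennreal B"
    "(\<integral>\<^sup>+x. ennreal (V x * (u x)\<^sup>2) \<partial>lborel) \<le> ennreal B"
    "(\<integral>\<^sup>+x. ennreal ((u x)\<^sup>2) \<partial>lborel) \<le> ennreal (B / V0)"
proof -
  have nn: "0 \<le> integral\<^sup>L lebesgue (gagliardo s u u)" "0 \<le> (LINT x|lebesgue. V x * (u x)\<^sup>2)"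
    using V_nonneg by (auto intro!: Bochner_Integration.integral_nonneg simp: gagliardo_nonneg)
  have le: "integral\<^sup>L lebesgue (gagliardo s u u) \<le> B" "(LINT x|lebesgue. V x * (u x)\<^sup>2) \<le> B"
    using assms(2) nn unfolding form_def by (auto simp: power2_eq_square mult.assoc)
  have e: "(\<integral>\<^sup>+z. ennreal (gagliardo s u u z) \<partial>lborel) = ennreal (integral\<^sup>L lebesgue (gagliardo s u u))"
    using nn_integral_eq_integral[OF X1_D(3)[OF assms(1)]] by (simp add: gagliardo_nonneg nn_integral_completion)
  then show "(\<integral>\<^sup>+z. ennreal (gagliardo s u u z) \<partial>lborel) \<le> ennreal B" using le by (simp add: ennreal_leI)
  have e2: "(\<integral>\<^sup>+x. ennreal (V x * (u x)\<^sup>2) \<partial>lborel) = ennreal (LINT x|lebesgue. V x * (u x)\<^sup>2)"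
    using nn_integral_eq_integral[OF X1_D(4)[OF assms(1)]] V_nonneg by (simp add: nn_integral_completion)
  then show *: "(\<integral>\<^sup>+x. ennreal (V x * (u x)\<^sup>2) \<partial>lborel) \<le> ennreal B" using le by (simp add: ennreal_leI)
  have "(LINT x|lebesgue. V0 * (u x)\<^sup>2) \<le> (LINT x|lebesgue. V x * (u x)\<^sup>2)"
    using X1_D[OF assms(1)] V0 by (intro integral_mono) (auto intro!: mult_right_mono)
  then have "(LINT x|lebesgue. (u x)\<^sup>2) \<le> B / V0" using le V0(1) by (simp add: field_simps)
  moreover have "(\<integral>\<^sup>+x. ennreal ((u x)\<^sup>2) \<partial>lborel) = ennreal (LINT x|lebesgue. (u x)\<^sup>2)"
    using nn_integral_eq_integral[OF X1_D(2)[OF assms(1)]] by (simp add: nn_integral_completion)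
  ultimately show "(\<integral>\<^sup>+x. ennreal ((u x)\<^sup>2) \<partial>lborel) \<le> ennreal (B / V0)" by (simp add: ennreal_leI)
qed

end

subsection \<open>Cut-off functions\<close>

lemma ennreal_le_suminf: "f k \<le> (\<Sum>k. f k)" for f :: "nat \<Rightarrow> ennreal"
  using sum_le_suminf[of f "{k}"] by simp

lemma emeasure_cball_vec:
  fixes x :: "real^'n" assumes "r \<ge> 0"
  shows "emeasure lborel (cball x r) = ennreal (unit_ball_vol (real CARD('n)) * r powr real CARD('n))"
proof (cases "r = 0")
  case False
  then show ?thesis using emeasure_cball[OF assms, of x] assms by (simp add: powr_realpow)
qed (use emeasure_cball[of 0 x] in \<open>simp add: power_0_left\<close>)

lemma two_powr_floor:
  fixes d :: real assumes "d \<ge> 1"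
  obtains k :: nat where "2 powr real k \<le> d" "d \<le> 2 powr (real k + 1)"
proof
  have l: "0 \<le> log 2 d" using assms by simp
  have d: "d = 2 powr log 2 d" using assms by simp
  have k: "real (nat \<lfloor>log 2 d\<rfloor>) = of_int \<lfloor>log 2 d\<rfloor>" using l by simp
  have "2 powr real (nat \<lfloor>log 2 d\<rfloor>) \<le> 2 powr log 2 d" unfolding k by simp
  then show "2 powr real (nat \<lfloor>log 2 d\<rfloor>) \<le> d" using d by simp
  have "2 powr log 2 d \<le> 2 powr (real (nat \<lfloor>log 2 d\<rfloor>) + 1)" unfolding k by (intro powr_mono) (linarith, simp)
  then show "d \<le> 2 powr (real (nat \<lfloor>log 2 d\<rfloor>) + 1)" using d by simp
qed

text \<open>Dyadic shells around \<open>x\<close>. Beyond distance 1 the numerator is at most R^2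
  and the shells sum with ratio \<open>2 powr (- 2 * s)\<close>; within distance 1 it is at most the
  squared distance, and the ratio is \<open>2 powr (- (2 - 2 * s))\<close>. Both ratios are below 1
  because 0 < s < 1.\<close>

lemma kernel_bound:
  assumes "0 < s" "s < 1"
  obtains K :: real where "K \<ge> 0"
    "\<And>x :: real^'n. (\<integral>\<^sup>+y. ennreal (min ((norm (x - y))\<^sup>2) (R\<^sup>2) / norm (x - y) powr (real CARD('n) + 2 * s)) \<partial>lborel) \<le> ennreal K"
proof -
  define N where "N = real CARD('n)"
  define \<omega> where "\<omega> = unit_ball_vol N"
  have N: "N > 0" unfolding N_def by simp
  have \<omega>: "\<omega> \<ge> 0" unfolding \<omega>_def N_def by simp
  \<comment> \<open>\<open>c1 k\<close> and \<open>c2 k\<close> bound the integrand on the k-th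
    outer and inner shell; \<open>r1 k\<close> and \<open>r2 k\<close> are radii of balls containing
    these shells.\<close>
  define c1 where "c1 k = R\<^sup>2 * 2 powr (- real k * (N + 2 * s))" for k :: nat
  define c2 where "c2 k = 2 powr (- 2 * real k) * 2 powr ((real k + 1) * (N + 2 * s))" for k :: nat
  define r1 where "r1 k = 2 powr (real k + 1)" for k :: nat
  define r2 where "r2 k = 2 powr (- real k)" for k :: nat
  have r: "r1 k \<ge> 0" "r2 k \<ge> 0" "c1 k \<ge> 0" "c2 k \<ge> 0" for k unfolding r1_def r2_def c1_def c2_def by simp_all
  have g1: "c1 k * (\<omega> * r1 k powr N) = (R\<^sup>2 * \<omega> * 2 powr N) * (2 powr (- 2 * s)) ^ k" for k
  proof -
    have "2 powr (- real k * (N + 2 * s)) * r1 k powr N = 2 powr (N + (- 2 * s) * real k)"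
      unfolding r1_def powr_powr powr_add[symmetric] by (simp add: algebra_simps)
    also have "\<dots> = 2 powr N * (2 powr (- 2 * s)) ^ k"
      unfolding powr_add powr_powr[symmetric] by (simp add: powr_realpow)
    finally show ?thesis unfolding c1_def by (simp add: mult_ac)
  qed
  have g2: "c2 k * (\<omega> * r2 k powr N) = (\<omega> * 2 powr (N + 2 * s)) * (2 powr (- (2 - 2 * s))) ^ k" for k
  proof -
    have "c2 k * r2 k powr N = 2 powr ((N + 2 * s) + (- (2 - 2 * s)) * real k)"
      unfolding c2_def r2_def powr_powr powr_add[symmetric] by (simp add: algebra_simps)
    also have "\<dots> = 2 powr (N + 2 * s) * (2 powr (- (2 - 2 * s))) ^ k"
      unfolding powr_add[of 2 "N + 2 * s"] powr_powr[symmetric] by (simp add: powr_realpow)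
    finally show ?thesis by (simp add: mult_ac)
  qed
  have q: "2 powr (- 2 * s) < 1" "2 powr (- (2 - 2 * s)) < 1"
    using assms powr_less_mono[of _ 0 2] by fastforce+
  have s1: "summable (\<lambda>k. c1 k * (\<omega> * r1 k powr N))" unfolding g1 using q by (intro summable_mult summable_geometric) auto
  have s2: "summable (\<lambda>k. c2 k * (\<omega> * r2 k powr N))" unfolding g2 using q by (intro summable_mult summable_geometric) auto
  define K where "K = (\<Sum>k. c1 k * (\<omega> * r1 k powr N)) + (\<Sum>k. c2 k * (\<omega> * r2 k powr N))"
  have p1: "0 \<le> c1 k * (\<omega> * r1 k powr N)" and p2: "0 \<le> c2 k * (\<omega> * r2 k powr N)" for k using r \<omega> by simp_all
  have K0: "0 \<le> (\<Sum>k. c1 k * (\<omega> * r1 k powr N))" "0 \<le> (\<Sum>k. c2 k * (\<omega> * r2 k powr N))"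
    using suminf_nonneg[OF s1 p1] suminf_nonneg[OF s2 p2] by auto
  show ?thesis
  proof (rule that[of K])
    show "K \<ge> 0" unfolding K_def using K0 by simp
    fix x :: "real^'n"
    let ?t1 = "\<lambda>y k. ennreal (c1 k) * indicator (cball x (r1 k)) y"
    let ?t2 = "\<lambda>y k. ennreal (c2 k) * indicator (cball x (r2 k)) y"
    have pt: "ennreal (min ((norm (x - y))\<^sup>2) (R\<^sup>2) / norm (x - y) powr (N + 2 * s))
      \<le> (\<Sum>k. ?t1 y k) + (\<Sum>k. ?t2 y k)" for y
    proof -
      define d where "d = norm (x - y)"
      consider "d = 0" | "d \<ge> 1" | "0 < d" "d < 1" unfolding d_def by fastforce
      then have "ennreal (min (d\<^sup>2) (R\<^sup>2) / d powr (N + 2 * s)) \<le> (\<Sum>k. ?t1 y k) + (\<Sum>k. ?t2 y k)"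
      proof cases
        case 2
        then obtain k :: nat where k: "2 powr real k \<le> d" "d \<le> 2 powr (real k + 1)" using two_powr_floor by blast
        have "min (d\<^sup>2) (R\<^sup>2) / d powr (N + 2 * s) \<le> R\<^sup>2 / (2 powr real k) powr (N + 2 * s)"
          using k N assms by (intro frac_le powr_mono2) auto
        also have "\<dots> = c1 k" unfolding c1_def powr_powr by (simp add: powr_minus divide_inverse)
        finally have "ennreal (min (d\<^sup>2) (R\<^sup>2) / d powr (N + 2 * s)) \<le> ?t1 y k"
          using k(2) by (simp add: d_def r1_def dist_norm ennreal_leI)
        also have "\<dots> \<le> (\<Sum>k. ?t1 y k)" by (rule ennreal_le_suminf)
        finally show ?thesis by (simp add: add_increasing2)
      next
        case 3
        then have "1 \<le> 1 / d" by simp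
        then obtain k :: nat where k: "2 powr real k \<le> 1 / d" "1 / d \<le> 2 powr (real k + 1)"
          using two_powr_floor by blast
        have k': "d \<le> r2 k" "2 powr (- (real k + 1)) \<le> d"
          using le_imp_inverse_le[OF k(1)] le_imp_inverse_le[OF k(2)] 3
          unfolding r2_def powr_minus[of 2 "real k"] powr_minus[of 2 "real k + 1"] by simp_all
        have "min (d\<^sup>2) (R\<^sup>2) / d powr (N + 2 * s) \<le> (r2 k)\<^sup>2 / (2 powr (- (real k + 1))) powr (N + 2 * s)"
        proof (intro frac_le powr_mono2)
          show "min (d\<^sup>2) (R\<^sup>2) \<le> (r2 k)\<^sup>2" using k'(1) 3 by (intro min.coboundedI1 power_mono) auto
        qed (use k' N assms in auto)
        also have "\<dots> = c2 k"
        proof -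
          have "(r2 k)\<^sup>2 = 2 powr (- 2 * real k)"
            unfolding r2_def power2_eq_square powr_add[symmetric] by simp
          moreover have "(2 powr (- (real k + 1))) powr (N + 2 * s) = inverse (2 powr ((real k + 1) * (N + 2 * s)))"
            unfolding powr_powr powr_minus[symmetric] by (simp only: minus_mult_left)
          ultimately show ?thesis unfolding c2_def by (simp add: divide_inverse)
        qed
        finally have "ennreal (min (d\<^sup>2) (R\<^sup>2) / d powr (N + 2 * s)) \<le> ?t2 y k"
          using k'(1) by (simp add: d_def dist_norm ennreal_leI)
        also have "\<dots> \<le> (\<Sum>k. ?t2 y k)" by (rule ennreal_le_suminf)
        finally show ?thesis by (simp add: add_increasing)
      qed simp
      then show ?thesis unfolding d_def .
    qed
    have i1: "(\<integral>\<^sup>+y. ?t1 y k \<partial>lborel) = ennreal (c1 k * (\<omega> * r1 k powr N))" for k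
      using r \<omega> by (subst nn_integral_cmult_indicator) (auto simp: emeasure_cball_vec \<omega>_def N_def ennreal_mult')
    have i2: "(\<integral>\<^sup>+y. ?t2 y k \<partial>lborel) = ennreal (c2 k * (\<omega> * r2 k powr N))" for k
      using r \<omega> by (subst nn_integral_cmult_indicator) (auto simp: emeasure_cball_vec \<omega>_def N_def ennreal_mult')
    have [measurable]: "cball x r \<in> sets borel" for r by simp
    have "(\<integral>\<^sup>+y. ennreal (min ((norm (x - y))\<^sup>2) (R\<^sup>2) / norm (x - y) powr (N + 2 * s)) \<partial>lborel)
       \<le> (\<integral>\<^sup>+y. (\<Sum>k. ?t1 y k) + (\<Sum>k. ?t2 y k) \<partial>lborel)"
      by (intro nn_integral_mono pt)
    also have "\<dots> = (\<Sum>k. \<integral>\<^sup>+y. ?t1 y k \<partial>lborel) + (\<Sum>k. \<integral>\<^sup>+y. ?t2 y k \<partial>lborel)"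
      by (subst nn_integral_add) (auto simp: nn_integral_suminf)
    also have "\<dots> = ennreal K"
      unfolding i1 i2 K_def suminf_ennreal2[OF p1 s1] suminf_ennreal2[OF p2 s2]
      by (rule ennreal_plus[OF K0, symmetric])
    finally show "(\<integral>\<^sup>+y. ennreal (min ((norm (x - y))\<^sup>2) (R\<^sup>2) / norm (x - y) powr (real CARD('n) + 2 * s)) \<partial>lborel) \<le> ennreal K"
      unfolding N_def .
  qed
qed

text \<open>A Lipschitz tent of compact support. One tent provides a pair with positive coupling;
  the tents of integer radius are the test functions of the positivity argument.\<close>

definition bump :: "real \<Rightarrow> real^'n \<Rightarrow> real" where
  "bump R x = max 0 (R - norm x)"

lemma bump_borel [measurable]: "bump R \<in> borel_measurable borel"
  unfolding bump_def[abs_def] by measurable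

text \<open>The tent is 1-Lipschitz with values in \<open>[0, \<bar>R\<bar>]\<close>, so its
  quotient is at most the kernel of \<open>kernel_bound\<close>, and it vanishes unless one of the
  two points lies in a fixed ball. In each of the two cases the other variable is integrated
  first.\<close>

lemma bump_gagliardo_finite:
  assumes "0 < s" "s < 1"
  shows "(\<integral>\<^sup>+z. ennreal (gagliardo s (bump R) (bump R :: real^'n \<Rightarrow> real) z) \<partial>lborel) < \<infinity>"
proof -
  obtain K where K: "K \<ge> 0"
    "\<And>x :: real^'n. (\<integral>\<^sup>+y. ennreal (min ((norm (x - y))\<^sup>2) (R\<^sup>2) / norm (x - y) powr (real CARD('n) + 2 * s)) \<partial>lborel) \<le> ennreal K"
    using kernel_bound[OF assms] by blast
  define B where "B = cball (0 :: real^'n) \<bar>R\<bar>"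
  define \<kappa> where "\<kappa> = (\<lambda>z::(real^'n) \<times> (real^'n). ennreal (min ((norm (fst z - snd z))\<^sup>2) (R\<^sup>2) / norm (fst z - snd z) powr (real CARD('n) + 2 * s)))"
  have [measurable]: "\<kappa> \<in> borel_measurable borel" "B \<in> sets borel"
    subgoal unfolding \<kappa>_def by measurable
    subgoal unfolding B_def by simp
    done
  have K': "(\<integral>\<^sup>+y. \<kappa> (x, y) \<partial>lborel) \<le> ennreal K" "(\<integral>\<^sup>+y. \<kappa> (y, x) \<partial>lborel) \<le> ennreal K" for x
    using K(2)[of x] unfolding \<kappa>_def by (simp_all add: norm_minus_commute)
  have pt: "ennreal (gagliardo s (bump R) (bump R) (x, y)) \<le> indicator B x * \<kappa> (x, y) + indicator B y * \<kappa> (x, y)" for x y :: "real^'n"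
  proof (cases "x \<in> B \<or> y \<in> B")
    case True
    define D where "D = \<bar>bump R x - bump R y\<bar>"
    have "norm x - norm y \<le> norm (x - y)" "norm y - norm x \<le> norm (x - y)"
      using norm_triangle_ineq2[of x y] norm_triangle_ineq2[of y x] by (simp_all add: norm_minus_commute)
    then have "D \<le> norm (x - y)" unfolding D_def bump_def by (auto simp: max_def)
    have "0 \<le> bump R w \<and> bump R w \<le> \<bar>R\<bar>" for w :: "real^'n"
      unfolding bump_def using norm_ge_zero[of w] by linarith
    from this[of x] this[of y] have "D \<le> \<bar>R\<bar>" unfolding D_def by linarith
    have "D\<^sup>2 \<le> (norm (x - y))\<^sup>2" "D\<^sup>2 \<le> R\<^sup>2" using \<open>D \<le> norm (x - y)\<close> unfolding D_def
      by (metis abs_ge_zero power_mono) (metis D_def \<open>D \<le> \<bar>R\<bar>\<close> abs_idempotent abs_le_square_iff)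
    then have "gagliardo s (bump R) (bump R) (x, y) \<le> min ((norm (x - y))\<^sup>2) (R\<^sup>2) / norm (x - y) powr (real CARD('n) + 2 * s)"
      unfolding gagliardo_def D_def by (auto intro!: divide_right_mono simp: power2_eq_square)
    then have "ennreal (gagliardo s (bump R) (bump R) (x, y)) \<le> \<kappa> (x, y)" unfolding \<kappa>_def by (simp add: ennreal_leI)
    then show ?thesis using True by (auto simp: indicator_def add_increasing add_increasing2)
  next
    case False
    then have "bump R x = 0" "bump R y = 0" unfolding B_def bump_def by auto
    then show ?thesis by (simp add: gagliardo_def)
  qed
  have "(\<integral>\<^sup>+z. ennreal (gagliardo s (bump R) (bump R :: real^'n \<Rightarrow> real) z) \<partial>lborel)
    \<le> (\<integral>\<^sup>+z. indicator B (fst z) * \<kappa> z + indicator B (snd z) * \<kappa> z \<partial>lborel)"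
    by (intro nn_integral_mono) (use pt in auto)
  also have "\<dots> = (\<integral>\<^sup>+z. indicator B (fst z) * \<kappa> z \<partial>lborel) + (\<integral>\<^sup>+z. indicator B (snd z) * \<kappa> z \<partial>lborel)"
    by (intro nn_integral_add) measurable
  also have "(\<integral>\<^sup>+z. indicator B (fst z) * \<kappa> z \<partial>lborel) = (\<integral>\<^sup>+x. \<integral>\<^sup>+y. indicator B x * \<kappa> (x, y) \<partial>lborel \<partial>lborel)"
    by (subst tonelli_lborel(1)) simp_all
  also have "\<dots> = (\<integral>\<^sup>+x. indicator B x * (\<integral>\<^sup>+y. \<kappa> (x, y) \<partial>lborel) \<partial>lborel)"
    by (intro nn_integral_cong nn_integral_cmult) measurable
  also have "(\<integral>\<^sup>+z. indicator B (snd z) * \<kappa> z \<partial>lborel) = (\<integral>\<^sup>+y. \<integral>\<^sup>+x. indicator B y * \<kappa> (x, y) \<partial>lborel \<partial>lborel)"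
    by (subst tonelli_lborel(2)) simp_all
  also have "\<dots> = (\<integral>\<^sup>+y. indicator B y * (\<integral>\<^sup>+x. \<kappa> (x, y) \<partial>lborel) \<partial>lborel)"
    by (intro nn_integral_cong nn_integral_cmult) measurable
  also have "(\<integral>\<^sup>+x. indicator B x * (\<integral>\<^sup>+y. \<kappa> (x, y) \<partial>lborel) \<partial>lborel) + (\<integral>\<^sup>+y. indicator B y * (\<integral>\<^sup>+x. \<kappa> (x, y) \<partial>lborel) \<partial>lborel)
    \<le> (\<integral>\<^sup>+x. indicator B x * ennreal K \<partial>lborel) + (\<integral>\<^sup>+x. indicator B x * ennreal K \<partial>lborel)"
    by (intro add_mono nn_integral_mono mult_left_mono K') auto
  also have "\<dots> = emeasure lborel B * ennreal K + emeasure lborel B * ennreal K"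
    by (simp add: nn_integral_multc)
  also have "\<dots> < \<infinity>"
    using emeasure_compact_finite[of B] unfolding B_def by (simp add: ennreal_mult_less_top)
  finally show ?thesis .
qed

context potential begin

lemma bump_X1: "bump R \<in> X1 s V"
proof (rule X1_I)
  show m: "bump R \<in> borel_measurable lebesgue" by (intro measurable_completion) simp
  note [measurable] = m
  show "integrable lebesgue (gagliardo s (bump R) (bump R))"
    using bump_gagliardo_finite[OF s(1,2), of R]
    by (intro integrableI_nonneg) (auto simp: gagliardo_nonneg nn_integral_completion)
  \<comment> \<open>Continuity bounds \<open>V\<close> on the support of the tent.\<close>
  have "compact (V ` cball 0 \<bar>R\<bar>)"
    using V_cont continuous_on_subset by (intro compact_continuous_image) auto
  then have "bounded (V ` cball 0 \<bar>R\<bar>)" by (rule compact_imp_bounded)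
  then obtain M where M: "\<And>x. x \<in> cball 0 \<bar>R\<bar> \<Longrightarrow> V x \<le> M"
    unfolding bounded_iff by (metis abs_le_D1 image_eqI real_norm_def)
  have "integrable lborel (\<lambda>x. M * R\<^sup>2 * indicator (cball (0::real^'n) \<bar>R\<bar>) x)"
    by (intro integrable_mult_right integrable_real_indicator) (auto simp: emeasure_compact_finite[unfolded infinity_ennreal_def])
  then have "integrable lebesgue (\<lambda>x. M * R\<^sup>2 * indicator (cball (0::real^'n) \<bar>R\<bar>) x)"
    by (subst integrable_completion) auto
  then show "integrable lebesgue (\<lambda>x. V x * (bump R x)\<^sup>2)"
  proof (rule Bochner_Integration.integrable_bound, measurable, intro AE_I2)
    fix x :: "real^'n"
    show "norm (V x * (bump R x)\<^sup>2) \<le> norm (M * R\<^sup>2 * indicator (cball (0::real^'n) \<bar>R\<bar>) x)"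
    proof (cases "x \<in> cball 0 \<bar>R\<bar>")
      case True
      have "\<bar>bump R x\<bar> \<le> \<bar>R\<bar>" unfolding bump_def using norm_ge_zero[of x] by linarith
      then have "(bump R x)\<^sup>2 \<le> R\<^sup>2" unfolding abs_le_square_iff .
      then have "V x * (bump R x)\<^sup>2 \<le> M * R\<^sup>2"
        using M[OF True] V_nonneg by (intro mult_mono) (auto intro: order_trans)
      then show ?thesis using V_nonneg[of x] True by simp
    next
      case False
      then have "bump R x = 0" unfolding bump_def by auto
      then show ?thesis by simp
    qed
  qed
qed

end

subsection \<open>Decay of superlevel sets and the fractional Sobolev inequality\<close>

text \<open>If \<open>\<bar>u x\<bar> \<ge> 2 t\<close>, then at least half of a ball around \<open>x\<close> of twice the volume of
  \<open>{\<bar>u\<bar> \<ge> t}\<close> consists of points \<open>y\<close> with \<open>\<bar>u x - u y\<bar> \<ge> t\<close>.\<close>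

lemma level_step:
  fixes u :: "real^'n \<Rightarrow> real"
  assumes s: "0 < s" and u [measurable]: "u \<in> borel_measurable borel"
    and G: "(\<integral>\<^sup>+z. ennreal (gagliardo s u u z) \<partial>lborel) \<le> ennreal B" and "B \<ge> 0"
    and fin: "emeasure lborel {x. t \<le> \<bar>u x\<bar>} < \<infinity>" and t: "t > 0"
  shows "t\<^sup>2 * measure lborel {x. 2 * t \<le> \<bar>u x\<bar>} \<le>
     (2 / unit_ball_vol (real CARD('n))) powr (1 + 2 * s / real CARD('n)) * B
      * measure lborel {x. t \<le> \<bar>u x\<bar>} powr (2 * s / real CARD('n))"
proof -
  define N where "N = real CARD('n)"
  define \<omega> where "\<omega> = unit_ball_vol N"
  define E where "E t = {x. t \<le> \<bar>u x\<bar>}" for t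
  define D where "D = measure lborel (E t)"
  have N: "N > 0" unfolding N_def by simp
  have \<omega>: "\<omega> > 0" unfolding \<omega>_def N_def by simp
  have E [measurable]: "E t \<in> sets borel" for t unfolding E_def by measurable
  have eD: "emeasure lborel (E t) = ennreal D"
    using fin unfolding D_def E_def by (intro emeasure_eq_ennreal_measure) auto
  have sub: "E (2 * t) \<subseteq> E t" using t unfolding E_def by auto
  have D0: "D \<ge> 0" unfolding D_def by simp
  have le: "emeasure lborel (E (2*t)) \<le> ennreal D" unfolding eD[symmetric] using sub by (intro emeasure_mono) auto
  have le2: "measure lborel (E (2*t)) \<le> D" using le D0 unfolding measure_def by (simp add: enn2real_leI)
  have e2: "emeasure lborel (E (2 * t)) = ennreal (measure lborel (E (2 * t)))"
    using le by (intro emeasure_eq_ennreal_measure) (auto simp: top_unique)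
  have "t\<^sup>2 * measure lborel (E (2 * t)) \<le> (2 / \<omega>) powr (1 + 2 * s / N) * B * D powr (2 * s / N)"
  proof (cases "D = 0")
    case True
    then show ?thesis using le2 by (simp add: measure_le_0_iff)
  next
    case False
    then have D: "D > 0" using D0 by simp
    \<comment> \<open>Radius of the ball of volume \<open>2 * D\<close>; a part of it of volume at
      least \<open>D\<close> lies outside \<open>E t\<close>.\<close>
    define \<rho> where "\<rho> = (2 * D / \<omega>) powr (1 / N)"
    have \<rho>: "\<rho> > 0" unfolding \<rho>_def using D \<omega> by simp
    have \<rho>N: "\<omega> * \<rho> powr N = 2 * D" unfolding \<rho>_def powr_powr using D \<omega> N by simp
    have \<rho>Ns: "\<rho> powr (N + 2 * s) = (2 * D / \<omega>) powr (1 + 2 * s / N)"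
      unfolding \<rho>_def powr_powr using N by (simp add: field_simps)
    \<comment> \<open>Lower bound of the Gagliardo quotient between a point of
      \<open>E (2 * t)\<close> and points of its ball outside \<open>E t\<close>.\<close>
    define c where "c = t\<^sup>2 / \<rho> powr (N + 2 * s)"
    have c: "c > 0" unfolding c_def using t \<rho> by simp
    have [measurable]: "cball x r \<in> sets borel" for x :: "real^'n" and r by simp
    have inner: "ennreal (c * D) \<le> (\<integral>\<^sup>+y. ennreal (gagliardo s u u (x, y)) \<partial>lborel)" if x: "x \<in> E (2 * t)" for x
    proof -
      have "emeasure lborel (cball x \<rho>) = ennreal (2 * D)"
        using emeasure_cball_vec[of \<rho> x] \<rho> \<rho>N unfolding N_def \<omega>_def by simp
      moreover have "emeasure lborel (cball x \<rho>) \<le> emeasure lborel (cball x \<rho> - E t) + emeasure lborel (E t)"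
        by (rule order_trans[OF emeasure_mono emeasure_subadditive]) auto
      ultimately have "ennreal (2 * D) \<le> emeasure lborel (cball x \<rho> - E t) + ennreal D" using eD by simp
      moreover have "ennreal (2 * D) = ennreal D + ennreal D" using D0 by (simp add: ennreal_plus[symmetric] del: ennreal_plus)
      ultimately have vol: "ennreal D \<le> emeasure lborel (cball x \<rho> - E t)"
        by (simp add: add.commute ennreal_add_left_cancel_le)
      have "ennreal (c * D) = ennreal c * ennreal D" using c D by (simp add: ennreal_mult)
      also have "\<dots> \<le> ennreal c * emeasure lborel (cball x \<rho> - E t)" using vol by (rule mult_left_mono) simp
      also have "\<dots> = (\<integral>\<^sup>+y. ennreal c * indicator (cball x \<rho> - E t) y \<partial>lborel)"
        by (subst nn_integral_cmult_indicator) auto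
      also have "\<dots> \<le> (\<integral>\<^sup>+y. ennreal (gagliardo s u u (x, y)) \<partial>lborel)"
      proof (rule nn_integral_mono)
        fix y
        show "ennreal c * indicator (cball x \<rho> - E t) y \<le> ennreal (gagliardo s u u (x, y))"
        proof (cases "y \<in> cball x \<rho> - E t")
          case True
          have ux: "2 * t \<le> \<bar>u x\<bar>" "\<bar>u y\<bar> < t" using x True unfolding E_def by auto
          then have "x \<noteq> y" using t by auto
          have "t \<le> \<bar>u x - u y\<bar>" using ux by linarith
          then have "t\<^sup>2 \<le> (u x - u y)\<^sup>2" using t by (metis power2_abs power_mono less_imp_le)
          moreover have "norm (x - y) powr (N + 2 * s) \<le> \<rho> powr (N + 2 * s)"
            using True N s by (intro powr_mono2) (auto simp: dist_norm)
          moreover have "0 < norm (x - y) powr (N + 2 * s)" using \<open>x \<noteq> y\<close> by simp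
          ultimately have "c \<le> gagliardo s u u (x, y)"
            unfolding c_def gagliardo_def N_def by (auto intro!: frac_le simp: power2_eq_square)
          then show ?thesis using True by (simp add: ennreal_leI)
        qed simp
      qed
      finally show ?thesis .
    qed
    have mg: "(\<lambda>z. ennreal (gagliardo s u u z)) \<in> borel_measurable borel"
      unfolding gagliardo_def case_prod_beta by measurable
    have "ennreal (c * D * measure lborel (E (2 * t))) = ennreal (c * D) * emeasure lborel (E (2 * t))"
      unfolding e2 using c D by (simp add: ennreal_mult)
    also have "\<dots> = (\<integral>\<^sup>+x. ennreal (c * D) * indicator (E (2 * t)) x \<partial>lborel)"
      by (subst nn_integral_cmult_indicator) auto
    also have "\<dots> \<le> (\<integral>\<^sup>+x. \<integral>\<^sup>+y. ennreal (gagliardo s u u (x, y)) \<partial>lborel \<partial>lborel)"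
      using inner by (intro nn_integral_mono) (auto simp: indicator_def)
    also have "\<dots> = (\<integral>\<^sup>+z. ennreal (gagliardo s u u z) \<partial>lborel)" using tonelli_lborel(1)[OF mg] by simp
    also have "\<dots> \<le> ennreal B" by (rule G)
    finally have "c * D * measure lborel (E (2 * t)) \<le> B" using \<open>B \<ge> 0\<close> by simp
    then have "t\<^sup>2 * D * measure lborel (E (2 * t)) \<le> B * (2 * D / \<omega>) powr (1 + 2 * s / N)"
      unfolding c_def \<rho>Ns[symmetric] using \<rho> by (simp add: field_simps)
    also have "(2 * D / \<omega>) powr (1 + 2 * s / N) = (2 / \<omega>) powr (1 + 2 * s / N) * D powr (1 + 2 * s / N)"
      using D \<omega> by (simp add: powr_mult[symmetric])
    also have "D powr (1 + 2 * s / N) = D * D powr (2 * s / N)" using D by (simp add: powr_add)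
    finally have "D * (t\<^sup>2 * measure lborel (E (2 * t))) \<le> D * ((2 / \<omega>) powr (1 + 2 * s / N) * B * D powr (2 * s / N))"
      by (simp add: mult_ac)
    then show ?thesis using D by (simp only: mult_le_cancel_left_pos)
  qed
  then show ?thesis unfolding D_def E_def N_def \<omega>_def .
qed

lemma chebyshev_sq:
  fixes u :: "real^'n \<Rightarrow> real"
  assumes u [measurable]: "u \<in> borel_measurable borel"
    and L2: "(\<integral>\<^sup>+x. ennreal ((u x)\<^sup>2) \<partial>lborel) \<le> ennreal B" and "t > 0"
  shows "emeasure lborel {x. t \<le> \<bar>u x\<bar>} \<le> ennreal (B / t\<^sup>2)"
proof -
  have "ennreal (t\<^sup>2) * emeasure lborel {x. t \<le> \<bar>u x\<bar>} = (\<integral>\<^sup>+x. ennreal (t\<^sup>2) * indicator {x. t \<le> \<bar>u x\<bar>} x \<partial>lborel)"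
    by (subst nn_integral_cmult_indicator) auto
  also have "\<dots> \<le> (\<integral>\<^sup>+x. ennreal ((u x)\<^sup>2) \<partial>lborel)"
    using \<open>t > 0\<close> by (intro nn_integral_mono)
      (auto simp: indicator_def intro!: ennreal_leI, metis power2_abs power_mono less_imp_le)
  also have "\<dots> \<le> ennreal B" by (rule L2)
  finally have "ennreal (1 / t\<^sup>2) * (ennreal (t\<^sup>2) * emeasure lborel {x. t \<le> \<bar>u x\<bar>}) \<le> ennreal (1 / t\<^sup>2) * ennreal B"
    by (rule mult_left_mono) simp
  moreover have "ennreal (1 / t\<^sup>2) * ennreal (t\<^sup>2) = 1" using \<open>t > 0\<close> by (simp add: ennreal_mult[symmetric])
  moreover have "ennreal (1 / t\<^sup>2) * ennreal B = ennreal (B / t\<^sup>2)" using \<open>t > 0\<close> by (simp add: ennreal_mult'[symmetric])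
  ultimately show ?thesis by (simp add: mult.assoc[symmetric])
qed

text \<open>The critical exponent \<open>2 N / (N - 2 s)\<close>, in the form that shows \<open>r = 2 + r (2 s / N)\<close>, the fixed point
  equation behind the decay rate below.\<close>

definition crit_exp :: "real \<Rightarrow> real \<Rightarrow> real" where "crit_exp N s = 2 / (1 - 2 * s / N)"

text \<open>A weak-type Sobolev inequality. Writing m(k) for the measure of the superlevel set at
  height 2^k, \<open>level_step\<close> reads m(k+1) \<le> C 4^(-k) m(k)^\<sigma>, and the bound K
  2^(-r k) reproduces itself because \<open>r = 2 + r * \<sigma>\<close>.\<close>

lemma level_decay:
  assumes s: "0 < s" "real CARD('n) > 2 * s" and B: "B \<ge> 0"
  obtains K where "K \<ge> 0" "\<And>(u :: real^'n \<Rightarrow> real) k. u \<in> borel_measurable borel \<Longrightarrow>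
    (\<integral>\<^sup>+z. ennreal (gagliardo s u u z) \<partial>lborel) \<le> ennreal B \<Longrightarrow>
    (\<integral>\<^sup>+x. ennreal ((u x)\<^sup>2) \<partial>lborel) \<le> ennreal B \<Longrightarrow>
    emeasure lborel {x. 2 powr real k \<le> \<bar>u x\<bar>} \<le> ennreal (K * 2 powr (- crit_exp (real CARD('n)) s * real k))"
proof -
  define N where "N = real CARD('n)"
  define \<sigma> where "\<sigma> = 2 * s / N"
  define r where "r = crit_exp N s"
  \<comment> \<open>The summand 1 keeps \<open>C\<close> positive also for
    \<open>B = 0\<close>.\<close>
  define C where "C = (2 / unit_ball_vol N) powr (1 + \<sigma>) * B + 1"
  have N: "N > 0" unfolding N_def by simp
  have \<sigma>: "0 < \<sigma>" "\<sigma> < 1" unfolding \<sigma>_def using s N by (simp_all add: N_def)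
  have r: "r > 0" "r = 2 + r * \<sigma>" unfolding r_def crit_exp_def \<sigma>_def[symmetric] using \<sigma> by (simp_all add: field_simps)
  have C: "C > 0" unfolding C_def using B by (simp add: add_nonneg_pos)
  \<comment> \<open>\<open>B\<close> serves the start of the induction, by Chebyshev's inequality at
    height 1; the other entry is the solution of \<open>C * K powr \<sigma> * 2 powr r = K\<close>
    needed for the step.\<close>
  define K where "K = max B ((C * 2 powr r) powr (1 / (1 - \<sigma>)))"
  have K: "K > 0" unfolding K_def using C by (simp add: less_max_iff_disj)
  have Kb: "C * K powr \<sigma> * 2 powr r \<le> K"
  proof -
    have "C * 2 powr r = ((C * 2 powr r) powr (1 / (1 - \<sigma>))) powr (1 - \<sigma>)"
      using C \<sigma> by (simp add: powr_powr)
    also have "\<dots> \<le> K powr (1 - \<sigma>)" unfolding K_def using \<sigma> by (intro powr_mono2) auto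
    finally have "C * 2 powr r * K powr \<sigma> \<le> K powr (1 - \<sigma>) * K powr \<sigma>" by (intro mult_right_mono) auto
    also have "\<dots> = K" unfolding powr_add[symmetric] using K by simp
    finally show ?thesis by (simp add: mult_ac)
  qed
  show ?thesis
  proof (rule that[of K])
    fix u :: "real^'n \<Rightarrow> real" and k
    assume u [measurable]: "u \<in> borel_measurable borel"
      and G: "(\<integral>\<^sup>+z. ennreal (gagliardo s u u z) \<partial>lborel) \<le> ennreal B"
      and L: "(\<integral>\<^sup>+x. ennreal ((u x)\<^sup>2) \<partial>lborel) \<le> ennreal B"
    have fin: "emeasure lborel {x. t \<le> \<bar>u x\<bar>} < \<infinity>" if "t > 0" for t
      using chebyshev_sq[OF u L that] by (rule order.strict_trans1) simp
    have "measure lborel {x. 2 powr real k \<le> \<bar>u x\<bar>} \<le> K * 2 powr (- r * real k)"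
    proof (induction k)
      case 0
      have "measure lborel {x. 1 \<le> \<bar>u x\<bar>} \<le> B"
        using chebyshev_sq[OF u L, of 1] B unfolding measure_def by (simp add: enn2real_leI)
      also have "\<dots> \<le> K" unfolding K_def by simp
      finally show ?case by simp
    next
      case (Suc k)
      let ?t = "2 powr real k"
      let ?m = "\<lambda>t. measure lborel {x. t \<le> \<bar>u x\<bar>}"
      have "?t\<^sup>2 * ?m (2 * ?t) \<le> (2 / unit_ball_vol N) powr (1 + \<sigma>) * B * ?m ?t powr \<sigma>"
        using level_step[OF s(1) u G B fin, of ?t] unfolding N_def \<sigma>_def by simp
      also have "\<dots> \<le> C * ?m ?t powr \<sigma>" unfolding C_def by (intro mult_right_mono) auto
      also have "\<dots> \<le> C * (K * 2 powr (- r * real k)) powr \<sigma>"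
        using C \<sigma> Suc by (intro mult_left_mono powr_mono2) auto
      also have "(K * 2 powr (- r * real k)) powr \<sigma> = K powr \<sigma> * 2 powr (- r * real k * \<sigma>)"
        using K by (simp add: powr_mult powr_powr)
      finally have "?t\<^sup>2 * ?m (2 * ?t) \<le> C * K powr \<sigma> * 2 powr (- r * real k * \<sigma>)" by (simp add: mult_ac)
      then have le: "2 powr (- 2 * real k) * (?t\<^sup>2 * ?m (2 * ?t)) \<le> 2 powr (- 2 * real k) * (C * K powr \<sigma> * 2 powr (- r * real k * \<sigma>))"
        by (rule mult_left_mono) simp
      have "2 powr (- 2 * real k) * ?t\<^sup>2 = 1"
        unfolding power2_eq_square powr_add[symmetric] by simp
      then have "?m (2 * ?t) = 2 powr (- 2 * real k) * (?t\<^sup>2 * ?m (2 * ?t))"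
        by (simp only: mult.assoc[symmetric] mult_1)
      also note le
      also have "2 powr (- 2 * real k) * (C * K powr \<sigma> * 2 powr (- r * real k * \<sigma>)) = C * K powr \<sigma> * (2 powr (- 2 * real k) * 2 powr (- r * real k * \<sigma>))"
        by (simp only: mult_ac)
      also have "2 powr (- 2 * real k) * 2 powr (- r * real k * \<sigma>) = 2 powr (- (2 + r * \<sigma>) * real k)"
        unfolding powr_add[symmetric] by (simp add: algebra_simps)
      also have "\<dots> = 2 powr r * 2 powr (- r * real (Suc k))"
        unfolding r(2)[symmetric] powr_add[symmetric] by (simp add: algebra_simps)
      also have "C * K powr \<sigma> * (2 powr r * 2 powr (- r * real (Suc k))) = (C * K powr \<sigma> * 2 powr r) * 2 powr (- r * real (Suc k))"
        by (simp add: mult_ac)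
      also have "\<dots> \<le> K * 2 powr (- r * real (Suc k))" by (rule mult_right_mono[OF Kb]) simp
      also have "2 * ?t = 2 powr real (Suc k)" by (simp add: powr_add)
      finally show ?case .
    qed
    moreover have "emeasure lborel {x. 2 powr real k \<le> \<bar>u x\<bar>} = ennreal (measure lborel {x. 2 powr real k \<le> \<bar>u x\<bar>})"
      using fin[of "2 powr real k"] by (intro emeasure_eq_ennreal_measure) auto
    ultimately show "emeasure lborel {x. 2 powr real k \<le> \<bar>u x\<bar>} \<le> ennreal (K * 2 powr (- crit_exp (real CARD('n)) s * real k))"
      unfolding r_def N_def by (simp add: ennreal_leI)
  qed (use K in simp)
qed

text \<open>Summation over the layers between consecutive powers of 2. A layer contributes at most a
  multiple of \<open>q ^ k\<close> with \<open>q = 2 powr (r - R)\<close>, and subcriticality makes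
  \<open>q < 1\<close>; the constants depend on \<open>u\<close> only through
  \<open>B\<close>.\<close>

lemma uniform_tail:
  assumes s: "0 < s" "real CARD('n) > 2 * s" and B: "B \<ge> 0"
    and r: "0 < r" "r < crit_exp (real CARD('n)) s" and e: "e > 0"
  obtains m :: nat where "\<And>(u :: real^'n \<Rightarrow> real). u \<in> borel_measurable borel \<Longrightarrow>
    (\<integral>\<^sup>+z. ennreal (gagliardo s u u z) \<partial>lborel) \<le> ennreal B \<Longrightarrow>
    (\<integral>\<^sup>+x. ennreal ((u x)\<^sup>2) \<partial>lborel) \<le> ennreal B \<Longrightarrow>
    (\<integral>\<^sup>+x. ennreal (\<bar>u x\<bar> powr r) * indicator {x. 2 powr real m \<le> \<bar>u x\<bar>} x \<partial>lborel) \<le> ennreal e"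
proof -
  define R where "R = crit_exp (real CARD('n)) s"
  obtain K where K: "K \<ge> 0" "\<And>(u :: real^'n \<Rightarrow> real) k. u \<in> borel_measurable borel \<Longrightarrow>
    (\<integral>\<^sup>+z. ennreal (gagliardo s u u z) \<partial>lborel) \<le> ennreal B \<Longrightarrow>
    (\<integral>\<^sup>+x. ennreal ((u x)\<^sup>2) \<partial>lborel) \<le> ennreal B \<Longrightarrow>
    emeasure lborel {x. 2 powr real k \<le> \<bar>u x\<bar>} \<le> ennreal (K * 2 powr (- R * real k))"
    using level_decay[OF s B] unfolding R_def by metis
  define q where "q = 2 powr (r - R)"
  have q: "0 < q" "q < 1" unfolding q_def R_def using r powr_less_mono[of "r - R" 0 2] by (auto simp: R_def)
  define c where "c = K * 2 powr r * (\<Sum>k. q ^ k)"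
  have sq: "summable (\<lambda>k. q ^ k)" using q by (intro summable_geometric) auto
  have c: "c \<ge> 0" unfolding c_def using K(1) q suminf_nonneg[OF sq] by simp
  obtain m where m: "c * q ^ m < e"
  proof -
    have "(\<lambda>m. c * q ^ m) \<longlonglongrightarrow> c * 0" using q by (intro tendsto_intros LIMSEQ_power_zero) auto
    then have "\<forall>\<^sub>F m in sequentially. c * q ^ m < e" using e order_tendstoD(2) by fastforce
    then show ?thesis using that by (auto simp: eventually_sequentially)
  qed
  show ?thesis
  proof (rule that[of m])
    fix u :: "real^'n \<Rightarrow> real"
    assume u [measurable]: "u \<in> borel_measurable borel"
      and G: "(\<integral>\<^sup>+z. ennreal (gagliardo s u u z) \<partial>lborel) \<le> ennreal B"
      and L: "(\<integral>\<^sup>+x. ennreal ((u x)\<^sup>2) \<partial>lborel) \<le> ennreal B"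
    let ?T = "\<lambda>k x. ennreal (2 powr ((real m + real k + 1) * r)) * indicator {x. 2 powr real (m + k) \<le> \<bar>u x\<bar>} x"
    have pt: "ennreal (\<bar>u x\<bar> powr r) * indicator {x. 2 powr real m \<le> \<bar>u x\<bar>} x \<le> (\<Sum>k. ?T k x)" for x
    proof (cases "2 powr real m \<le> \<bar>u x\<bar>")
      case True
      then have "1 \<le> \<bar>u x\<bar> / 2 powr real m" by simp
      then obtain k :: nat where k: "2 powr real k \<le> \<bar>u x\<bar> / 2 powr real m" "\<bar>u x\<bar> / 2 powr real m \<le> 2 powr (real k + 1)"
        using two_powr_floor by blast
      have "2 powr real (m + k) \<le> \<bar>u x\<bar>" using k(1) by (simp add: powr_add field_simps)
      moreover have "\<bar>u x\<bar> \<le> 2 powr (real m + real k + 1)" using k(2) by (simp add: powr_add field_simps)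
      then have "\<bar>u x\<bar> powr r \<le> 2 powr ((real m + real k + 1) * r)"
        unfolding powr_powr[symmetric] using r by (intro powr_mono2) auto
      ultimately have "ennreal (\<bar>u x\<bar> powr r) * indicator {x. 2 powr real m \<le> \<bar>u x\<bar>} x \<le> ?T k x"
        using True by (simp add: ennreal_leI)
      also have "\<dots> \<le> (\<Sum>k. ?T k x)" by (rule ennreal_le_suminf)
      finally show ?thesis .
    qed simp
    have Ti: "(\<integral>\<^sup>+x. ?T k x \<partial>lborel) \<le> ennreal (K * 2 powr r * q ^ m * q ^ k)" for k
    proof -
      have "(\<integral>\<^sup>+x. ?T k x \<partial>lborel) = ennreal (2 powr ((real m + real k + 1) * r)) * emeasure lborel {x. 2 powr real (m + k) \<le> \<bar>u x\<bar>}"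
        by (subst nn_integral_cmult_indicator) auto
      also have "\<dots> \<le> ennreal (2 powr ((real m + real k + 1) * r)) * ennreal (K * 2 powr (- R * real (m + k)))"
        by (intro mult_left_mono K(2)[OF u G L]) auto
      also have "\<dots> = ennreal (K * (2 powr ((real m + real k + 1) * r) * 2 powr (- R * real (m + k))))"
        using K(1) by (simp add: ennreal_mult[symmetric] mult_ac)
      also have "2 powr ((real m + real k + 1) * r) * 2 powr (- R * real (m + k)) = 2 powr r * 2 powr ((r - R) * real (m + k))"
        unfolding powr_add[symmetric] by (simp add: algebra_simps)
      also have "2 powr ((r - R) * real (m + k)) = q ^ m * q ^ k"
        unfolding q_def powr_powr[symmetric] by (simp add: powr_realpow power_add[symmetric] del: of_nat_add)
      finally show ?thesis by (simp add: mult_ac)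
    qed
    have "(\<integral>\<^sup>+x. ennreal (\<bar>u x\<bar> powr r) * indicator {x. 2 powr real m \<le> \<bar>u x\<bar>} x \<partial>lborel) \<le> (\<integral>\<^sup>+x. (\<Sum>k. ?T k x) \<partial>lborel)"
      by (intro nn_integral_mono pt)
    also have "\<dots> = (\<Sum>k. \<integral>\<^sup>+x. ?T k x \<partial>lborel)" by (intro nn_integral_suminf) auto
    also have "\<dots> \<le> (\<Sum>k. ennreal (K * 2 powr r * q ^ m * q ^ k))" by (intro suminf_le Ti) auto
    also have "\<dots> = ennreal (\<Sum>k. K * 2 powr r * q ^ m * q ^ k)"
      using K(1) q sq by (intro suminf_ennreal2) (auto intro!: summable_mult)
    also have "(\<Sum>k. K * 2 powr r * q ^ m * q ^ k) = c * q ^ m"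
      unfolding c_def using suminf_mult[OF sq, of "K * 2 powr r * q ^ m"] by (simp add: mult_ac)
    also have "ennreal (c * q ^ m) \<le> ennreal e" using m by (intro ennreal_leI) simp
    finally show "(\<integral>\<^sup>+x. ennreal (\<bar>u x\<bar> powr r) * indicator {x. 2 powr real m \<le> \<bar>u x\<bar>} x \<partial>lborel) \<le> ennreal e" .
  qed
qed

subsection \<open>Dyadic cubes and compactness in \<open>L\<^sup>2\<close>\<close>

text \<open>The floor makes the cubes half-open, so that for fixed \<open>k\<close> they partition
  the space.\<close>

definition cube :: "nat \<Rightarrow> ('n \<Rightarrow> int) \<Rightarrow> (real^'n) set" where
  "cube k z = {x. \<forall>i. \<lfloor>2 ^ k * x $ i\<rfloor> = z i}"

lemma vec_nth_borel [measurable]: "(\<lambda>x. x $ i) \<in> borel_measurable (borel :: (real^'n) measure)"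
  by (intro borel_measurable_continuous_onI continuous_intros)

lemma cube_measurable [measurable]: "cube k z \<in> sets (borel :: (real^'n) measure)"
  unfolding cube_def floor_eq_iff by measurable

lemma cube_disjoint: "x \<in> cube k z \<Longrightarrow> x \<in> cube k z' \<Longrightarrow> z = z'"
  unfolding cube_def by auto

lemma emeasure_cube: "emeasure lborel (cube k z :: (real^'n) set) = ennreal ((1 / 2 ^ k) ^ CARD('n))"
proof -
  define a :: "real^'n" where "a = (\<chi> i. real_of_int (z i) / 2 ^ k)"
  define b :: "real^'n" where "b = (\<chi> i. (real_of_int (z i) + 1) / 2 ^ k)"
  have sub1: "box a b \<subseteq> cube k z"
    unfolding cube_def a_def b_def by (auto simp: mem_box_cart floor_eq_iff field_simps less_imp_le)
  have sub2: "cube k z \<subseteq> cbox a b"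
    unfolding cube_def a_def b_def by (auto simp: mem_box_cart floor_eq_iff field_simps less_imp_le)
  have d: "(b - a) \<bullet> e = 1 / 2 ^ k" if Be: "e \<in> Basis" for e
  proof -
    obtain i where e: "e = axis i 1" using Be unfolding Basis_vec_def by auto
    have "(b - a) \<bullet> e = (b - a) $ i" unfolding e by (simp add: inner_axis)
    also have "\<dots> = 1 / 2 ^ k" unfolding a_def b_def by (simp add: diff_divide_distrib[symmetric])
    finally show ?thesis .
  qed
  then have le: "a \<bullet> e \<le> b \<bullet> e" if "e \<in> Basis" for e using that by (simp add: inner_diff_left diff_eq_eq)
  have p: "(\<Prod>e\<in>Basis. (b - a) \<bullet> e) = (1 / 2 ^ k) ^ CARD('n)" using d by simp
  have "emeasure lborel (box a b) = ennreal ((1 / 2 ^ k) ^ CARD('n))"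
    unfolding p[symmetric] using le by (rule emeasure_lborel_box)
  moreover have "emeasure lborel (cbox a b) = ennreal ((1 / 2 ^ k) ^ CARD('n))"
    unfolding p[symmetric] using le by (rule emeasure_lborel_cbox)
  moreover have "emeasure lborel (box a b) \<le> emeasure lborel (cube k z)" "emeasure lborel (cube k z) \<le> emeasure lborel (cbox a b)"
    using sub1 sub2 by (auto intro!: emeasure_mono)
  ultimately show ?thesis by (metis antisym)
qed

lemma cube_diam:
  fixes x y :: "real^'n"
  assumes "x \<in> cube k z" "y \<in> cube k z"
  shows "norm (x - y) \<le> real CARD('n) / 2 ^ k"
proof -
  have "\<bar>(x - y) $ i\<bar> \<le> 1 / 2 ^ k" for i
  proof -
    have "real_of_int (z i) \<le> 2 ^ k * x $ i" "2 ^ k * x $ i < real_of_int (z i) + 1"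
      "real_of_int (z i) \<le> 2 ^ k * y $ i" "2 ^ k * y $ i < real_of_int (z i) + 1"
      using assms unfolding cube_def floor_eq_iff by auto
    then have "\<bar>2 ^ k * x $ i - 2 ^ k * y $ i\<bar> \<le> 1" by linarith
    then have "2 ^ k * \<bar>x $ i - y $ i\<bar> \<le> 1" by (simp add: right_diff_distrib[symmetric] abs_mult)
    then show ?thesis by (simp add: field_simps)
  qed
  then have "(\<Sum>i\<in>UNIV. \<bar>(x - y) $ i\<bar>) \<le> (\<Sum>i\<in>(UNIV::'n set). 1 / 2 ^ k)" by (intro sum_mono) auto
  then show ?thesis using norm_le_l1_cart[of "x - y"] by simp
qed

lemma integrable_square_indicator:
  fixes w :: "real^'n \<Rightarrow> real"
  assumes [measurable]: "w \<in> borel_measurable borel" "Q \<in> sets borel" and "emeasure lborel Q < \<infinity>"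
    and "(\<integral>\<^sup>+x. ennreal ((w x)\<^sup>2) \<partial>lborel) < \<infinity>"
  shows "integrable lborel (\<lambda>x. indicator Q x * (w x)\<^sup>2)" "integrable lborel (\<lambda>x. indicator Q x * w x)"
    "integrable lborel (indicator Q :: _ \<Rightarrow> real)"
proof -
  have i: "integrable lborel (\<lambda>x. (w x)\<^sup>2)" using assms by (intro integrableI_nonneg) auto
  then show 1: "integrable lborel (\<lambda>x. indicator Q x * (w x)\<^sup>2)"
    by (rule Bochner_Integration.integrable_bound) (auto simp: indicator_def)
  show 2: "integrable lborel (indicator Q :: _ \<Rightarrow> real)" using assms by (intro integrable_real_indicator) auto
  show "integrable lborel (\<lambda>x. indicator Q x * w x)"
  proof (rule Bochner_Integration.integrable_bound[OF Bochner_Integration.integrable_add[OF 1 2]], measurable, intro AE_I2)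
    fix x
    have "\<bar>w x\<bar> \<le> (w x)\<^sup>2 + 1" using abs_mult_le_squares[of "w x" 1] by simp
    then show "norm (indicator Q x * w x) \<le> norm (indicator Q x * (w x)\<^sup>2 + indicator Q x)"
      by (auto simp: indicator_def)
  qed
qed

text \<open>The Poincare inequality on a cube rests on
  \<open>\<integral>\<integral>\<^sub>Q\<^sub>\<times>\<^sub>Q (w x - w y)\<^sup>2 = 2 \<bar>Q\<bar> \<integral>\<^sub>Q w\<^sup>2 - 2 (\<integral>\<^sub>Q w)\<^sup>2\<close>.\<close>

lemma cube_poincare:
  fixes w :: "real^'n \<Rightarrow> real" and k z
  defines "Q \<equiv> cube k z" and "m \<equiv> (1 / 2 ^ k) ^ CARD('n)"
  assumes s: "0 < s" and w [measurable]: "w \<in> borel_measurable borel" and fin: "(\<integral>\<^sup>+x. ennreal ((w x)\<^sup>2) \<partial>lborel) < \<infinity>"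
  shows "(\<integral>\<^sup>+x. ennreal ((w x)\<^sup>2) * indicator Q x \<partial>lborel) \<le> ennreal ((LINT x|lborel. indicator Q x * w x)\<^sup>2 / m)
     + ennreal ((real CARD('n) / 2 ^ k) powr (real CARD('n) + 2 * s) / (2 * m))
       * (\<integral>\<^sup>+p. ennreal (gagliardo s w w p) * indicator (Q \<times> Q) p \<partial>lborel)"
proof -
  define I where "I = (LINT x|lborel. indicator Q x * w x)"
  define W where "W = (LINT x|lborel. indicator Q x * (w x)\<^sup>2)"
  \<comment> \<open>A power of the diameter bound: within the cube the squared difference is at most
    \<open>c\<close> times the Gagliardo quotient.\<close>
  define c where "c = (real CARD('n) / 2 ^ k) powr (real CARD('n) + 2 * s)"
  have c: "c \<ge> 0" unfolding c_def by simp
  have m: "m > 0" unfolding m_def by simp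
  have Q [measurable]: "Q \<in> sets borel" unfolding Q_def by simp
  have eQ: "emeasure lborel Q = ennreal m" unfolding Q_def m_def by (rule emeasure_cube)
  then have mQ: "measure lborel Q = m" using m by (simp add: measure_def)
  note int = integrable_square_indicator[OF w Q _ fin] 
  have i1: "integrable lborel (\<lambda>x. indicator Q x * (w x)\<^sup>2)" and i2: "integrable lborel (\<lambda>x. indicator Q x * w x)"
    and i3: "integrable lborel (indicator Q :: _ \<Rightarrow> real)" using int eQ by simp_all
  \<comment> \<open>The inner integral of the squared difference over \<open>y\<close> in
    \<open>Q\<close>, expanded.\<close>
  define h where "h x = (w x)\<^sup>2 * m - 2 * w x * I + W" for x
  have e1: "(\<lambda>y. indicator Q y * (w x - w y)\<^sup>2) = (\<lambda>y. (w x)\<^sup>2 * indicator Q y - 2 * w x * (indicator Q y * w y) + indicator Q y * (w y)\<^sup>2)" for x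
    by (auto simp: power2_eq_square algebra_simps)
  have ih: "integrable lborel (\<lambda>y. indicator Q y * (w x - w y)\<^sup>2)" for x
    unfolding e1 using i1 i2 i3 by simp
  have hx: "(LINT y|lborel. indicator Q y * (w x - w y)\<^sup>2) = h x" for x
    unfolding e1 h_def I_def W_def using i1 i2 i3 mQ by simp
  have h0: "0 \<le> h x" for x unfolding hx[symmetric] by (intro Bochner_Integration.integral_nonneg) simp
  have inner: "(\<integral>\<^sup>+y. ennreal (indicator Q y * (w x - w y)\<^sup>2) \<partial>lborel) = ennreal (h x)" for x
    using nn_integral_eq_integral[OF ih] hx by simp
  have e2: "(\<lambda>x. indicator Q x * h x) = (\<lambda>x. m * (indicator Q x * (w x)\<^sup>2) - 2 * I * (indicator Q x * w x) + W * indicator Q x)"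
    unfolding h_def by (auto simp: algebra_simps)
  have ih2: "integrable lborel (\<lambda>x. indicator Q x * h x)" unfolding e2 using i1 i2 i3 by simp
  have "(LINT x|lborel. indicator Q x * h x) = m * W - 2 * I * I + W * m"
    unfolding e2 I_def W_def using i1 i2 i3 mQ by simp
  then have out: "(LINT x|lborel. indicator Q x * h x) = 2 * m * W - 2 * I\<^sup>2"
    by (simp add: power2_eq_square)
  have nn: "0 \<le> 2 * m * W - 2 * I\<^sup>2" unfolding out[symmetric] using h0 by (intro Bochner_Integration.integral_nonneg) simp
  have mg: "(\<lambda>z. ennreal (gagliardo s w w z) * indicator (Q \<times> Q) z) \<in> borel_measurable borel"
  proof -
    have "Q \<times> Q \<in> sets borel" by (rule borel_Times) auto
    then show ?thesis unfolding gagliardo_def case_prod_beta by measurable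
  qed
  have "ennreal (2 * m * W - 2 * I\<^sup>2) = (\<integral>\<^sup>+x. ennreal (indicator Q x * h x) \<partial>lborel)"
    unfolding out[symmetric] using nn_integral_eq_integral[OF ih2] h0 by simp
  also have "\<dots> = (\<integral>\<^sup>+x. indicator Q x * (\<integral>\<^sup>+y. ennreal (indicator Q y * (w x - w y)\<^sup>2) \<partial>lborel) \<partial>lborel)"
    unfolding inner by (intro nn_integral_cong) (auto simp: indicator_def)
  also have "\<dots> \<le> (\<integral>\<^sup>+x. \<integral>\<^sup>+y. ennreal c * (ennreal (gagliardo s w w (x, y)) * indicator (Q \<times> Q) (x, y)) \<partial>lborel \<partial>lborel)"
  proof (rule nn_integral_mono)
    fix x
    show "indicator Q x * (\<integral>\<^sup>+y. ennreal (indicator Q y * (w x - w y)\<^sup>2) \<partial>lborel)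
      \<le> (\<integral>\<^sup>+y. ennreal c * (ennreal (gagliardo s w w (x, y)) * indicator (Q \<times> Q) (x, y)) \<partial>lborel)"
    proof (cases "x \<in> Q")
      case True
      have "ennreal (indicator Q y * (w x - w y)\<^sup>2) \<le> ennreal c * (ennreal (gagliardo s w w (x, y)) * indicator (Q \<times> Q) (x, y))" for y
      proof (cases "y \<in> Q \<and> y \<noteq> x")
        case yQ: True
        have "norm (x - y) powr (real CARD('n) + 2 * s) \<le> c"
          unfolding c_def using cube_diam[of x k z y] True yQ s unfolding Q_def by (intro powr_mono2) auto
        moreover have "0 < norm (x - y) powr (real CARD('n) + 2 * s)" using yQ by auto
        ultimately have "(w x - w y)\<^sup>2 \<le> c * gagliardo s w w (x, y)"
          unfolding gagliardo_def power2_eq_square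
          by (simp add: pos_le_divide_eq mult_left_mono mult.commute[of c])
        then have "ennreal ((w x - w y)\<^sup>2) \<le> ennreal c * ennreal (gagliardo s w w (x, y))"
          using c by (simp add: ennreal_mult[symmetric] gagliardo_nonneg ennreal_leI)
        then show ?thesis using True yQ by simp
      qed (use True in auto)
      then show ?thesis using True by (auto intro!: nn_integral_mono)
    qed simp
  qed
  also have "\<dots> = (\<integral>\<^sup>+p. ennreal c * (ennreal (gagliardo s w w p) * indicator (Q \<times> Q) p) \<partial>lborel)"
    using tonelli_lborel(1)[of "\<lambda>p. ennreal c * (ennreal (gagliardo s w w p) * indicator (Q \<times> Q) p)"] mg by simp
  also have "\<dots> = ennreal c * (\<integral>\<^sup>+p. ennreal (gagliardo s w w p) * indicator (Q \<times> Q) p \<partial>lborel)" (is "_ = _ * ?G")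
    using mg by (intro nn_integral_cmult) simp
  finally have main: "ennreal (2 * m * W - 2 * I\<^sup>2) \<le> ennreal c * ?G" .
  \<comment> \<open>The identity solved for the integral \<open>W\<close> of the square: a part from
    the mean and a part from the oscillation.\<close>
  have "ennreal W = ennreal (I\<^sup>2 / m + 1 / (2 * m) * (2 * m * W - 2 * I\<^sup>2))"
    using m by (simp add: field_simps)
  also have "\<dots> = ennreal (I\<^sup>2 / m) + ennreal (1 / (2 * m)) * ennreal (2 * m * W - 2 * I\<^sup>2)"
    using m nn by (subst ennreal_plus) (auto simp: ennreal_mult[symmetric])
  also have "\<dots> \<le> ennreal (I\<^sup>2 / m) + ennreal (1 / (2 * m)) * (ennreal c * ?G)"
    by (intro add_left_mono mult_left_mono main) simp
  also have "ennreal (1 / (2 * m)) * (ennreal c * ?G) = ennreal (c / (2 * m)) * ?G"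
    using m c by (simp add: mult.assoc[symmetric] ennreal_mult[symmetric])
  finally have "ennreal W \<le> ennreal (I\<^sup>2 / m) + ennreal (c / (2 * m)) * ?G" .
  moreover have "(\<integral>\<^sup>+x. ennreal ((w x)\<^sup>2) * indicator Q x \<partial>lborel) = ennreal W"
  proof -
    have "(\<integral>\<^sup>+x. ennreal ((w x)\<^sup>2) * indicator Q x \<partial>lborel) = (\<integral>\<^sup>+x. ennreal (indicator Q x * (w x)\<^sup>2) \<partial>lborel)"
      by (intro nn_integral_cong) (auto simp: indicator_def)
    then show ?thesis unfolding W_def using nn_integral_eq_integral[OF i1] by simp
  qed
  ultimately show ?thesis unfolding I_def c_def by simp
qed

text \<open>The Riesz-Fischer argument. Integrals of squared increments below 8^(-k) remain summable
  with weights 4^k, so almost everywhere the k-th increment is at most a constant times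
  2^(-k).\<close>

lemma L2_Cauchy_converges:
  fixes u :: "nat \<Rightarrow> 'a::euclidean_space \<Rightarrow> real"
  assumes [measurable]: "\<And>n. u n \<in> borel_measurable borel"
    and cauchy: "\<And>e. e > 0 \<Longrightarrow> \<exists>n0. \<forall>n\<ge>n0. \<forall>m\<ge>n0. (\<integral>\<^sup>+x. ennreal ((u n x - u m x)\<^sup>2) \<partial>lborel) \<le> ennreal e"
  obtains r v where "strict_mono (r :: nat \<Rightarrow> nat)" "v \<in> borel_measurable borel"
    "AE x in lborel. (\<lambda>n. u (r n) x) \<longlonglongrightarrow> v x" "(\<lambda>n. \<integral>\<^sup>+x. ennreal ((u (r n) x - v x)\<^sup>2) \<partial>lborel) \<longlonglongrightarrow> 0"
proof -
  have "\<forall>k. \<exists>n0. \<forall>n\<ge>n0. \<forall>m\<ge>n0. (\<integral>\<^sup>+x. ennreal ((u n x - u m x)\<^sup>2) \<partial>lborel) \<le> ennreal ((1/8) ^ k)"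
    using cauchy by simp
  then obtain n0 where n0: "\<And>k n m. n \<ge> n0 k \<Longrightarrow> m \<ge> n0 k \<Longrightarrow> (\<integral>\<^sup>+x. ennreal ((u n x - u m x)\<^sup>2) \<partial>lborel) \<le> ennreal ((1/8) ^ k)"
    by metis
  \<comment> \<open>The partial sum dominates \<open>n0 k\<close>, and the summand \<open>k\<close>
    makes \<open>r\<close> strictly increasing.\<close>
  define r where "r k = (\<Sum>j\<le>k. n0 j) + k" for k
  have r: "strict_mono r" unfolding r_def by (intro strict_monoI_Suc) simp
  have rn: "n0 k \<le> r k" for k unfolding r_def using member_le_sum[of k "{..k}" n0] by simp
  define d where "d k x = \<bar>u (r (Suc k)) x - u (r k) x\<bar>" for k x
  have [measurable]: "d k \<in> borel_measurable borel" for k unfolding d_def by measurable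
  have d: "(\<integral>\<^sup>+x. ennreal ((d k x)\<^sup>2) \<partial>lborel) \<le> ennreal ((1/8) ^ k)" for k
    unfolding d_def power2_abs using rn[of k] strict_monoD[OF r, of k "Suc k"] by (intro n0) auto
  have "(\<integral>\<^sup>+x. (\<Sum>k. ennreal (4 ^ k * (d k x)\<^sup>2)) \<partial>lborel) = (\<Sum>k. \<integral>\<^sup>+x. ennreal (4 ^ k * (d k x)\<^sup>2) \<partial>lborel)"
    by (intro nn_integral_suminf) auto
  also have "\<dots> = (\<Sum>k. ennreal (4 ^ k) * (\<integral>\<^sup>+x. ennreal ((d k x)\<^sup>2) \<partial>lborel))"
    by (simp add: ennreal_mult nn_integral_cmult)
  also have "\<dots> \<le> (\<Sum>k. ennreal (4 ^ k) * ennreal ((1/8) ^ k))"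
    by (intro suminf_le mult_left_mono d) auto
  also have "\<dots> = (\<Sum>k. ennreal ((1/2) ^ k))"
    by (simp add: ennreal_mult[symmetric] power_mult_distrib[symmetric])
  also have "\<dots> = ennreal (\<Sum>k. (1/2) ^ k)" by (intro suminf_ennreal2 summable_geometric) auto
  also have "\<dots> < \<infinity>" by simp
  finally have "AE x in lborel. (\<Sum>k. ennreal (4 ^ k * (d k x)\<^sup>2)) \<noteq> \<infinity>"
    by (intro nn_integral_PInf_AE) auto
  then have conv: "AE x in lborel. convergent (\<lambda>n. u (r n) x)"
  proof eventually_elim
    case (elim x)
    define c where "c = enn2real (\<Sum>k. ennreal (4 ^ k * (d k x)\<^sup>2))"
    have c: "c \<ge> 0" "(\<Sum>k. ennreal (4 ^ k * (d k x)\<^sup>2)) = ennreal c"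
      unfolding c_def using elim by (simp_all add: ennreal_enn2real_if)
    have le: "d k x \<le> sqrt c * (1/2) ^ k" for k
    proof -
      have "ennreal (4 ^ k * (d k x)\<^sup>2) \<le> ennreal c" unfolding c(2)[symmetric] by (rule ennreal_le_suminf)
      then have "4 ^ k * (d k x)\<^sup>2 \<le> c" using c(1) by simp
      moreover have "(4::real) ^ k = (2 ^ k)\<^sup>2" by (simp add: power2_eq_square power_mult_distrib[symmetric])
      ultimately have "(2 ^ k * d k x)\<^sup>2 \<le> c" by (simp add: power_mult_distrib)
      then have "2 ^ k * d k x \<le> sqrt c" by (rule real_le_rsqrt)
      then show ?thesis by (simp add: power_one_over pos_le_divide_eq mult.commute)
    qed
    have "summable (\<lambda>k. u (r (Suc k)) x - u (r k) x)"
    proof (rule summable_comparison_test')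
      show "summable (\<lambda>k. sqrt c * (1/2) ^ k)" by (intro summable_mult summable_geometric) auto
      show "norm (u (r (Suc k)) x - u (r k) x) \<le> sqrt c * (1/2) ^ k" if "k \<ge> 0" for k using le[of k] unfolding d_def by simp
    qed
    then have "convergent (\<lambda>n. \<Sum>k<n. u (r (Suc k)) x - u (r k) x)" by (simp add: summable_iff_convergent)
    moreover have "(\<Sum>k<n. u (r (Suc k)) x - u (r k) x) = u (r n) x - u (r 0) x" for n
      using sum_lessThan_telescope[of "\<lambda>k. u (r k) x" n] by simp
    ultimately have "convergent (\<lambda>n. u (r n) x - u (r 0) x)" by simp
    then show ?case by (subst (asm) convergent_diff_const_right_iff)
  qed
  define v where "v x = lim (\<lambda>n. u (r n) x)" for x
  have v [measurable]: "v \<in> borel_measurable borel" unfolding v_def by measurable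
  have ae: "AE x in lborel. (\<lambda>n. u (r n) x) \<longlonglongrightarrow> v x"
    using conv by eventually_elim (simp add: v_def convergent_LIMSEQ_iff)
  have "(\<lambda>n. \<integral>\<^sup>+x. ennreal ((u (r n) x - v x)\<^sup>2) \<partial>lborel) \<longlonglongrightarrow> 0"
  proof (rule tendsto_sandwich[where f="\<lambda>_. 0" and h="\<lambda>n. ennreal ((1/8) ^ n)"])
    show "\<forall>\<^sub>F n in sequentially. (\<integral>\<^sup>+x. ennreal ((u (r n) x - v x)\<^sup>2) \<partial>lborel) \<le> ennreal ((1/8) ^ n)"
    proof (rule always_eventually, rule allI)
      fix n
      \<comment> \<open>Fatou's lemma in the second index turns the Cauchy bound into a bound for
        the distance to the limit.\<close>
      have "(\<integral>\<^sup>+x. ennreal ((u (r n) x - v x)\<^sup>2) \<partial>lborel) \<le> (\<integral>\<^sup>+x. liminf (\<lambda>j. ennreal ((u (r n) x - u (r j) x)\<^sup>2)) \<partial>lborel)"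
      proof (rule nn_integral_mono_AE, use ae in eventually_elim)
        case (elim x)
        have "(\<lambda>j. ennreal ((u (r n) x - u (r j) x)\<^sup>2)) \<longlonglongrightarrow> ennreal ((u (r n) x - v x)\<^sup>2)"
          by (intro tendsto_ennrealI tendsto_intros elim)
        then show ?case using lim_imp_Liminf[OF sequentially_bot] by (metis order_refl)
      qed
      also have "\<dots> \<le> liminf (\<lambda>j. \<integral>\<^sup>+x. ennreal ((u (r n) x - u (r j) x)\<^sup>2) \<partial>lborel)"
        by (intro nn_integral_liminf) measurable
      also have "\<dots> \<le> ennreal ((1/8) ^ n)"
      proof (rule order_trans[OF Liminf_mono])
        have "(\<integral>\<^sup>+x. ennreal ((u (r n) x - u (r j) x)\<^sup>2) \<partial>lborel) \<le> ennreal ((1/8) ^ n)" if "j \<ge> n" for j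
          using rn[of n] strict_mono_leD[OF r that] by (intro n0) auto
        then show "\<forall>\<^sub>F j in sequentially. (\<integral>\<^sup>+x. ennreal ((u (r n) x - u (r j) x)\<^sup>2) \<partial>lborel) \<le> ennreal ((1/8) ^ n)"
          by (auto simp: eventually_sequentially)
        show "liminf (\<lambda>j::nat. ennreal ((1/8) ^ n)) \<le> ennreal ((1/8) ^ n)" by (simp add: Liminf_const)
      qed
      finally show "(\<integral>\<^sup>+x. ennreal ((u (r n) x - v x)\<^sup>2) \<partial>lborel) \<le> ennreal ((1/8) ^ n)" .
    qed
    have "(\<lambda>n. ennreal ((1/8) ^ n)) \<longlonglongrightarrow> ennreal 0" by (intro tendsto_ennrealI LIMSEQ_power_zero) simp
    then show "(\<lambda>n. ennreal ((1/8) ^ n)) \<longlonglongrightarrow> 0" by simp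
  qed auto
  then show ?thesis using that r v ae by blast
qed

lemma gagliardo_diff_le: "gagliardo s (\<lambda>x. u x - v x) (\<lambda>x. u x - v x) z \<le> 2 * gagliardo s u u z + 2 * gagliardo s v v z"
proof -
  have "gagliardo s (\<lambda>x. u x - v x) (\<lambda>x. u x - v x) z = gagliardo s u u z - 2 * gagliardo s u v z + gagliardo s v v z"
    using gagliardo_add_scale[of s u "-1" v z] by simp
  moreover have "0 \<le> gagliardo s u u z + 2 * gagliardo s u v z + gagliardo s v v z"
    using gagliardo_add_scale[of s u 1 v z] gagliardo_nonneg[of s "\<lambda>x. u x + 1 * v x" z] by simp
  ultimately show ?thesis by linarith
qed

lemma gagliardo_borel:
  assumes [measurable]: "u \<in> borel_measurable borel"
  shows "gagliardo s u u \<in> borel_measurable borel"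
  unfolding gagliardo_def case_prod_beta by measurable

lemma square_diff_nn_integral:
  fixes f g :: "'a::euclidean_space \<Rightarrow> real"
  assumes [measurable]: "f \<in> borel_measurable borel" "g \<in> borel_measurable borel" and "B \<ge> 0"
    and nn: "\<And>x. 0 \<le> f x" "\<And>x. 0 \<le> g x" and le: "\<And>x. h x \<le> 2 * f x + 2 * g x"
    and "(\<integral>\<^sup>+x. ennreal (f x) \<partial>lborel) \<le> ennreal B" "(\<integral>\<^sup>+x. ennreal (g x) \<partial>lborel) \<le> ennreal B"
  shows "(\<integral>\<^sup>+x. ennreal (h x) \<partial>lborel) \<le> ennreal (4 * B)"
proof -
  have "(\<integral>\<^sup>+x. ennreal (h x) \<partial>lborel) \<le> (\<integral>\<^sup>+x. ennreal 2 * ennreal (f x) + ennreal 2 * ennreal (g x) \<partial>lborel)"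
  proof (rule nn_integral_mono)
    fix x
    have "ennreal (h x) \<le> ennreal (2 * f x + 2 * g x)" using le by (rule ennreal_leI)
    also have "\<dots> = ennreal 2 * ennreal (f x) + ennreal 2 * ennreal (g x)"
      using nn[of x] by (simp add: ennreal_mult)
    finally show "ennreal (h x) \<le> ennreal 2 * ennreal (f x) + ennreal 2 * ennreal (g x)" .
  qed
  also have "\<dots> = ennreal 2 * (\<integral>\<^sup>+x. ennreal (f x) \<partial>lborel) + ennreal 2 * (\<integral>\<^sup>+x. ennreal (g x) \<partial>lborel)"
    by (simp add: nn_integral_add nn_integral_cmult)
  also have "\<dots> \<le> ennreal 2 * ennreal B + ennreal 2 * ennreal B"
    using assms by (intro add_mono mult_left_mono) auto
  also have "\<dots> = ennreal (4 * B)"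
    unfolding ennreal_mult[OF zero_le_numeral \<open>B \<ge> 0\<close>, symmetric] using \<open>B \<ge> 0\<close> by (subst ennreal_plus[symmetric]) auto
  finally show ?thesis .
qed

lemma square_diff_le: "((a::real) - b)\<^sup>2 \<le> 2 * a\<^sup>2 + 2 * b\<^sup>2"
  using zero_le_power2[of "a + b"] by (simp add: power2_eq_square algebra_simps)

text \<open>Borel functions and \<open>lborel\<close>, as Tonelli's theorem and the cube estimates
  demand. Stated by nonnegative integrals, the bounds include finiteness.\<close>

definition (in potential) bounded_by :: "real \<Rightarrow> (real^'n \<Rightarrow> real) \<Rightarrow> bool" where
  "bounded_by B u \<longleftrightarrow> u \<in> borel_measurable borel \<and> (\<integral>\<^sup>+z. ennreal (gagliardo s u u z) \<partial>lborel) \<le> ennreal B \<and>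
     (\<integral>\<^sup>+x. ennreal (V x * (u x)\<^sup>2) \<partial>lborel) \<le> ennreal B \<and> (\<integral>\<^sup>+x. ennreal ((u x)\<^sup>2) \<partial>lborel) \<le> ennreal B"

section \<open>Compactness of the embedding into L^2\<close>

context potential begin

lemma bounded_by_diff:
  assumes "bounded_by B u" "bounded_by B v" "B \<ge> 0"
  shows "bounded_by (4 * B) (\<lambda>x. u x - v x)"
proof -
  have [measurable]: "u \<in> borel_measurable borel" "v \<in> borel_measurable borel"
    using assms unfolding bounded_by_def by auto
  have "(\<integral>\<^sup>+z. ennreal (gagliardo s (\<lambda>x. u x - v x) (\<lambda>x. u x - v x) z) \<partial>lborel) \<le> ennreal (4 * B)"
    using assms unfolding bounded_by_def
    by (intro square_diff_nn_integral[of "gagliardo s u u" "gagliardo s v v"]) (auto simp: gagliardo_diff_le gagliardo_borel gagliardo_nonneg)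
  moreover have "(\<integral>\<^sup>+x. ennreal (V x * (u x - v x)\<^sup>2) \<partial>lborel) \<le> ennreal (4 * B)"
  proof (rule square_diff_nn_integral[of "\<lambda>x. V x * (u x)\<^sup>2" "\<lambda>x. V x * (v x)\<^sup>2"])
    show "V x * (u x - v x)\<^sup>2 \<le> 2 * (V x * (u x)\<^sup>2) + 2 * (V x * (v x)\<^sup>2)" for x
      using mult_left_mono[OF square_diff_le[of "u x" "v x"] V_nonneg[of x]] by (simp add: algebra_simps)
  qed (use assms V_nonneg in \<open>auto simp: bounded_by_def\<close>)
  moreover have "(\<integral>\<^sup>+x. ennreal ((u x - v x)\<^sup>2) \<partial>lborel) \<le> ennreal (4 * B)"
    using assms unfolding bounded_by_def
    by (intro square_diff_nn_integral[of "\<lambda>x. (u x)\<^sup>2" "\<lambda>x. (v x)\<^sup>2"] square_diff_le) auto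
  ultimately show ?thesis unfolding bounded_by_def by simp
qed

lemma two_less_crit: "2 < crit_exp (real CARD('n)) s"
proof -
  have "0 < 2 * s / real CARD('n)" "2 * s / real CARD('n) < 1" using s by simp_all
  then show ?thesis unfolding crit_exp_def by (simp add: field_simps)
qed

text \<open>The square of a difference \<open>w\<close> is split over four regions:
  \<open>V > M\<close>, controlled by the weighted integral; \<open>\<bar>w\<bar> \<ge> T\<close>,
  by the uniform tail; the remainder of \<open>{V \<le> M}\<close> outside finitely many cubes,
  where \<open>w\<close> is below \<open>T\<close> and the measure is small; and these cubes, where
  the Poincare inequality leaves averages, which converge, and an oscillation with a small factor.
  Finiteness of the measure of \<open>{V \<le> M}\<close> plays the part of a bounded
  domain.\<close>

lemma rellich_Cauchy:
  assumes bd: "\<And>n. bounded_by B (u n)" and B: "B \<ge> 0"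
    and av: "\<And>k z. convergent (\<lambda>n. LINT x|lborel. indicator (cube k z) x * u n x)" and e: "e > 0"
  shows "\<exists>n0. \<forall>n\<ge>n0. \<forall>m\<ge>n0. (\<integral>\<^sup>+x. ennreal ((u n x - u m x)\<^sup>2) \<partial>lborel) \<le> ennreal e"
proof -
  define N where "N = real CARD('n)"
  define B' where "B' = 4 * B"
  \<comment> \<open>Four regions, the cubes contributing two terms.\<close>
  define e' where "e' = e / 5"
  have e': "e' > 0" unfolding e'_def using e by simp
  have B': "B' \<ge> 0" unfolding B'_def using B by simp
  have um [measurable]: "u n \<in> borel_measurable borel" for n using bd unfolding bounded_by_def by simp
  have ufin: "(\<integral>\<^sup>+x. ennreal ((u n x)\<^sup>2) \<partial>lborel) < \<infinity>" for n
    using bd[of n] unfolding bounded_by_def by (auto intro: le_less_trans)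
  define M where "M = B' / e' + 1"
  have M: "M > 0" unfolding M_def using B' e' by (simp add: add_nonneg_pos)
  have M2: "1 / M * B' \<le> e'" using M e' unfolding M_def by (simp add: field_simps)
  obtain j :: nat where tail: "\<And>w :: real^'n \<Rightarrow> real. bounded_by B' w \<Longrightarrow>
    (\<integral>\<^sup>+x. ennreal (\<bar>w x\<bar> powr 2) * indicator {x. 2 powr real j \<le> \<bar>w x\<bar>} x \<partial>lborel) \<le> ennreal e'"
    apply (rule uniform_tail[OF s(1,3) B' zero_less_numeral two_less_crit e'])
    subgoal for m by (rule that[of m]) (simp add: bounded_by_def)
    done
  define T where "T = 2 powr real j"
  have T: "T > 0" unfolding T_def by simp
  define C where "C = N powr (N + 2 * s) / 2"
  have Nn: "N > 0" unfolding N_def by simp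
  have C: "C > 0" unfolding C_def using Nn by simp
  \<comment> \<open>The constant of \<open>cube_poincare\<close> at side 2^(-k): the volume cancels,
    and the decaying factor \<open>2 powr (- 2 * s)\<close> to the k remains.\<close>
  have Ck: "(N / 2 ^ k) powr (N + 2 * s) / (2 * (1 / 2 ^ k) ^ CARD('n)) = C * (2 powr (- 2 * s)) ^ k" for k
  proof -
    have "(N / 2 ^ k) powr (N + 2 * s) = N powr (N + 2 * s) / (2 powr real k) powr (N + 2 * s)"
      using Nn by (simp add: powr_divide powr_realpow)
    moreover have "(1 / 2 ^ k) ^ CARD('n) = 1 / (2 powr real k) powr N"
      unfolding N_def by (simp add: powr_realpow power_divide)
    moreover have "(2 powr real k) powr (N + 2 * s) = (2 powr real k) powr N * (2 powr (2 * s)) ^ k"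
    proof -
      have *: "(2 powr (2 * s)) ^ k = (2 powr (2 * s)) powr real k" by (simp add: powr_realpow)
      show ?thesis unfolding * powr_powr powr_add[symmetric] by (simp add: algebra_simps)
    qed
    moreover have "(2 powr real k) powr N > 0" by simp
    ultimately have "(N / 2 ^ k) powr (N + 2 * s) / (2 * (1 / 2 ^ k) ^ CARD('n)) = C * (1 / (2 powr (2 * s)) ^ k)"
      unfolding C_def by (simp only: divide_divide_eq_left divide_divide_eq_right times_divide_eq_right times_divide_eq_left) simp
    also have "1 / (2 powr (2 * s)) ^ k = (2 powr (- 2 * s)) ^ k"
      using powr_minus[of 2 "2 * s"] by (simp add: power_one_over[symmetric] inverse_eq_divide)
    finally show ?thesis .
  qed
  obtain k where k: "C * (2 powr (- 2 * s)) ^ k * B' \<le> e'"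
  proof -
    have "2 powr (- 2 * s) < 2 powr 0" using s by (intro powr_less_mono) auto
    then have "(\<lambda>k. C * (2 powr (- 2 * s)) ^ k * B') \<longlonglongrightarrow> C * 0 * B'" by (intro tendsto_intros LIMSEQ_power_zero) auto
    then have "\<forall>\<^sub>F k in sequentially. C * (2 powr (- 2 * s)) ^ k * B' < e'" using e' order_tendstoD(2) by fastforce
    then show ?thesis using that by (auto simp: eventually_sequentially intro: less_imp_le)
  qed
  define m where "m = (1 / 2 ^ k :: real) ^ CARD('n)"
  have m: "m > 0" unfolding m_def by simp
  define S where "S = {x. V x \<le> M}"
  have S [measurable]: "S \<in> sets borel" unfolding S_def by measurable
  have Sfin: "emeasure lborel S < \<infinity>" using V_finite[OF M] S unfolding S_def by simp
  \<comment> \<open>Indices of finitely many cubes that exhaust the space as \<open>L\<close> grows.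
    Since \<open>S\<close> has finite measure, that of \<open>S - K L\<close> tends to 0 by
    continuity from above.\<close>
  define Z where "Z L = {z :: 'n \<Rightarrow> int. \<forall>i. \<bar>z i\<bar> \<le> int L}" for L :: nat
  have Zfin: "finite (Z L)" for L
  proof -
    have "- int L \<le> z i \<and> z i \<le> int L" if "\<bar>z i\<bar> \<le> int L" for z :: "'n \<Rightarrow> int" and i using that by linarith
    then have "Z L \<subseteq> PiE UNIV (\<lambda>_. {- int L .. int L})" unfolding Z_def by auto
    then show ?thesis by (rule finite_subset) (intro finite_PiE; simp)
  qed
  define K where "K L = (\<Union>z\<in>Z L. cube k z :: (real^'n) set)" for L
  have K [measurable]: "K L \<in> sets borel" for L unfolding K_def using Zfin by (intro sets.finite_UN) auto
  have "(\<lambda>L. emeasure lborel (S - K L)) \<longlonglongrightarrow> emeasure lborel (\<Inter>L. S - K L)"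
  proof (rule Lim_emeasure_decseq)
    have "Z a \<subseteq> Z b" if ab: "a \<le> b" for a b
    proof
      fix z assume "z \<in> Z a"
      then have "\<bar>z i\<bar> \<le> int b" for i unfolding Z_def using ab order_trans[of "\<bar>z i\<bar>" "int a" "int b"] by simp
      then show "z \<in> Z b" unfolding Z_def by simp
    qed
    then show "decseq (\<lambda>L. S - K L)" unfolding decseq_def K_def by blast
    show "emeasure lborel (S - K L) \<noteq> \<infinity>" for L
      using Sfin emeasure_mono[of "S - K L" S lborel] by (auto simp: top_unique)
  qed auto
  moreover have "(\<Inter>L. S - K L) = {}"
  proof -
    have "\<exists>L. x \<in> K L" for x
    proof -
      define z where "z = (\<lambda>i. \<lfloor>2 ^ k * x $ i\<rfloor>)"
      have "z \<in> Z (nat (\<Sum>i\<in>UNIV. \<bar>z i\<bar>))" unfolding Z_def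
        using member_le_sum[of _ UNIV "\<lambda>i. \<bar>z i\<bar>"] by (auto simp: sum_nonneg)
      moreover have "x \<in> cube k z" unfolding cube_def z_def by simp
      ultimately show ?thesis unfolding K_def by blast
    qed
    then show ?thesis by blast
  qed
  ultimately have "(\<lambda>L. emeasure lborel (S - K L)) \<longlonglongrightarrow> 0" by (metis emeasure_empty)
  then have "\<forall>\<^sub>F L in sequentially. emeasure lborel (S - K L) < ennreal (e' / T\<^sup>2)"
    using e' T by (intro order_tendstoD(2)) auto
  then obtain L where L: "emeasure lborel (S - K L) \<le> ennreal (e' / T\<^sup>2)"
    by (auto simp: eventually_sequentially intro: less_imp_le)
  define I where "I n z = (LINT x|lborel. indicator (cube k z) x * u n x)" for n z
  \<comment> \<open>Chosen so that \<open>card (Z L)\<close> mean terms \<open>\<delta> / m\<close>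
    add up to at most \<open>e'\<close>.\<close>
  define \<delta> where "\<delta> = e' * m / (real (card (Z L)) + 1)"
  have \<delta>: "\<delta> > 0" unfolding \<delta>_def using e' m by simp
  have "\<forall>z. \<exists>n0. \<forall>n\<ge>n0. \<forall>i\<ge>n0. \<bar>I n z - I i z\<bar> < sqrt \<delta>"
    using Cauchy_convergent_iff[THEN iffD2, OF av] \<delta> unfolding I_def Cauchy_def dist_real_def by simp
  then obtain nz where nz: "\<And>z n i. n \<ge> nz z \<Longrightarrow> i \<ge> nz z \<Longrightarrow> \<bar>I n z - I i z\<bar> < sqrt \<delta>" by metis
  define n0 where "n0 = (\<Sum>z\<in>Z L. nz z)"
  have n0: "nz z \<le> n0" if "z \<in> Z L" for z unfolding n0_def using that Zfin by (intro member_le_sum) auto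
  show ?thesis
  proof (intro exI allI impI)
    fix n i assume ni: "n \<ge> n0" "i \<ge> n0"
    define w where "w x = u n x - u i x" for x
    have w: "bounded_by B' w" unfolding w_def B'_def by (intro bounded_by_diff bd B)
    have wm [measurable]: "w \<in> borel_measurable borel" unfolding w_def by measurable
    have wfin: "(\<integral>\<^sup>+x. ennreal ((w x)\<^sup>2) \<partial>lborel) < \<infinity>"
      using w unfolding bounded_by_def by (auto intro: le_less_trans)
    have Iw: "(LINT x|lborel. indicator (cube k z) x * w x) = I n z - I i z" for z
    proof -
      have "integrable lborel (\<lambda>x. indicator (cube k z) x * u j x)" for j
        using ufin[of j] by (intro integrable_square_indicator(2)) (auto simp: emeasure_cube)
      then show ?thesis unfolding I_def w_def by (simp add: right_diff_distrib)
    qed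
    let ?t1 = "\<lambda>x. ennreal (1 / M) * ennreal (V x * (w x)\<^sup>2)"
    let ?t2 = "\<lambda>x. ennreal (\<bar>w x\<bar> powr 2) * indicator {x. T \<le> \<bar>w x\<bar>} x"
    let ?t3 = "\<lambda>x. ennreal (T\<^sup>2) * indicator (S - K L) x"
    let ?t4 = "\<lambda>x. \<Sum>z\<in>Z L. ennreal ((w x)\<^sup>2) * indicator (cube k z) x"
    have pt: "ennreal ((w x)\<^sup>2) \<le> ?t1 x + ?t2 x + ?t3 x + ?t4 x" for x
    proof -
      consider "M < V x" | "V x \<le> M" "T \<le> \<bar>w x\<bar>" | "V x \<le> M" "\<bar>w x\<bar> < T" "x \<notin> K L" | "x \<in> K L" by fastforce
      then show ?thesis
      proof cases
        case 1
        have "M * (w x)\<^sup>2 \<le> V x * (w x)\<^sup>2" using 1 by (intro mult_right_mono) auto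
        then have "(w x)\<^sup>2 \<le> 1 / M * (V x * (w x)\<^sup>2)" using M by (simp add: field_simps)
        then have "ennreal ((w x)\<^sup>2) \<le> ?t1 x" using M V_nonneg by (simp add: ennreal_mult[symmetric] ennreal_leI)
        then show ?thesis by (simp add: add_increasing2 add.assoc)
      next
        case 2
        then have "ennreal ((w x)\<^sup>2) \<le> ?t2 x" by (simp add: powr_numeral)
        then show ?thesis by (simp add: add_increasing2 add_increasing)
      next
        case 3
        then have "(w x)\<^sup>2 \<le> T\<^sup>2" by (metis abs_ge_zero less_imp_le power2_abs power_mono)
        then have "ennreal ((w x)\<^sup>2) \<le> ?t3 x" using 3 by (simp add: S_def ennreal_leI)
        then show ?thesis by (simp add: add_increasing2 add_increasing)
      next
        case 4
        then obtain z where z: "z \<in> Z L" "x \<in> cube k z" unfolding K_def by blast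
        have "ennreal ((w x)\<^sup>2) \<le> ennreal ((w x)\<^sup>2) * indicator (cube k z) x" using z by simp
        also have "\<dots> \<le> ?t4 x" using z Zfin by (intro member_le_sum) auto
        finally show ?thesis by (simp add: add_increasing)
      qed
    qed
    have b1: "(\<integral>\<^sup>+x. ?t1 x \<partial>lborel) \<le> ennreal e'"
    proof -
      have "(\<integral>\<^sup>+x. ?t1 x \<partial>lborel) = ennreal (1 / M) * (\<integral>\<^sup>+x. ennreal (V x * (w x)\<^sup>2) \<partial>lborel)"
        by (intro nn_integral_cmult) measurable
      also have "\<dots> \<le> ennreal (1 / M) * ennreal B'" using w unfolding bounded_by_def by (intro mult_left_mono) auto
      also have "\<dots> \<le> ennreal e'" using M2 M B' by (simp add: ennreal_mult[symmetric] ennreal_leI del: ennreal_1)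
      finally show ?thesis .
    qed
    have b2: "(\<integral>\<^sup>+x. ?t2 x \<partial>lborel) \<le> ennreal e'" using tail[OF w] unfolding T_def .
    have b3: "(\<integral>\<^sup>+x. ?t3 x \<partial>lborel) \<le> ennreal e'"
    proof -
      have "(\<integral>\<^sup>+x. ?t3 x \<partial>lborel) = ennreal (T\<^sup>2) * emeasure lborel (S - K L)"
        by (intro nn_integral_cmult_indicator) auto
      also have "\<dots> \<le> ennreal (T\<^sup>2) * ennreal (e' / T\<^sup>2)" by (intro mult_left_mono L) auto
      also have "\<dots> = ennreal e'" using T e' by (simp add: ennreal_mult[symmetric])
      finally show ?thesis .
    qed
    have b4: "(\<integral>\<^sup>+x. ?t4 x \<partial>lborel) \<le> ennreal e' + ennreal e'"
    proof -
      let ?G = "\<lambda>z. \<integral>\<^sup>+p. ennreal (gagliardo s w w p) * indicator (cube k z \<times> cube k z) p \<partial>lborel"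
      have [measurable]: "gagliardo s w w \<in> borel_measurable borel" by (rule gagliardo_borel[OF wm])
      have [measurable]: "cube k z \<times> cube k z \<in> sets (borel :: ((real^'n) \<times> (real^'n)) measure)" for z
        by (intro borel_Times) auto
      have I2: "(I n z - I i z)\<^sup>2 / m \<le> \<delta> / m" if "z \<in> Z L" for z
      proof -
        have "\<bar>I n z - I i z\<bar> < sqrt \<delta>" using nz n0[OF that] ni by (meson order_trans)
        then have "(I n z - I i z)\<^sup>2 \<le> (sqrt \<delta>)\<^sup>2" by (metis abs_ge_zero less_imp_le power2_abs power_mono)
        then show ?thesis using \<delta> m by (simp add: divide_right_mono)
      qed
      have "(\<integral>\<^sup>+x. ?t4 x \<partial>lborel) = (\<Sum>z\<in>Z L. \<integral>\<^sup>+x. ennreal ((w x)\<^sup>2) * indicator (cube k z) x \<partial>lborel)"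
        by (intro nn_integral_sum) measurable
      also have "\<dots> \<le> (\<Sum>z\<in>Z L. ennreal (\<delta> / m) + ennreal (C * (2 powr (- 2 * s)) ^ k) * ?G z)"
      proof (rule sum_mono)
        fix z assume z: "z \<in> Z L"
        have "(\<integral>\<^sup>+x. ennreal ((w x)\<^sup>2) * indicator (cube k z) x \<partial>lborel) \<le> ennreal ((I n z - I i z)\<^sup>2 / m) + ennreal (C * (2 powr (- 2 * s)) ^ k) * ?G z"
          using cube_poincare[OF s(1) wm wfin, of k z] unfolding Iw m_def Ck[symmetric] N_def .
        also have "\<dots> \<le> ennreal (\<delta> / m) + ennreal (C * (2 powr (- 2 * s)) ^ k) * ?G z"
          by (intro add_right_mono ennreal_leI I2 z)
        finally show "(\<integral>\<^sup>+x. ennreal ((w x)\<^sup>2) * indicator (cube k z) x \<partial>lborel) \<le> ennreal (\<delta> / m) + ennreal (C * (2 powr (- 2 * s)) ^ k) * ?G z" .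
      qed
      also have "\<dots> = (\<Sum>z\<in>Z L. ennreal (\<delta> / m)) + ennreal (C * (2 powr (- 2 * s)) ^ k) * (\<Sum>z\<in>Z L. ?G z)"
        by (simp only: sum.distrib sum_distrib_left)
      also have "\<dots> \<le> ennreal e' + ennreal e'"
      proof (rule add_mono)
        have "(\<Sum>z\<in>Z L. ?G z) = (\<integral>\<^sup>+p. (\<Sum>z\<in>Z L. ennreal (gagliardo s w w p) * indicator (cube k z \<times> cube k z) p) \<partial>lborel)"
          by (intro nn_integral_sum[symmetric]) measurable
        also have "\<dots> \<le> (\<integral>\<^sup>+p. ennreal (gagliardo s w w p) \<partial>lborel)"
        proof (rule nn_integral_mono)
          fix p :: "(real^'n) \<times> (real^'n)"
          \<comment> \<open>The cubes being disjoint, the products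
            \<open>cube k z \<times> cube k z\<close> do not overlap, and the energies of
            \<open>w\<close> on them add up to at most its total energy.\<close>
          have one: "(\<Sum>z\<in>Z L. indicator (cube k z \<times> cube k z) p) \<le> (1 :: ennreal)"
          proof (cases "\<exists>z\<in>Z L. p \<in> cube k z \<times> cube k z")
            case True
            then obtain z where z: "z \<in> Z L" "p \<in> cube k z \<times> cube k z" by blast
            have "(\<Sum>z'\<in>Z L. indicator (cube k z' \<times> cube k z') p) = (\<Sum>z'\<in>{z}. indicator (cube k z' \<times> cube k z') p :: ennreal)"
              using z Zfin by (intro sum.mono_neutral_right) (auto simp: indicator_def dest: cube_disjoint)
            also have "\<dots> = indicator (cube k z \<times> cube k z) p" by (simp only: sum.insert sum.empty finite.emptyI empty_iff not_False_eq_True add_0_right)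
            also have "\<dots> = 1" using z(2) by (rule indicator_simps)
            finally show ?thesis by simp
          next
            case False
            then show ?thesis by (simp add: indicator_def)
          qed
          have "(\<Sum>z\<in>Z L. ennreal (gagliardo s w w p) * indicator (cube k z \<times> cube k z) p)
            = ennreal (gagliardo s w w p) * (\<Sum>z\<in>Z L. indicator (cube k z \<times> cube k z) p)"
            by (simp only: sum_distrib_left)
          also have "\<dots> \<le> ennreal (gagliardo s w w p) * 1" by (intro mult_left_mono one) simp
          finally show "(\<Sum>z\<in>Z L. ennreal (gagliardo s w w p) * indicator (cube k z \<times> cube k z) p) \<le> ennreal (gagliardo s w w p)"
            by simp
        qed
        also have "\<dots> \<le> ennreal B'" using w unfolding bounded_by_def by simp
        finally have "ennreal (C * (2 powr (- 2 * s)) ^ k) * (\<Sum>z\<in>Z L. ?G z) \<le> ennreal (C * (2 powr (- 2 * s)) ^ k) * ennreal B'"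
          by (rule mult_left_mono) simp
        also have "\<dots> \<le> ennreal e'"
          using k C B' by (simp add: ennreal_mult[symmetric] ennreal_leI)
        finally show "ennreal (C * (2 powr (- 2 * s)) ^ k) * (\<Sum>z\<in>Z L. ?G z) \<le> ennreal e'" .
        have "(\<Sum>z\<in>Z L. ennreal (\<delta> / m)) = ennreal (real (card (Z L)) * (\<delta> / m))"
          unfolding sum_constant ennreal_of_nat_eq_real_of_nat using \<delta> m by (intro ennreal_mult[symmetric]) auto
        also have "real (card (Z L)) * (\<delta> / m) = real (card (Z L)) * e' / (real (card (Z L)) + 1)"
          unfolding \<delta>_def using m by simp
        also have "ennreal (real (card (Z L)) * e' / (real (card (Z L)) + 1)) \<le> ennreal e'"
          using e' by (intro ennreal_leI) (simp add: pos_divide_le_eq distrib_left)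
        finally show "(\<Sum>z\<in>Z L. ennreal (\<delta> / m)) \<le> ennreal e'" .
      qed
      finally show ?thesis .
    qed
    have "(\<integral>\<^sup>+x. ennreal ((w x)\<^sup>2) \<partial>lborel) \<le> (\<integral>\<^sup>+x. ?t1 x + ?t2 x + ?t3 x + ?t4 x \<partial>lborel)"
      by (intro nn_integral_mono pt)
    also have "\<dots> = (\<integral>\<^sup>+x. ?t1 x \<partial>lborel) + (\<integral>\<^sup>+x. ?t2 x \<partial>lborel) + (\<integral>\<^sup>+x. ?t3 x \<partial>lborel) + (\<integral>\<^sup>+x. ?t4 x \<partial>lborel)"
      by (simp add: nn_integral_add del: nn_integral_cmult)
    also have "\<dots> \<le> ennreal e' + ennreal e' + ennreal e' + (ennreal e' + ennreal e')"
      by (intro add_mono b1 b2 b3 b4)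
    also have "\<dots> = ennreal e" using e' unfolding e'_def by (simp add: ennreal_plus[symmetric] del: ennreal_plus)
    finally show "(\<integral>\<^sup>+x. ennreal ((u n x - u i x)\<^sup>2) \<partial>lborel) \<le> ennreal e" unfolding w_def .
  qed
qed

text \<open>Averages over dyadic cubes form a countable family of bounded sequences, so a diagonal
  subsequence makes all of them converge, as \<open>rellich_Cauchy\<close> requires.\<close>

proposition rellich:
  assumes bd: "\<And>n. bounded_by B (u n)" and B: "B \<ge> 0"
  obtains r v where "strict_mono (r :: nat \<Rightarrow> nat)" "v \<in> borel_measurable borel"
    "AE x in lborel. (\<lambda>n. u (r n) x) \<longlonglongrightarrow> v x" "(\<lambda>n. \<integral>\<^sup>+x. ennreal ((u (r n) x - v x)\<^sup>2) \<partial>lborel) \<longlonglongrightarrow> 0"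
proof -
  have um [measurable]: "u n \<in> borel_measurable borel" for n using bd unfolding bounded_by_def by simp
  define f where "f n kz = (LINT x|lborel. indicator (cube (fst kz) (snd kz)) x * u n x)" for n :: nat and kz :: "nat \<times> ('n \<Rightarrow> int)"
  have ct: "countable (UNIV :: (nat \<times> ('n \<Rightarrow> int)) set)" by simp
  have "norm (f n kz) \<le> 1 + B" for n kz
  proof -
    let ?Q = "cube (fst kz) (snd kz) :: (real^'n) set"
    have fin: "(\<integral>\<^sup>+x. ennreal ((u n x)\<^sup>2) \<partial>lborel) \<le> ennreal B" using bd unfolding bounded_by_def by simp
    then have fin': "(\<integral>\<^sup>+x. ennreal ((u n x)\<^sup>2) \<partial>lborel) < \<infinity>" by (auto intro: le_less_trans)
    have i: "integrable lborel (\<lambda>x. indicator ?Q x * u n x)" "integrable lborel (indicator ?Q :: _ \<Rightarrow> real)"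
      using integrable_square_indicator[OF um _ _ fin', of ?Q] by (auto simp: emeasure_cube)
    have i2: "integrable lborel (\<lambda>x. (u n x)\<^sup>2)" using fin' by (intro integrableI_nonneg) auto
    have le2: "(LINT x|lborel. (u n x)\<^sup>2) \<le> B"
      using fin nn_integral_eq_integral[OF i2] B by simp
    have "measure lborel ?Q = (1 / 2 ^ fst kz) ^ CARD('n)" unfolding measure_def emeasure_cube by simp
    also have "\<dots> \<le> 1" by (intro power_le_one) auto
    finally have le1: "measure lborel ?Q \<le> 1" .
    have "norm (f n kz) \<le> (LINT x|lborel. norm (indicator ?Q x * u n x))"
      unfolding f_def by (rule integral_norm_bound)
    also have "\<dots> \<le> (LINT x|lborel. indicator ?Q x + (u n x)\<^sup>2)"
    proof (intro integral_mono)
      fix x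
      have "\<bar>u n x\<bar> \<le> (u n x)\<^sup>2 + 1" using abs_mult_le_squares[of "u n x" 1] by simp
      then show "norm (indicator ?Q x * u n x) \<le> indicator ?Q x + (u n x)\<^sup>2" by (auto simp: indicator_def)
    qed (use i i2 in auto)
    also have "\<dots> = measure lborel ?Q + (LINT x|lborel. (u n x)\<^sup>2)" using i i2 by simp
    finally show ?thesis using le1 le2 by linarith
  qed
  then obtain r1 where r1: "strict_mono (r1 :: nat \<Rightarrow> nat)" "\<And>kz. \<exists>l. (\<lambda>n. f (r1 n) kz) \<longlonglongrightarrow> l"
    using function_convergent_subsequence[OF ct, of f "1 + B"] by (metis UNIV_I)
  have av: "convergent (\<lambda>n. LINT x|lborel. indicator (cube k z) x * u (r1 n) x)" for k z
    using r1(2)[of "(k, z)"] unfolding f_def convergent_def by simp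
  obtain r2 v where r2: "strict_mono (r2 :: nat \<Rightarrow> nat)" "v \<in> borel_measurable borel"
    "AE x in lborel. (\<lambda>n. u (r1 (r2 n)) x) \<longlonglongrightarrow> v x" "(\<lambda>n. \<integral>\<^sup>+x. ennreal ((u (r1 (r2 n)) x - v x)\<^sup>2) \<partial>lborel) \<longlonglongrightarrow> 0"
    using L2_Cauchy_converges[of "\<lambda>n. u (r1 n)"] rellich_Cauchy[of B "\<lambda>n. u (r1 n)", OF bd B av] um by blast
  show ?thesis
    using that[of "r1 \<circ> r2" v] strict_mono_o[OF r1(1) r2(1)] r2 by simp
qed

end

subsection \<open>Convergence of integrals\<close>

text \<open>Dominated convergence with a convergent sequence of dominating functions: truncating
  \<open>f n\<close> at \<open>\<bar>g\<bar>\<close> costs at most \<open>\<bar>g n - g\<bar>\<close>, which tends to 0 in \<open>L\<^sup>1\<close> by Scheffe's lemma.\<close>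

lemma generalized_dominated_convergence:
  fixes f :: "nat \<Rightarrow> 'a \<Rightarrow> real"
  assumes fm [measurable]: "\<And>n. f n \<in> borel_measurable M" "h \<in> borel_measurable M"
    and gi: "\<And>n. integrable M (g n)" "integrable M G"
    and le: "\<And>n. AE x in M. \<bar>f n x\<bar> \<le> g n x"
    and f: "AE x in M. (\<lambda>n. f n x) \<longlonglongrightarrow> h x"
    and g: "AE x in M. (\<lambda>n. g n x) \<longlonglongrightarrow> G x"
    and int: "(\<lambda>n. integral\<^sup>L M (g n)) \<longlonglongrightarrow> integral\<^sup>L M G"
  shows "integrable M h" "(\<lambda>n. integral\<^sup>L M (f n)) \<longlonglongrightarrow> integral\<^sup>L M h"
proof -
  note [measurable] = borel_measurable_integrable[OF gi(1)] borel_measurable_integrable[OF gi(2)]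
  have le': "AE x in M. \<forall>n. \<bar>f n x\<bar> \<le> g n x" using le by (simp add: AE_all_countable)
  have hG: "AE x in M. \<bar>h x\<bar> \<le> G x"
    using f g le'
  proof eventually_elim
    case (elim x)
    show ?case by (rule LIMSEQ_le[OF tendsto_rabs[OF elim(1)] elim(2)]) (use elim(3) in auto)
  qed
  show "integrable M h"
    by (rule Bochner_Integration.integrable_bound[OF gi(2)]) (use hG in \<open>auto elim!: eventually_mono\<close>)
  have fi: "integrable M (f n)" for n
    by (rule Bochner_Integration.integrable_bound[OF gi(1)[of n]]) (use le[of n] in \<open>auto elim!: eventually_mono\<close>)
  have gnn: "AE x in M. norm (g n x) = g n x" for n using le[of n] by eventually_elim auto
  have Gnn: "AE x in M. norm (G x) = G x" using hG by eventually_elim auto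
  have n1: "(\<integral>\<^sup>+x. norm (g n x) \<partial>M) = ennreal (integral\<^sup>L M (g n))" for n
    using nn_integral_eq_integral[OF integrable_norm[OF gi(1)[of n]]] integral_cong_AE[OF _ _ gnn[of n]] by simp
  have n2: "(\<integral>\<^sup>+x. norm (G x) \<partial>M) = ennreal (integral\<^sup>L M G)"
    using nn_integral_eq_integral[OF integrable_norm[OF gi(2)]] integral_cong_AE[OF _ _ Gnn] by simp
  have "(\<lambda>n. \<integral>\<^sup>+x. norm (g n x) \<partial>M) \<longlonglongrightarrow> (\<integral>\<^sup>+x. norm (G x) \<partial>M)"
    unfolding n1 n2 by (intro tendsto_ennrealI int)
  then have "limsup (\<lambda>n. \<integral>\<^sup>+x. norm (g n x) \<partial>M) \<le> (\<integral>\<^sup>+x. norm (G x) \<partial>M)"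
    using lim_imp_Limsup[OF sequentially_bot] by (metis order_refl)
  then have "(\<lambda>n. \<integral>\<^sup>+x. norm (g n x - G x) \<partial>M) \<longlonglongrightarrow> 0"
    by (rule Scheffe_lemma1[OF gi g])
  moreover have "(\<integral>\<^sup>+x. norm (g n x - G x) \<partial>M) = ennreal (LINT x|M. norm (g n x - G x))" for n
    using gi by (intro nn_integral_eq_integral) auto
  ultimately have d0: "(\<lambda>n. LINT x|M. norm (g n x - G x)) \<longlonglongrightarrow> 0"
    by (auto dest!: tendsto_ennrealD[where x=0, simplified] simp: Bochner_Integration.integral_nonneg)
  define k where "k n x = max (- \<bar>G x\<bar>) (min \<bar>G x\<bar> (f n x))" for n x
  have [measurable]: "k n \<in> borel_measurable M" for n unfolding k_def by measurable
  have kle: "norm (k n x) \<le> \<bar>G x\<bar>" for n x unfolding k_def by auto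
  have ki: "integrable M (k n)" for n
    by (rule Bochner_Integration.integrable_bound[OF gi(2)]) (use kle in auto)
  have lim1: "(\<lambda>n. integral\<^sup>L M (k n)) \<longlonglongrightarrow> integral\<^sup>L M h"
  proof (rule integral_dominated_convergence)
    show "integrable M (\<lambda>x. \<bar>G x\<bar>)" using gi(2) by simp
    show "AE x in M. (\<lambda>n. k n x) \<longlonglongrightarrow> h x"
      using f hG
    proof eventually_elim
      case (elim x)
      have "(\<lambda>n. k n x) \<longlonglongrightarrow> max (- \<bar>G x\<bar>) (min \<bar>G x\<bar> (h x))"
        unfolding k_def by (intro tendsto_intros elim)
      moreover have "max (- \<bar>G x\<bar>) (min \<bar>G x\<bar> (h x)) = h x" using elim by (auto simp: max_def min_def)
      ultimately show ?case by simp
    qed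
  qed (use kle in auto)
  have "(\<lambda>n. integral\<^sup>L M (f n) - integral\<^sup>L M (k n)) \<longlonglongrightarrow> 0"
  proof (rule Lim_null_comparison[OF always_eventually d0], rule allI)
    fix n
    have "norm (integral\<^sup>L M (f n) - integral\<^sup>L M (k n)) = norm (LINT x|M. f n x - k n x)" using fi ki by simp
    also have "\<dots> \<le> (LINT x|M. norm (f n x - k n x))" by (rule integral_norm_bound)
    also have "\<dots> \<le> (LINT x|M. norm (g n x - G x))"
    proof (rule integral_mono_AE)
      show "AE x in M. norm (f n x - k n x) \<le> norm (g n x - G x)"
        using le[of n] hG by eventually_elim (auto simp: k_def max_def min_def)
    qed (use fi ki gi in auto)
    finally show "norm (integral\<^sup>L M (f n) - integral\<^sup>L M (k n)) \<le> (LINT x|M. norm (g n x - G x))" .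
  qed
  from tendsto_add[OF this lim1] show "(\<lambda>n. integral\<^sup>L M (f n)) \<longlonglongrightarrow> integral\<^sup>L M h" by simp
qed

lemma fatou_real:
  fixes f :: "nat \<Rightarrow> 'a \<Rightarrow> real"
  assumes fi: "\<And>n. integrable M (f n)" and nn: "\<And>n x. 0 \<le> f n x" "\<And>x. 0 \<le> h x"
    and [measurable]: "h \<in> borel_measurable M"
    and f: "AE x in M. (\<lambda>n. f n x) \<longlonglongrightarrow> h x" and L: "(\<lambda>n. integral\<^sup>L M (f n)) \<longlonglongrightarrow> L"
  shows "integrable M h" "integral\<^sup>L M h \<le> L"
proof -
  note [measurable] = borel_measurable_integrable[OF fi]
  have L0: "0 \<le> L" using L by (rule tendsto_lowerbound) (auto simp: nn Bochner_Integration.integral_nonneg)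
  have "(\<integral>\<^sup>+x. ennreal (h x) \<partial>M) \<le> (\<integral>\<^sup>+x. liminf (\<lambda>n. ennreal (f n x)) \<partial>M)"
  proof (rule nn_integral_mono_AE, use f in eventually_elim)
    case (elim x)
    then have "(\<lambda>n. ennreal (f n x)) \<longlonglongrightarrow> ennreal (h x)" by (rule tendsto_ennrealI)
    then show ?case using lim_imp_Liminf[OF sequentially_bot] by (metis order_refl)
  qed
  also have "\<dots> \<le> liminf (\<lambda>n. \<integral>\<^sup>+x. ennreal (f n x) \<partial>M)" by (intro nn_integral_liminf) measurable
  also have "(\<lambda>n. \<integral>\<^sup>+x. ennreal (f n x) \<partial>M) = (\<lambda>n. ennreal (integral\<^sup>L M (f n)))"
    using nn_integral_eq_integral[OF fi] nn by simp
  also have "liminf (\<lambda>n. ennreal (integral\<^sup>L M (f n))) = ennreal L"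
    by (intro lim_imp_Liminf tendsto_ennrealI L) simp
  finally have le: "(\<integral>\<^sup>+x. ennreal (h x) \<partial>M) \<le> ennreal L" .
  then show i: "integrable M h" using nn by (intro integrableI_nonneg) (auto intro: le_less_trans)
  show "integral\<^sup>L M h \<le> L" using le nn_integral_eq_integral[OF i] nn L0 by simp
qed

lemma nn_integral_lborel_AE_cong:
  assumes "AE x in lebesgue. f x = g x"
  shows "(\<integral>\<^sup>+x. f x \<partial>lborel) = (\<integral>\<^sup>+x. g x \<partial>lborel)"
  by (rule nn_integral_cong_AE) (use assms in \<open>simp add: AE_completion_iff\<close>)

lemma nn_integral_eq_lebesgue_integral:
  fixes f :: "real^'n \<Rightarrow> real"
  assumes "f \<in> borel_measurable lebesgue" "\<And>x. 0 \<le> f x" "(\<integral>\<^sup>+x. ennreal (f x) \<partial>lborel) < \<infinity>"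
  shows "integrable lebesgue f" "(\<integral>\<^sup>+x. ennreal (f x) \<partial>lborel) = ennreal (integral\<^sup>L lebesgue f)"
proof -
  show i: "integrable lebesgue f" using assms by (intro integrableI_nonneg) (auto simp: nn_integral_completion)
  show "(\<integral>\<^sup>+x. ennreal (f x) \<partial>lborel) = ennreal (integral\<^sup>L lebesgue f)"
    using nn_integral_eq_integral[OF i] assms(2) by (simp add: nn_integral_completion)
qed

section \<open>Power inequalities and convergence of powers\<close>

lemma powr_add_le:
  fixes x y \<gamma> :: real
  assumes "\<gamma> \<ge> 0" "x \<ge> 0" "y \<ge> 0"
  shows "(x + y) powr \<gamma> \<le> 2 powr \<gamma> * (x powr \<gamma> + y powr \<gamma>)"
proof -
  have "(x + y) powr \<gamma> \<le> (2 * max x y) powr \<gamma>" using assms by (intro powr_mono2) auto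
  also have "\<dots> = 2 powr \<gamma> * max x y powr \<gamma>" using assms by (simp add: powr_mult)
  also have "\<dots> \<le> 2 powr \<gamma> * (x powr \<gamma> + y powr \<gamma>)" by (intro mult_left_mono) (auto simp: max_def)
  finally show ?thesis .
qed

lemma powr_mult_le_sum:
  fixes x y \<alpha> \<beta> :: real
  assumes "\<alpha> \<ge> 0" "\<beta> \<ge> 0" "x \<ge> 0" "y \<ge> 0"
  shows "x powr \<alpha> * y powr \<beta> \<le> x powr (\<alpha> + \<beta>) + y powr (\<alpha> + \<beta>)"
proof (cases "x \<le> y")
  case True
  then have "x powr \<alpha> * y powr \<beta> \<le> y powr \<alpha> * y powr \<beta>" using assms by (intro mult_right_mono powr_mono2) auto
  then show ?thesis unfolding powr_add by (smt (verit) powr_ge_zero mult_nonneg_nonneg)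
next
  case False
  then have "x powr \<alpha> * y powr \<beta> \<le> x powr \<alpha> * x powr \<beta>" using assms by (intro mult_left_mono powr_mono2) auto
  then show ?thesis unfolding powr_add by (smt (verit) powr_ge_zero mult_nonneg_nonneg)
qed

text \<open>The dominating functions vary with \<open>n\<close>, but their integrals converge
  because those of \<open>\<bar>u n x - v x\<bar> powr \<gamma>\<close> do.\<close>

lemma powr_integral_tendsto:
  fixes u :: "nat \<Rightarrow> real^'n \<Rightarrow> real"
  assumes \<gamma>: "\<gamma> > 0" and [measurable]: "\<And>n. u n \<in> borel_measurable lebesgue" "v \<in> borel_measurable lebesgue"
    and ae: "AE x in lebesgue. (\<lambda>n. u n x) \<longlonglongrightarrow> v x"
    and i: "\<And>n. integrable lebesgue (\<lambda>x. \<bar>u n x - v x\<bar> powr \<gamma>)" "integrable lebesgue (\<lambda>x. \<bar>v x\<bar> powr \<gamma>)"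
    and lim: "(\<lambda>n. LINT x|lebesgue. \<bar>u n x - v x\<bar> powr \<gamma>) \<longlonglongrightarrow> 0"
  shows "(\<lambda>n. LINT x|lebesgue. \<bar>u n x\<bar> powr \<gamma>) \<longlonglongrightarrow> (LINT x|lebesgue. \<bar>v x\<bar> powr \<gamma>)"
proof -
  define g where "g n x = 2 powr \<gamma> * (\<bar>u n x - v x\<bar> powr \<gamma> + \<bar>v x\<bar> powr \<gamma>)" for n x
  define G where "G x = 2 powr \<gamma> * (0 + \<bar>v x\<bar> powr \<gamma>)" for x
  show ?thesis
  proof (rule generalized_dominated_convergence(2)[where g=g and G=G])
    show "integrable lebesgue (g n)" for n unfolding g_def using i by simp
    show "integrable lebesgue G" unfolding G_def using i by simp
    show "AE x in lebesgue. \<bar>\<bar>u n x\<bar> powr \<gamma>\<bar> \<le> g n x" for n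
    proof (rule AE_I2)
      fix x
      have "\<bar>u n x\<bar> powr \<gamma> \<le> (\<bar>u n x - v x\<bar> + \<bar>v x\<bar>) powr \<gamma>" using \<gamma> by (intro powr_mono2) auto
      also have "\<dots> \<le> g n x" unfolding g_def using \<gamma> by (intro powr_add_le) auto
      finally show "\<bar>\<bar>u n x\<bar> powr \<gamma>\<bar> \<le> g n x" by simp
    qed
    have pw: "(\<lambda>n. \<bar>y n\<bar> powr \<gamma>) \<longlonglongrightarrow> \<bar>c\<bar> powr \<gamma>" if "y \<longlonglongrightarrow> c" for y :: "nat \<Rightarrow> real" and c
      using that \<gamma> by (intro tendsto_powr' tendsto_rabs tendsto_const) auto
    show "AE x in lebesgue. (\<lambda>n. \<bar>u n x\<bar> powr \<gamma>) \<longlonglongrightarrow> \<bar>v x\<bar> powr \<gamma>"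
      using ae by eventually_elim (rule pw)
    show "AE x in lebesgue. (\<lambda>n. g n x) \<longlonglongrightarrow> G x"
      using ae
    proof eventually_elim
      case (elim x)
      have "(\<lambda>n. u n x - v x) \<longlonglongrightarrow> 0" using tendsto_diff[OF elim tendsto_const, of "v x"] by simp
      then have "(\<lambda>n. \<bar>u n x - v x\<bar> powr \<gamma>) \<longlonglongrightarrow> 0" using pw[of "\<lambda>n. u n x - v x" 0] by simp
      then show ?case unfolding g_def G_def by (intro tendsto_intros)
    qed
    have "(\<lambda>n. 2 powr \<gamma> * ((LINT x|lebesgue. \<bar>u n x - v x\<bar> powr \<gamma>) + (LINT x|lebesgue. \<bar>v x\<bar> powr \<gamma>)))
      \<longlonglongrightarrow> 2 powr \<gamma> * (0 + (LINT x|lebesgue. \<bar>v x\<bar> powr \<gamma>))" by (intro tendsto_intros lim)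
    then show "(\<lambda>n. integral\<^sup>L lebesgue (g n)) \<longlonglongrightarrow> integral\<^sup>L lebesgue G"
      unfolding g_def G_def using i by simp
  qed measurable
qed

text \<open>Young's inequality for the conjugate exponents 2/(1+p) and 2/(1-p), with constant 1, by
  comparing \<open>a\<close> with \<open>h powr (1 + p)\<close>. It ties the integrability class of
  the weights to the L^2 norm.\<close>

lemma weight_powr_le:
  fixes a h p :: real
  assumes "a \<ge> 0" "h \<ge> 0" "0 < p" "p < 1"
  shows "a * h powr (1 - p) \<le> a powr (2 / (1 + p)) + h\<^sup>2"
proof (cases "a \<le> h powr (1 + p)")
  case True
  then have "a * h powr (1 - p) \<le> h powr (1 + p) * h powr (1 - p)" by (intro mult_right_mono) auto
  also have "\<dots> = h\<^sup>2" using assms unfolding powr_add[symmetric] by (simp add: powr_numeral)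
  finally show ?thesis by (simp add: add_increasing)
next
  case False
  then have "h powr (1 + p) \<le> a" by simp
  then have "(h powr (1 + p)) powr (1 / (1 + p)) \<le> a powr (1 / (1 + p))" using assms by (intro powr_mono2) auto
  then have "h \<le> a powr (1 / (1 + p))" using assms by (simp add: powr_powr)
  then have "h powr (1 - p) \<le> (a powr (1 / (1 + p))) powr (1 - p)" using assms by (intro powr_mono2) auto
  then have "a * h powr (1 - p) \<le> a * a powr ((1 - p) / (1 + p))" using assms by (simp add: powr_powr mult_left_mono)
  also have "\<dots> = a powr (1 + (1 - p) / (1 + p))" using assms by (simp add: powr_mult_base)
  also have "1 + (1 - p) / (1 + p) = 2 / (1 + p)" using assms by (simp add: field_simps)
  finally show ?thesis by (simp add: add_increasing2)
qed

context potential begin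

text \<open>\<open>B / V0\<close> controls the square integral through \<open>V \<ge> V0\<close>;
  the sum serves all three bounds.\<close>

lemma X1_representative:
  assumes "u \<in> X1 s V" "form u u \<le> B" "B \<ge> 0"
  obtains u' where "bounded_by (B + B / V0) u'" "AE x in lebesgue. u x = u' x"
proof -
  obtain u' where u': "u' \<in> borel_measurable borel" "AE x in lebesgue. u x = u' x"
    using borel_representative X1_D(1)[OF assms(1)] by blast
  have m: "u' \<in> borel_measurable lebesgue" using u'(1) by (intro measurable_completion) simp
  have X: "u' \<in> X1 s V" using X1_AE_cong[OF assms(1) m u'(2)] .
  have "form u' u' \<le> B" using form_AE_cong[OF X1_D(1)[OF assms(1)] m u'(2)] assms(2) by simp
  note b = form_bounds[OF X this]
  have "ennreal B \<le> ennreal (B + B / V0)" "ennreal (B / V0) \<le> ennreal (B + B / V0)"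
    using assms(3) V0(1) by (auto intro!: ennreal_leI)
  then have "bounded_by (B + B / V0) u'" unfolding bounded_by_def using b u'(1) by (meson order_trans)
  then show ?thesis using that u' by blast
qed

text \<open>Cut at height \<open>T\<close>: below it the power is at most
  \<open>T powr (\<gamma> - 2)\<close> times the square, above it the uniform tail is at most
  \<open>e\<close>. Along bounded sequences, convergence to 0 in L^2 thus implies convergence to 0
  in L^\<gamma>.\<close>

lemma bounded_by_powr:
  assumes \<gamma>: "2 \<le> \<gamma>" "\<gamma> < crit_exp (real CARD('n)) s" and B: "B \<ge> 0" and e: "e > 0"
  obtains K where "K \<ge> 0" "\<And>w. bounded_by B w \<Longrightarrow>
    (\<integral>\<^sup>+x. ennreal (\<bar>w x\<bar> powr \<gamma>) \<partial>lborel) \<le> ennreal K * (\<integral>\<^sup>+x. ennreal ((w x)\<^sup>2) \<partial>lborel) + ennreal e"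
proof -
  have g0: "0 < \<gamma>" using \<gamma> by simp
  obtain m :: nat where m: "\<And>w. bounded_by B w \<Longrightarrow>
    (\<integral>\<^sup>+x. ennreal (\<bar>w x\<bar> powr \<gamma>) * indicator {x. 2 powr real m \<le> \<bar>w x\<bar>} x \<partial>lborel) \<le> ennreal e"
    apply (rule uniform_tail[OF s(1,3) B g0 \<gamma>(2) e])
    subgoal for m by (rule that[of m]) (simp add: bounded_by_def)
    done
  define T where "T = 2 powr real m"
  define K where "K = T powr (\<gamma> - 2)"
  show ?thesis
  proof (rule that[of K])
    show "K \<ge> 0" unfolding K_def by simp
    fix w assume w: "bounded_by B w"
    then have [measurable]: "w \<in> borel_measurable borel" unfolding bounded_by_def by simp
    have pt: "ennreal (\<bar>w x\<bar> powr \<gamma>) \<le> ennreal K * ennreal ((w x)\<^sup>2) + ennreal (\<bar>w x\<bar> powr \<gamma>) * indicator {x. T \<le> \<bar>w x\<bar>} x" for x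
    proof (cases "T \<le> \<bar>w x\<bar>")
      case False
      have "\<bar>w x\<bar> powr \<gamma> = \<bar>w x\<bar> powr (\<gamma> - 2) * \<bar>w x\<bar> powr 2" unfolding powr_add[symmetric] by simp
      also have "\<dots> \<le> T powr (\<gamma> - 2) * \<bar>w x\<bar> powr 2" using False \<gamma> by (intro mult_right_mono powr_mono2) auto
      also have "\<bar>w x\<bar> powr 2 = (w x)\<^sup>2" by (simp add: powr_numeral)
      finally show ?thesis unfolding K_def by (simp add: ennreal_mult[symmetric] ennreal_leI add_increasing2)
    qed (simp add: add_increasing)
    have "(\<integral>\<^sup>+x. ennreal (\<bar>w x\<bar> powr \<gamma>) \<partial>lborel) \<le>
      (\<integral>\<^sup>+x. ennreal K * ennreal ((w x)\<^sup>2) + ennreal (\<bar>w x\<bar> powr \<gamma>) * indicator {x. T \<le> \<bar>w x\<bar>} x \<partial>lborel)"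
      by (intro nn_integral_mono pt)
    also have "\<dots> = ennreal K * (\<integral>\<^sup>+x. ennreal ((w x)\<^sup>2) \<partial>lborel) + (\<integral>\<^sup>+x. ennreal (\<bar>w x\<bar> powr \<gamma>) * indicator {x. T \<le> \<bar>w x\<bar>} x \<partial>lborel)"
      by (simp add: nn_integral_add nn_integral_cmult)
    also have "\<dots> \<le> ennreal K * (\<integral>\<^sup>+x. ennreal ((w x)\<^sup>2) \<partial>lborel) + ennreal e"
      using m[OF w] unfolding T_def by (intro add_left_mono)
    finally show "(\<integral>\<^sup>+x. ennreal (\<bar>w x\<bar> powr \<gamma>) \<partial>lborel) \<le> ennreal K * (\<integral>\<^sup>+x. ennreal ((w x)\<^sup>2) \<partial>lborel) + ennreal e" .
  qed
qed

lemma X1_powr: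
  assumes \<gamma>: "2 \<le> \<gamma>" "\<gamma> < crit_exp (real CARD('n)) s" and B: "B \<ge> 0"
  obtains K where "\<And>u. u \<in> X1 s V \<Longrightarrow> form u u \<le> B \<Longrightarrow>
    integrable lebesgue (\<lambda>x. \<bar>u x\<bar> powr \<gamma>) \<and> (LINT x|lebesgue. \<bar>u x\<bar> powr \<gamma>) \<le> K"
proof -
  define B' where "B' = B + B / V0"
  have B': "B' \<ge> 0" unfolding B'_def using B V0(1) by simp
  obtain K where K: "K \<ge> 0" "\<And>w. bounded_by B' w \<Longrightarrow>
    (\<integral>\<^sup>+x. ennreal (\<bar>w x\<bar> powr \<gamma>) \<partial>lborel) \<le> ennreal K * (\<integral>\<^sup>+x. ennreal ((w x)\<^sup>2) \<partial>lborel) + ennreal 1"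
    using bounded_by_powr[OF \<gamma> B' zero_less_one] by blast
  show ?thesis
  proof (rule that[of "K * B' + 1"])
    fix u assume u: "u \<in> X1 s V" "form u u \<le> B"
    note [measurable] = X1_D(1)[OF u(1)]
    obtain u' where u': "bounded_by B' u'" "AE x in lebesgue. u x = u' x"
      using X1_representative[OF u B] unfolding B'_def by blast
    have "(\<integral>\<^sup>+x. ennreal (\<bar>u x\<bar> powr \<gamma>) \<partial>lebesgue) = (\<integral>\<^sup>+x. ennreal (\<bar>u' x\<bar> powr \<gamma>) \<partial>lborel)"
      unfolding nn_integral_completion by (rule nn_integral_lborel_AE_cong) (use u'(2) in \<open>auto elim!: eventually_mono\<close>)
    also have "\<dots> \<le> ennreal K * (\<integral>\<^sup>+x. ennreal ((u' x)\<^sup>2) \<partial>lborel) + ennreal 1" using K(2)[OF u'(1)] .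
    also have "\<dots> \<le> ennreal K * ennreal B' + ennreal 1"
      using u'(1) unfolding bounded_by_def by (intro add_right_mono mult_left_mono) auto
    also have "\<dots> = ennreal (K * B' + 1)"
      using K(1) B' by (subst ennreal_plus) (auto simp: ennreal_mult)
    finally have le: "(\<integral>\<^sup>+x. ennreal (\<bar>u x\<bar> powr \<gamma>) \<partial>lebesgue) \<le> ennreal (K * B' + 1)" .
    then have i: "integrable lebesgue (\<lambda>x. \<bar>u x\<bar> powr \<gamma>)"
      by (intro integrableI_nonneg) (auto intro: le_less_trans)
    have "K * B' + 1 \<ge> 0" using K(1) B' by simp
    then have "(LINT x|lebesgue. \<bar>u x\<bar> powr \<gamma>) \<le> K * B' + 1"
      using le nn_integral_eq_integral[OF i] by simp
    with i show "integrable lebesgue (\<lambda>x. \<bar>u x\<bar> powr \<gamma>) \<and> (LINT x|lebesgue. \<bar>u x\<bar> powr \<gamma>) \<le> K * B' + 1" ..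
  qed
qed

lemma X1_powr_integrable:
  assumes "2 \<le> \<gamma>" "\<gamma> < crit_exp (real CARD('n)) s" "u \<in> X1 s V"
  shows "integrable lebesgue (\<lambda>x. \<bar>u x\<bar> powr \<gamma>)"
  by (rule X1_powr[OF assms(1,2) form_nonneg[of u]]) (use assms(3) in auto)

lemma form_lsc:
  assumes u: "\<And>n. u n \<in> X1 s V" and [measurable]: "v \<in> borel_measurable lebesgue"
    and ae: "AE x in lebesgue. (\<lambda>n. u n x) \<longlonglongrightarrow> v x" and L: "(\<lambda>n. form (u n) (u n)) \<longlonglongrightarrow> L"
  shows "v \<in> X1 s V" "form v v \<le> L"
proof -
  define g where "g n = integral\<^sup>L lebesgue (gagliardo s (u n) (u n))" for n
  define h where "h n = (LINT x|lebesgue. V x * u n x * u n x)" for n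
  have nn: "0 \<le> V x * c * c" for x and c :: real using V_nonneg by (simp add: mult.assoc)
  have gh: "0 \<le> g n" "0 \<le> h n" "g n + h n = form (u n) (u n)" for n
    unfolding g_def h_def form_def by (auto intro!: Bochner_Integration.integral_nonneg simp: gagliardo_nonneg nn)
  have "Bseq (\<lambda>n. form (u n) (u n))" using L by (intro convergent_imp_Bseq convergentI)
  then obtain b where "\<And>n. norm (form (u n) (u n)) \<le> b" unfolding Bseq_def by blast
  then have b: "form (u n) (u n) \<le> b" for n using abs_le_D1 by (metis real_norm_def)
  have "norm (g n) \<le> b" for n using gh(1,2)[of n] gh(3)[of n] b[of n] by simp
  \<comment> \<open>The two parts of the form need converge separately only along a subsequence;
    there Fatou's lemma applies to each, and the two limits add up to \<open>L\<close>.\<close>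
  then have "bounded (range g)" unfolding bounded_iff by blast
  then obtain L1 r where r: "strict_mono (r :: nat \<Rightarrow> nat)" "(\<lambda>n. g (r n)) \<longlonglongrightarrow> L1"
    using bounded_imp_convergent_subsequence unfolding o_def by blast
  have "(\<lambda>n. form (u (r n)) (u (r n)) - g (r n)) \<longlonglongrightarrow> L - L1"
    using LIMSEQ_subseq_LIMSEQ[OF L r(1)] r(2) by (intro tendsto_diff) (auto simp: o_def)
  then have h: "(\<lambda>n. h (r n)) \<longlonglongrightarrow> L - L1" unfolding gh(3)[symmetric] by simp
  have ae1: "AE x in lebesgue. (\<lambda>n. u (r n) x) \<longlonglongrightarrow> v x"
    using ae by eventually_elim (drule LIMSEQ_subseq_LIMSEQ[OF _ r(1)], simp add: o_def)
  have ae2: "AE z in lebesgue. (\<lambda>n. gagliardo s (u (r n)) (u (r n)) z) \<longlonglongrightarrow> gagliardo s v v z"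
    using AE_lebesgue_fst[OF ae1] AE_lebesgue_snd[OF ae1]
  proof eventually_elim
    case (elim z)
    show ?case unfolding gagliardo_def case_prod_beta divide_inverse by (intro tendsto_intros elim)
  qed
  have ae3: "AE x in lebesgue. (\<lambda>n. V x * u (r n) x * u (r n) x) \<longlonglongrightarrow> V x * v x * v x"
    using ae1 by eventually_elim (intro tendsto_intros)
  have 1: "integrable lebesgue (gagliardo s v v)" "integral\<^sup>L lebesgue (gagliardo s v v) \<le> L1"
    using fatou_real[of lebesgue "\<lambda>n. gagliardo s (u (r n)) (u (r n))", OF X1_D(3)[OF u] gagliardo_nonneg gagliardo_nonneg _ ae2 r(2)[unfolded g_def]] by simp_all
  have 2: "integrable lebesgue (\<lambda>x. V x * v x * v x)" "(LINT x|lebesgue. V x * v x * v x) \<le> L - L1"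
    using fatou_real[of lebesgue "\<lambda>n x. V x * u (r n) x * u (r n) x" "\<lambda>x. V x * v x * v x", OF form_integrable(2)[OF u u] nn nn _ ae3 h[unfolded h_def]] by simp_all
  show "v \<in> X1 s V" using 1 2 by (intro X1_I) (auto simp: power2_eq_square mult.assoc)
  show "form v v \<le> L" unfolding form_def using 1 2 by simp
qed

text \<open>\<open>rellich\<close>, applied to Borel representatives, gives convergence almost
  everywhere and in L^2; \<open>bounded_by_powr\<close>, applied to the differences from the limit,
  extends it to both exponents.\<close>

proposition X1_compact:
  assumes u: "\<And>n. u n \<in> X1 s V" "\<And>n. form (u n) (u n) \<le> B"
    and \<gamma>: "2 \<le> \<gamma>" "\<gamma> < crit_exp (real CARD('n)) s"
  obtains r v L where "strict_mono (r :: nat \<Rightarrow> nat)" "v \<in> X1 s V"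
    "AE x in lebesgue. (\<lambda>n. u (r n) x) \<longlonglongrightarrow> v x"
    "(\<lambda>n. form (u (r n)) (u (r n))) \<longlonglongrightarrow> L" "form v v \<le> L"
    "(\<lambda>n. LINT x|lebesgue. \<bar>u (r n) x\<bar> powr 2) \<longlonglongrightarrow> (LINT x|lebesgue. \<bar>v x\<bar> powr 2)"
    "(\<lambda>n. LINT x|lebesgue. \<bar>u (r n) x\<bar> powr \<gamma>) \<longlonglongrightarrow> (LINT x|lebesgue. \<bar>v x\<bar> powr \<gamma>)"
proof -
  have B: "B \<ge> 0" using u(2)[of 0] form_nonneg[of "u 0"] by linarith
  define B' where "B' = B + B / V0"
  have B': "B' \<ge> 0" unfolding B'_def using B V0(1) by simp
  have "\<forall>n. \<exists>u'. bounded_by B' u' \<and> (AE x in lebesgue. u n x = u' x)"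
    using X1_representative[OF u B] unfolding B'_def by metis
  then obtain u' where u': "\<And>n. bounded_by B' (u' n)" "\<And>n. AE x in lebesgue. u n x = u' n x" by metis
  have "bounded (range (\<lambda>n. form (u n) (u n)))"
    unfolding bounded_iff using u(2) form_nonneg by (intro exI[of _ B]) auto
  then obtain L r1 where r1: "strict_mono (r1 :: nat \<Rightarrow> nat)" "(\<lambda>n. form (u (r1 n)) (u (r1 n))) \<longlonglongrightarrow> L"
    using bounded_imp_convergent_subsequence unfolding o_def by blast
  obtain r2 v where r2: "strict_mono (r2 :: nat \<Rightarrow> nat)" and v: "v \<in> borel_measurable borel"
    and ae: "AE x in lborel. (\<lambda>n. u' (r1 (r2 n)) x) \<longlonglongrightarrow> v x"
    and l2: "(\<lambda>n. \<integral>\<^sup>+x. ennreal ((u' (r1 (r2 n)) x - v x)\<^sup>2) \<partial>lborel) \<longlonglongrightarrow> 0"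
    using rellich[of B' "\<lambda>n. u' (r1 n)", OF u'(1) B'] by blast
  define r where "r n = r1 (r2 n)" for n
  have r: "strict_mono r" using strict_mono_o[OF r1(1) r2] unfolding r_def o_def .
  note [measurable] = X1_D(1)[OF u(1)] v
  have vm [measurable]: "v \<in> borel_measurable lebesgue" using v by (intro measurable_completion) simp
  have aeq: "AE x in lebesgue. \<forall>n. u n x = u' n x" using u'(2) by (simp add: AE_all_countable)
  have ae': "AE x in lebesgue. (\<lambda>n. u (r n) x) \<longlonglongrightarrow> v x"
    using AE_completion[OF ae] aeq unfolding r_def by eventually_elim simp
  have fL: "(\<lambda>n. form (u (r n)) (u (r n))) \<longlonglongrightarrow> L"
    using LIMSEQ_subseq_LIMSEQ[OF r1(2) r2] by (simp add: o_def r_def)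
  have vX: "v \<in> X1 s V" "form v v \<le> L" using form_lsc[OF u(1) vm ae' fL] by auto
  define w where "w n x = u (r n) x - v x" for n x
  have wX: "w n \<in> X1 s V" for n unfolding w_def by (rule X1_diff[OF u(1) vX(1)])
  \<comment> \<open>A common bound for the forms of all differences, by \<open>form_diff_le\<close>,
    so that one constant of \<open>bounded_by_powr\<close> serves the whole sequence.\<close>
  define D where "D = 2 * (B + form v v)"
  have D: "D \<ge> 0" unfolding D_def using B form_nonneg by simp
  have wD: "form (w n) (w n) \<le> D" for n
    unfolding D_def w_def using form_diff_le[OF u(1)[of "r n"] vX(1)] u(2)[of "r n"] by simp
  define D' where "D' = D + D / V0"
  have D': "D' \<ge> 0" unfolding D'_def using D V0(1) by simp
  have w2: "(\<integral>\<^sup>+x. ennreal ((w n x)\<^sup>2) \<partial>lborel) = (\<integral>\<^sup>+x. ennreal ((u' (r n) x - v x)\<^sup>2) \<partial>lborel)" for n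
    unfolding w_def by (rule nn_integral_lborel_AE_cong) (use u'(2)[of "r n"] in \<open>auto elim!: eventually_mono\<close>)
  have lim: "(\<lambda>n. LINT x|lebesgue. \<bar>w n x\<bar> powr \<rho>) \<longlonglongrightarrow> 0" if \<rho>: "2 \<le> \<rho>" "\<rho> < crit_exp (real CARD('n)) s" for \<rho>
  proof (rule LIMSEQ_I)
    fix e :: real assume e: "e > 0"
    obtain K where K: "K \<ge> 0" "\<And>w. bounded_by D' w \<Longrightarrow>
      (\<integral>\<^sup>+x. ennreal (\<bar>w x\<bar> powr \<rho>) \<partial>lborel) \<le> ennreal K * (\<integral>\<^sup>+x. ennreal ((w x)\<^sup>2) \<partial>lborel) + ennreal (e/2)"
      using bounded_by_powr[OF \<rho> D', of "e/2"] e by auto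
    have "(\<lambda>n. ennreal K * (\<integral>\<^sup>+x. ennreal ((w n x)\<^sup>2) \<partial>lborel) + ennreal (e/2)) \<longlonglongrightarrow> ennreal K * 0 + ennreal (e/2)"
      unfolding w2 r_def by (intro tendsto_add tendsto_const ennreal_tendsto_cmult l2) simp
    moreover have "ennreal K * 0 + ennreal (e/2) < ennreal e" using e by (simp add: ennreal_less_iff)
    ultimately have "\<forall>\<^sub>F n in sequentially. ennreal K * (\<integral>\<^sup>+x. ennreal ((w n x)\<^sup>2) \<partial>lborel) + ennreal (e/2) < ennreal e"
      by (rule order_tendstoD(2))
    then have "\<forall>\<^sub>F n in sequentially. norm ((LINT x|lebesgue. \<bar>w n x\<bar> powr \<rho>) - 0) < e"
    proof eventually_elim
      case (elim n)
      obtain w' where w': "bounded_by D' w'" "AE x in lebesgue. w n x = w' x"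
        using X1_representative[OF wX wD D] unfolding D'_def by blast
      have q1: "(\<integral>\<^sup>+x. ennreal (\<bar>w n x\<bar> powr \<rho>) \<partial>lborel) = (\<integral>\<^sup>+x. ennreal (\<bar>w' x\<bar> powr \<rho>) \<partial>lborel)"
        by (rule nn_integral_lborel_AE_cong) (use w'(2) in \<open>auto elim!: eventually_mono\<close>)
      have q2: "(\<integral>\<^sup>+x. ennreal ((w n x)\<^sup>2) \<partial>lborel) = (\<integral>\<^sup>+x. ennreal ((w' x)\<^sup>2) \<partial>lborel)"
        by (rule nn_integral_lborel_AE_cong) (use w'(2) in \<open>auto elim!: eventually_mono\<close>)
      have lt: "(\<integral>\<^sup>+x. ennreal (\<bar>w n x\<bar> powr \<rho>) \<partial>lborel) < ennreal e"
        using K(2)[OF w'(1)] elim unfolding q1 q2 by (rule le_less_trans)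
      have fin: "(\<integral>\<^sup>+x. ennreal (\<bar>w n x\<bar> powr \<rho>) \<partial>lborel) < \<infinity>"
        using lt by (rule less_trans) simp
      have "(\<lambda>x. \<bar>w n x\<bar> powr \<rho>) \<in> borel_measurable lebesgue" unfolding w_def by measurable
      from nn_integral_eq_lebesgue_integral(2)[OF this _ fin] lt
      have "ennreal (LINT x|lebesgue. \<bar>w n x\<bar> powr \<rho>) < ennreal e" by simp
      then show ?case by (simp add: ennreal_less_iff Bochner_Integration.integral_nonneg)
    qed
    then show "\<exists>no. \<forall>n\<ge>no. norm ((LINT x|lebesgue. \<bar>w n x\<bar> powr \<rho>) - 0) < e"
      by (simp add: eventually_sequentially)
  qed
  have fin: "(\<lambda>n. LINT x|lebesgue. \<bar>u (r n) x\<bar> powr \<rho>) \<longlonglongrightarrow> (LINT x|lebesgue. \<bar>v x\<bar> powr \<rho>)"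
    if \<rho>: "2 \<le> \<rho>" "\<rho> < crit_exp (real CARD('n)) s" for \<rho>
    using \<rho> X1_powr_integrable[OF \<rho> wX] X1_powr_integrable[OF \<rho> vX(1)] lim[OF \<rho>] unfolding w_def
    by (intro powr_integral_tendsto[OF _ _ _ ae']) auto
  show ?thesis
    using that[OF r vX(1) ae' fL vX(2) fin[OF order_refl two_less_crit] fin[OF \<gamma>]] .
qed

end

subsection \<open>The functionals of the singular system\<close>

lemma weight_integrable:
  fixes c u :: "real^'n \<Rightarrow> real"
  assumes c: "c \<in> Lp (2 / (1 + r))" "\<And>x. c x > 0" and r: "0 < r" "r < 1"
    and [measurable]: "u \<in> borel_measurable lebesgue" and u: "integrable lebesgue (\<lambda>x. \<bar>u x\<bar> powr 2)"
  shows "integrable lebesgue (\<lambda>x. c x * \<bar>u x\<bar> powr (1 - r))"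
    "(LINT x|lebesgue. c x * \<bar>u x\<bar> powr (1 - r)) \<le> (LINT x|lebesgue. c x powr (2 / (1 + r))) + (LINT x|lebesgue. \<bar>u x\<bar> powr 2)"
proof -
  have cm [measurable]: "c \<in> borel_measurable lebesgue" and ci: "integrable lebesgue (\<lambda>x. c x powr (2 / (1 + r)))"
    using c unfolding Lp_def by (auto simp: abs_of_pos)
  have le: "c x * \<bar>u x\<bar> powr (1 - r) \<le> c x powr (2 / (1 + r)) + \<bar>u x\<bar> powr 2" for x
    using weight_powr_le[of "c x" "\<bar>u x\<bar>" r] c(2)[of x] r by (simp add: powr_numeral)
  show i: "integrable lebesgue (\<lambda>x. c x * \<bar>u x\<bar> powr (1 - r))"
    by (rule Bochner_Integration.integrable_bound[OF Bochner_Integration.integrable_add[OF ci u]])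
      (use le c(2) in \<open>auto simp: less_imp_le\<close>)
  have "(LINT x|lebesgue. c x * \<bar>u x\<bar> powr (1 - r)) \<le> (LINT x|lebesgue. c x powr (2 / (1 + r)) + \<bar>u x\<bar> powr 2)"
    using i ci u le by (intro integral_mono) auto
  then show "(LINT x|lebesgue. c x * \<bar>u x\<bar> powr (1 - r)) \<le> (LINT x|lebesgue. c x powr (2 / (1 + r))) + (LINT x|lebesgue. \<bar>u x\<bar> powr 2)"
    using ci u by simp
qed

lemma abs_powr_tendsto:
  fixes y :: "nat \<Rightarrow> real"
  assumes "y \<longlonglongrightarrow> c" "k > 0" shows "(\<lambda>n. \<bar>y n\<bar> powr k) \<longlonglongrightarrow> \<bar>c\<bar> powr k"
  using assms by (intro tendsto_powr' tendsto_rabs tendsto_const) auto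

lemma weight_tendsto:
  fixes c u :: "real^'n \<Rightarrow> real"
  assumes c: "c \<in> Lp (2 / (1 + r))" "\<And>x. c x > 0" and r: "0 < r" "r < 1"
    and [measurable]: "\<And>n. v n \<in> borel_measurable lebesgue" "u \<in> borel_measurable lebesgue"
    and i: "\<And>n. integrable lebesgue (\<lambda>x. \<bar>v n x\<bar> powr 2)" "integrable lebesgue (\<lambda>x. \<bar>u x\<bar> powr 2)"
    and ae: "AE x in lebesgue. (\<lambda>n. v n x) \<longlonglongrightarrow> u x"
    and lim: "(\<lambda>n. LINT x|lebesgue. \<bar>v n x\<bar> powr 2) \<longlonglongrightarrow> (LINT x|lebesgue. \<bar>u x\<bar> powr 2)"
  shows "(\<lambda>n. LINT x|lebesgue. c x * \<bar>v n x\<bar> powr (1 - r)) \<longlonglongrightarrow> (LINT x|lebesgue. c x * \<bar>u x\<bar> powr (1 - r))"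
proof -
  have cm [measurable]: "c \<in> borel_measurable lebesgue" and ci: "integrable lebesgue (\<lambda>x. c x powr (2 / (1 + r)))"
    using c unfolding Lp_def by (auto simp: abs_of_pos)
  show ?thesis
  proof (rule generalized_dominated_convergence(2)[where g="\<lambda>n x. c x powr (2 / (1 + r)) + \<bar>v n x\<bar> powr 2"
        and G="\<lambda>x. c x powr (2 / (1 + r)) + \<bar>u x\<bar> powr 2"])
    show "AE x in lebesgue. \<bar>c x * \<bar>v n x\<bar> powr (1 - r)\<bar> \<le> c x powr (2 / (1 + r)) + \<bar>v n x\<bar> powr 2" for n
    proof (rule AE_I2)
      fix x show "\<bar>c x * \<bar>v n x\<bar> powr (1 - r)\<bar> \<le> c x powr (2 / (1 + r)) + \<bar>v n x\<bar> powr 2"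
        using weight_powr_le[of "c x" "\<bar>v n x\<bar>" r] c(2)[of x] r by (simp add: powr_numeral abs_mult)
    qed
    show "AE x in lebesgue. (\<lambda>n. c x * \<bar>v n x\<bar> powr (1 - r)) \<longlonglongrightarrow> c x * \<bar>u x\<bar> powr (1 - r)"
      using ae by eventually_elim (intro tendsto_intros abs_powr_tendsto, use r in auto)
    show "AE x in lebesgue. (\<lambda>n. c x powr (2 / (1 + r)) + \<bar>v n x\<bar> powr 2) \<longlonglongrightarrow> c x powr (2 / (1 + r)) + \<bar>u x\<bar> powr 2"
      using ae by eventually_elim (intro tendsto_add tendsto_const abs_powr_tendsto, auto)
    show "(\<lambda>n. LINT x|lebesgue. c x powr (2 / (1 + r)) + \<bar>v n x\<bar> powr 2) \<longlonglongrightarrow> (LINT x|lebesgue. c x powr (2 / (1 + r)) + \<bar>u x\<bar> powr 2)"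
      using ci i lim by (simp add: tendsto_add)
  qed (use ci i in auto)
qed

lemma coupling_integrable:
  fixes u v :: "real^'n \<Rightarrow> real"
  assumes "\<alpha> > 0" "\<beta> > 0" and [measurable]: "u \<in> borel_measurable lebesgue" "v \<in> borel_measurable lebesgue"
    and i: "integrable lebesgue (\<lambda>x. \<bar>u x\<bar> powr (\<alpha> + \<beta>))" "integrable lebesgue (\<lambda>x. \<bar>v x\<bar> powr (\<alpha> + \<beta>))"
  shows "integrable lebesgue (\<lambda>x. \<bar>u x\<bar> powr \<alpha> * \<bar>v x\<bar> powr \<beta>)"
    "(LINT x|lebesgue. \<bar>u x\<bar> powr \<alpha> * \<bar>v x\<bar> powr \<beta>) \<le> (LINT x|lebesgue. \<bar>u x\<bar> powr (\<alpha> + \<beta>)) + (LINT x|lebesgue. \<bar>v x\<bar> powr (\<alpha> + \<beta>))"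
proof -
  have le: "\<bar>u x\<bar> powr \<alpha> * \<bar>v x\<bar> powr \<beta> \<le> \<bar>u x\<bar> powr (\<alpha> + \<beta>) + \<bar>v x\<bar> powr (\<alpha> + \<beta>)" for x
    using assms by (intro powr_mult_le_sum) auto
  show j: "integrable lebesgue (\<lambda>x. \<bar>u x\<bar> powr \<alpha> * \<bar>v x\<bar> powr \<beta>)"
    by (rule Bochner_Integration.integrable_bound[OF Bochner_Integration.integrable_add[OF i]])
      (use le in auto)
  have "(LINT x|lebesgue. \<bar>u x\<bar> powr \<alpha> * \<bar>v x\<bar> powr \<beta>) \<le> (LINT x|lebesgue. \<bar>u x\<bar> powr (\<alpha> + \<beta>) + \<bar>v x\<bar> powr (\<alpha> + \<beta>))"
    using i j le by (intro integral_mono) auto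
  then show "(LINT x|lebesgue. \<bar>u x\<bar> powr \<alpha> * \<bar>v x\<bar> powr \<beta>) \<le> (LINT x|lebesgue. \<bar>u x\<bar> powr (\<alpha> + \<beta>)) + (LINT x|lebesgue. \<bar>v x\<bar> powr (\<alpha> + \<beta>))"
    using i by simp
qed

lemma coupling_tendsto:
  fixes u v :: "real^'n \<Rightarrow> real"
  assumes ab: "\<alpha> > 0" "\<beta> > 0"
    and [measurable]: "\<And>n. un n \<in> borel_measurable lebesgue" "\<And>n. vn n \<in> borel_measurable lebesgue"
      "u \<in> borel_measurable lebesgue" "v \<in> borel_measurable lebesgue"
    and i: "\<And>n. integrable lebesgue (\<lambda>x. \<bar>un n x\<bar> powr (\<alpha> + \<beta>))" "\<And>n. integrable lebesgue (\<lambda>x. \<bar>vn n x\<bar> powr (\<alpha> + \<beta>))"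
      "integrable lebesgue (\<lambda>x. \<bar>u x\<bar> powr (\<alpha> + \<beta>))" "integrable lebesgue (\<lambda>x. \<bar>v x\<bar> powr (\<alpha> + \<beta>))"
    and ae: "AE x in lebesgue. (\<lambda>n. un n x) \<longlonglongrightarrow> u x" "AE x in lebesgue. (\<lambda>n. vn n x) \<longlonglongrightarrow> v x"
    and lim: "(\<lambda>n. LINT x|lebesgue. \<bar>un n x\<bar> powr (\<alpha> + \<beta>)) \<longlonglongrightarrow> (LINT x|lebesgue. \<bar>u x\<bar> powr (\<alpha> + \<beta>))"
      "(\<lambda>n. LINT x|lebesgue. \<bar>vn n x\<bar> powr (\<alpha> + \<beta>)) \<longlonglongrightarrow> (LINT x|lebesgue. \<bar>v x\<bar> powr (\<alpha> + \<beta>))"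
  shows "(\<lambda>n. LINT x|lebesgue. \<bar>un n x\<bar> powr \<alpha> * \<bar>vn n x\<bar> powr \<beta>) \<longlonglongrightarrow> (LINT x|lebesgue. \<bar>u x\<bar> powr \<alpha> * \<bar>v x\<bar> powr \<beta>)"
proof (rule generalized_dominated_convergence(2)[where g="\<lambda>n x. \<bar>un n x\<bar> powr (\<alpha> + \<beta>) + \<bar>vn n x\<bar> powr (\<alpha> + \<beta>)"
      and G="\<lambda>x. \<bar>u x\<bar> powr (\<alpha> + \<beta>) + \<bar>v x\<bar> powr (\<alpha> + \<beta>)"])
  show "AE x in lebesgue. \<bar>\<bar>un n x\<bar> powr \<alpha> * \<bar>vn n x\<bar> powr \<beta>\<bar> \<le> \<bar>un n x\<bar> powr (\<alpha> + \<beta>) + \<bar>vn n x\<bar> powr (\<alpha> + \<beta>)" for n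
  proof (rule AE_I2)
    fix x show "\<bar>\<bar>un n x\<bar> powr \<alpha> * \<bar>vn n x\<bar> powr \<beta>\<bar> \<le> \<bar>un n x\<bar> powr (\<alpha> + \<beta>) + \<bar>vn n x\<bar> powr (\<alpha> + \<beta>)"
      using powr_mult_le_sum[of \<alpha> \<beta> "\<bar>un n x\<bar>" "\<bar>vn n x\<bar>"] ab by (simp add: abs_mult)
  qed
  show "AE x in lebesgue. (\<lambda>n. \<bar>un n x\<bar> powr \<alpha> * \<bar>vn n x\<bar> powr \<beta>) \<longlonglongrightarrow> \<bar>u x\<bar> powr \<alpha> * \<bar>v x\<bar> powr \<beta>"
    using ae by eventually_elim (intro tendsto_mult abs_powr_tendsto, use ab in auto)
  show "AE x in lebesgue. (\<lambda>n. \<bar>un n x\<bar> powr (\<alpha> + \<beta>) + \<bar>vn n x\<bar> powr (\<alpha> + \<beta>)) \<longlonglongrightarrow> \<bar>u x\<bar> powr (\<alpha> + \<beta>) + \<bar>v x\<bar> powr (\<alpha> + \<beta>)"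
    using ae by eventually_elim (intro tendsto_add abs_powr_tendsto, use ab in auto)
  show "(\<lambda>n. LINT x|lebesgue. \<bar>un n x\<bar> powr (\<alpha> + \<beta>) + \<bar>vn n x\<bar> powr (\<alpha> + \<beta>)) \<longlonglongrightarrow>
    (LINT x|lebesgue. \<bar>u x\<bar> powr (\<alpha> + \<beta>) + \<bar>v x\<bar> powr (\<alpha> + \<beta>))"
    using i lim by (simp add: tendsto_add)
qed (use i in auto)

lemma (in potential) form_abs_le: assumes "u \<in> X1 s V" shows "form (\<lambda>x. \<bar>u x\<bar>) (\<lambda>x. \<bar>u x\<bar>) \<le> form u u"
proof -
  have "(LINT x|lebesgue. V x * \<bar>u x\<bar> * \<bar>u x\<bar>) = (LINT x|lebesgue. V x * u x * u x)"
    by (simp add: mult.assoc)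
  moreover have "integral\<^sup>L lebesgue (gagliardo s (\<lambda>x. \<bar>u x\<bar>) (\<lambda>x. \<bar>u x\<bar>)) \<le> integral\<^sup>L lebesgue (gagliardo s u u)"
    using X1_D(3)[OF assms] X1_D(3)[OF X1_abs[OF assms]] gagliardo_abs_le by (intro integral_mono) auto
  ultimately show ?thesis unfolding form_def by simp
qed

text \<open>The weight is positive everywhere, so a vanishing singular integral leaves only the zero
  function.\<close>

lemma (in potential) weight_zero_form_zero:
  assumes u: "u \<in> X1 s V" and c: "c \<in> Lp (2 / (1 + r))" "\<And>x. c x > 0" and r: "0 < r" "r < 1"
    and z: "(LINT x|lebesgue. c x * \<bar>u x\<bar> powr (1 - r)) = 0"
  shows "AE x in lebesgue. u x = 0" "form u u = 0"
proof -
  note [measurable] = X1_D(1)[OF u]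
  have "integrable lebesgue (\<lambda>x. \<bar>u x\<bar> powr 2)" using X1_D(2)[OF u] by (simp add: powr_numeral)
  note i = weight_integrable(1)[OF c r X1_D(1)[OF u] this]
  have "AE x in lebesgue. c x * \<bar>u x\<bar> powr (1 - r) = 0"
    using integral_nonneg_eq_0_iff_AE[OF i] z c(2) by (simp add: less_imp_le)
  then show ae: "AE x in lebesgue. u x = 0"
  proof eventually_elim
    case (elim x)
    then show ?case using c(2)[of x] by simp
  qed
  have "form u u = form (\<lambda>x. 0) (\<lambda>x. 0)" by (rule form_AE_cong) (use ae in auto)
  then show "form u u = 0" using form_zero by simp
qed

section \<open>The concrete system for a fixed \<lambda>\<close>

locale singular_system =
  fixes s \<alpha> \<beta> p q \<theta> V0 l :: real
    and a b V1 V2 :: "real^'n \<Rightarrow> real"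
  assumes s: "0 < s" "s < 1" "real CARD('n) > 2 * s"
    and \<alpha>\<beta>: "\<alpha> > 1" "\<beta> > 1"
    and \<gamma>: "2 < \<alpha> + \<beta>" "\<alpha> + \<beta> < 2 * real CARD('n) / (real CARD('n) - 2 * s)"
    and pq: "0 < p" "p \<le> q" "q < 1" and \<theta>: "\<theta> > 0"
    and ab_Lp: "a \<in> Lp (2 / (1 + p))" "b \<in> Lp (2 / (1 + q))"
    and ab_pos: "\<And>x. a x > 0" "\<And>x. b x > 0"
    and V_cont: "continuous_on UNIV V1" "continuous_on UNIV V2"
    and V0: "V0 > 0" "\<And>x. V1 x \<ge> V0" "\<And>x. V2 x \<ge> V0"
    and V_fin: "\<And>M. M > 0 \<Longrightarrow> emeasure lebesgue {x. V1 x \<le> M} < \<infinity>"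
      "\<And>M. M > 0 \<Longrightarrow> emeasure lebesgue {x. V2 x \<le> M} < \<infinity>"
    and l: "0 < l" "ereal l < lambda_star s V1 V2 \<theta> \<alpha> \<beta> p q a b"

sublocale singular_system \<subseteq> pot1: potential s V1 V0
  using s V_cont V0 V_fin by unfold_locales auto

sublocale singular_system \<subseteq> pot2: potential s V2 V0
  using s V_cont V0 V_fin by unfold_locales auto

context singular_system begin

definition W :: "((real^'n \<Rightarrow> real) \<times> (real^'n \<Rightarrow> real)) set" where
  "W = X s V1 V2"

definition Wp :: "((real^'n \<Rightarrow> real) \<times> (real^'n \<Rightarrow> real)) set" where
  "Wp = {w \<in> W. \<forall>x. 0 \<le> fst w x \<and> 0 \<le> snd w x}"

definition scl :: "real \<Rightarrow> (real^'n \<Rightarrow> real) \<times> (real^'n \<Rightarrow> real) \<Rightarrow> (real^'n \<Rightarrow> real) \<times> (real^'n \<Rightarrow> real)" where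
  "scl t w = (\<lambda>x. t * fst w x, \<lambda>x. t * snd w x)"

definition A :: "(real^'n \<Rightarrow> real) \<times> (real^'n \<Rightarrow> real) \<Rightarrow> real" where
  "A w = pot1.form (fst w) (fst w) + pot2.form (snd w) (snd w)"

definition C :: "(real^'n \<Rightarrow> real) \<times> (real^'n \<Rightarrow> real) \<Rightarrow> real" where
  "C w = (LINT x|lebesgue. \<bar>fst w x\<bar> powr \<alpha> * \<bar>snd w x\<bar> powr \<beta>)"

definition P :: "(real^'n \<Rightarrow> real) \<times> (real^'n \<Rightarrow> real) \<Rightarrow> real" where
  "P w = (LINT x|lebesgue. a x * \<bar>fst w x\<bar> powr (1 - p))"

definition Q :: "(real^'n \<Rightarrow> real) \<times> (real^'n \<Rightarrow> real) \<Rightarrow> real" where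
  "Q w = (LINT x|lebesgue. b x * \<bar>snd w x\<bar> powr (1 - q))"

lemma W_iff: "w \<in> W \<longleftrightarrow> fst w \<in> X1 s V1 \<and> snd w \<in> X1 s V2"
  unfolding W_def X_def by (cases w) auto

lemma subcritical: "\<alpha> + \<beta> < crit_exp (real CARD('n)) s"
proof -
  have "2 * real CARD('n) / (real CARD('n) - 2 * s) = crit_exp (real CARD('n)) s"
    unfolding crit_exp_def using s by (simp add: field_simps)
  then show ?thesis using \<gamma> by simp
qed

lemma pq': "0 < q" "p < 1" using pq by auto

lemma X_inner_eq:
  assumes "(u, v) \<in> X s V1 V2" "(\<phi>, \<psi>) \<in> X s V1 V2"
  shows "integrable lebesgue (gagliardo2 s (u, v) (\<phi>, \<psi>))"
    "integrable lebesgue (\<lambda>x. V1 x * u x * \<phi> x + V2 x * v x * \<psi> x)"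
    "X_inner s V1 V2 (u, v) (\<phi>, \<psi>) = pot1.form u \<phi> + pot2.form v \<psi>"
proof -
  have m: "u \<in> X1 s V1" "v \<in> X1 s V2" "\<phi> \<in> X1 s V1" "\<psi> \<in> X1 s V2" using assms unfolding X_def by auto
  have e: "gagliardo2 s (u, v) (\<phi>, \<psi>) = (\<lambda>z. gagliardo s u \<phi> z + gagliardo s v \<psi> z)"
    unfolding gagliardo2_def gagliardo_def by (auto simp: add_divide_distrib)
  note i = pot1.form_integrable[OF m(1,3)] pot2.form_integrable[OF m(2,4)]
  show "integrable lebesgue (gagliardo2 s (u, v) (\<phi>, \<psi>))" unfolding e using i by simp
  show "integrable lebesgue (\<lambda>x. V1 x * u x * \<phi> x + V2 x * v x * \<psi> x)" using i by simp
  show "X_inner s V1 V2 (u, v) (\<phi>, \<psi>) = pot1.form u \<phi> + pot2.form v \<psi>"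
    unfolding X_inner_def pot1.form_def pot2.form_def using i by (simp add: e)
qed

lemma X_norm_eq: assumes "w \<in> W" shows "(X_norm s V1 V2 w)\<^sup>2 = A w"
proof -
  have w: "(fst w, snd w) \<in> X s V1 V2" using assms unfolding W_def by simp
  have "X_inner s V1 V2 w w = A w" using X_inner_eq(3)[OF w w] unfolding A_def by simp
  moreover have "0 \<le> A w" unfolding A_def using pot1.form_nonneg pot2.form_nonneg by simp
  ultimately show ?thesis unfolding X_norm_def by simp
qed

lemma X1_square:
  "u \<in> X1 s V1 \<Longrightarrow> integrable lebesgue (\<lambda>x. \<bar>u x\<bar> powr 2)" "u \<in> X1 s V2 \<Longrightarrow> integrable lebesgue (\<lambda>x. \<bar>u x\<bar> powr 2)"
  using pot1.X1_D(2) pot2.X1_D(2) by (simp_all add: powr_numeral)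

lemma X1_gamma:
  "u \<in> X1 s V1 \<Longrightarrow> integrable lebesgue (\<lambda>x. \<bar>u x\<bar> powr (\<alpha> + \<beta>))"
  "u \<in> X1 s V2 \<Longrightarrow> integrable lebesgue (\<lambda>x. \<bar>u x\<bar> powr (\<alpha> + \<beta>))"
  using pot1.X1_powr_integrable[of "\<alpha> + \<beta>" u] pot2.X1_powr_integrable[of "\<alpha> + \<beta>" u] subcritical \<gamma> by simp_all

lemma P_integrable: "u \<in> X1 s V1 \<Longrightarrow> integrable lebesgue (\<lambda>x. a x * \<bar>u x\<bar> powr (1 - p))"
  using weight_integrable(1)[OF ab_Lp(1) ab_pos(1)] pq pq' X1_square pot1.X1_D(1) by simp

lemma Q_integrable: "u \<in> X1 s V2 \<Longrightarrow> integrable lebesgue (\<lambda>x. b x * \<bar>u x\<bar> powr (1 - q))"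
  using weight_integrable(1)[OF ab_Lp(2) ab_pos(2)] pq pq' X1_square pot2.X1_D(1) by simp

lemma C_integrable: "u \<in> X1 s V1 \<Longrightarrow> v \<in> X1 s V2 \<Longrightarrow> integrable lebesgue (\<lambda>x. \<bar>u x\<bar> powr \<alpha> * \<bar>v x\<bar> powr \<beta>)"
  using coupling_integrable(1)[of \<alpha> \<beta> u v] \<alpha>\<beta> X1_gamma pot1.X1_D(1) pot2.X1_D(1) by simp

lemma PQ_nonneg: "0 \<le> P w" "0 \<le> Q w" "0 \<le> C w" "0 \<le> A w"
  unfolding P_def Q_def C_def A_def using ab_pos pot1.form_nonneg pot2.form_nonneg
  by (auto intro!: Bochner_Integration.integral_nonneg simp: less_imp_le)

text \<open>Keeps the denominator of the Rayleigh quotient positive on admissible pairs, and yields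
  the abstract assumption \<open>PQ_pos\<close>.\<close>

lemma PQ_zero:
  assumes "w \<in> W" "P w + Q w = 0" shows "A w = 0" "C w = 0"
proof -
  have w: "fst w \<in> X1 s V1" "snd w \<in> X1 s V2" using assms W_iff by auto
  have z: "P w = 0" "Q w = 0" using assms PQ_nonneg[of w] by auto
  note 1 = pot1.weight_zero_form_zero[OF w(1) ab_Lp(1) ab_pos(1) pq(1) pq'(2) z(1)[unfolded P_def]]
  note 2 = pot2.weight_zero_form_zero[OF w(2) ab_Lp(2) ab_pos(2) pq'(1) pq(3) z(2)[unfolded Q_def]]
  show "A w = 0" unfolding A_def using 1 2 by simp
  have "AE x in lebesgue. \<bar>fst w x\<bar> powr \<alpha> * \<bar>snd w x\<bar> powr \<beta> = 0" using 1(1) by eventually_elim simp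
  then show "C w = 0" unfolding C_def by (rule integral_eq_zero_AE)
qed

lemma scl_functionals:
  assumes "t > 0"
  shows "C (scl t w) = t powr (\<alpha> + \<beta>) * C w" "P (scl t w) = t powr (1 - p) * P w" "Q (scl t w) = t powr (1 - q) * Q w"
  unfolding C_def P_def Q_def scl_def using assms
  by (simp_all add: abs_mult powr_mult powr_add mult_ac flip: integral_mult_right_zero)

lemma scl_A: assumes "w \<in> W" "t > 0" shows "scl t w \<in> W" "A (scl t w) = t powr 2 * A w"
  using assms pot1.X1_scale pot2.X1_scale pot1.form_scale pot2.form_scale
  unfolding W_iff A_def scl_def by (auto simp: powr_numeral distrib_left)

text \<open>A supremum above \<open>l\<close> provides some \<open>t\<close> with quotient above
  \<open>l\<close>, whether or not a maximum is attained; the positive denominator is then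
  cleared.\<close>

lemma below_extremal':
  assumes w: "w \<in> W" "0 < C w"
  shows "\<exists>t>0. l * (t powr (1 - p) * P w + t powr (1 - q) * Q w) < t powr 2 * A w - \<theta> * t powr (\<alpha> + \<beta>) * C w"
proof -
  have adm: "w \<in> admissible s V1 V2 \<alpha> \<beta>"
    using w unfolding admissible_def W_def C_def by (cases w) auto
  have "ereal l < (SUP t\<in>{0<..}. ereal (rayleigh s V1 V2 \<theta> \<alpha> \<beta> p q a b (\<lambda>x. t * fst w x, \<lambda>x. t * snd w x)))"
  proof (rule less_le_trans[OF l(2)])
    show "lambda_star s V1 V2 \<theta> \<alpha> \<beta> p q a b \<le> (SUP t\<in>{0<..}. ereal (rayleigh s V1 V2 \<theta> \<alpha> \<beta> p q a b (\<lambda>x. t * fst w x, \<lambda>x. t * snd w x)))"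
      unfolding lambda_star_def by (rule INF_lower2[OF adm]) (simp add: case_prod_beta)
  qed
  then obtain t where t: "t > 0" "l < rayleigh s V1 V2 \<theta> \<alpha> \<beta> p q a b (scl t w)"
    unfolding less_SUP_iff scl_def by auto
  have "P w + Q w \<noteq> 0" using PQ_zero[OF w(1)] w(2) by auto
  then have "0 < P w \<or> 0 < Q w" using PQ_nonneg[of w] by linarith
  then have den: "0 < t powr (1 - p) * P w + t powr (1 - q) * Q w"
  proof
    assume "0 < P w"
    then show ?thesis using t(1) PQ_nonneg[of w] by (intro add_pos_nonneg) auto
  next
    assume "0 < Q w"
    then show ?thesis using t(1) PQ_nonneg[of w] by (intro add_nonneg_pos) auto
  qed
  have "rayleigh s V1 V2 \<theta> \<alpha> \<beta> p q a b (scl t w) = (A (scl t w) - \<theta> * C (scl t w)) / (P (scl t w) + Q (scl t w))"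
    using X_norm_eq[OF scl_A(1)[OF w(1) t(1)]] unfolding rayleigh_def C_def P_def Q_def scl_def by simp
  also have "\<dots> = (t powr 2 * A w - \<theta> * (t powr (\<alpha> + \<beta>) * C w)) / (t powr (1 - p) * P w + t powr (1 - q) * Q w)"
    unfolding scl_functionals[OF t(1)] scl_A(2)[OF w(1) t(1)] ..
  finally have "l * (t powr (1 - p) * P w + t powr (1 - q) * Q w) < t powr 2 * A w - \<theta> * (t powr (\<alpha> + \<beta>) * C w)"
    using t(2) den by (simp add: pos_less_divide_eq)
  then show ?thesis using t(1) by (auto simp: mult.assoc)
qed

lemma functionals_tendsto:
  assumes wn: "\<And>n. wn n \<in> W" and w: "w \<in> W"
    and ae: "AE x in lebesgue. (\<lambda>n. fst (wn n) x) \<longlonglongrightarrow> fst w x" "AE x in lebesgue. (\<lambda>n. snd (wn n) x) \<longlonglongrightarrow> snd w x"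
    and lim: "\<And>\<rho>. \<rho> \<in> {2, \<alpha> + \<beta>} \<Longrightarrow> (\<lambda>n. LINT x|lebesgue. \<bar>fst (wn n) x\<bar> powr \<rho>) \<longlonglongrightarrow> (LINT x|lebesgue. \<bar>fst w x\<bar> powr \<rho>)"
      "\<And>\<rho>. \<rho> \<in> {2, \<alpha> + \<beta>} \<Longrightarrow> (\<lambda>n. LINT x|lebesgue. \<bar>snd (wn n) x\<bar> powr \<rho>) \<longlonglongrightarrow> (LINT x|lebesgue. \<bar>snd w x\<bar> powr \<rho>)"
  shows "(\<lambda>n. C (wn n)) \<longlonglongrightarrow> C w" "(\<lambda>n. P (wn n)) \<longlonglongrightarrow> P w" "(\<lambda>n. Q (wn n)) \<longlonglongrightarrow> Q w"
proof -
  have X: "fst (wn n) \<in> X1 s V1" "snd (wn n) \<in> X1 s V2" "fst w \<in> X1 s V1" "snd w \<in> X1 s V2" for n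
    using wn w W_iff by auto
  note m = pot1.X1_D(1)[OF X(1)] pot2.X1_D(1)[OF X(2)] pot1.X1_D(1)[OF X(3)] pot2.X1_D(1)[OF X(4)]
  show "(\<lambda>n. C (wn n)) \<longlonglongrightarrow> C w" unfolding C_def
    using \<alpha>\<beta> m X1_gamma X ae lim by (intro coupling_tendsto) auto
  show "(\<lambda>n. P (wn n)) \<longlonglongrightarrow> P w" unfolding P_def
    by (rule weight_tendsto[OF ab_Lp(1) ab_pos(1) pq(1) pq'(2) m(1,3) X1_square(1)[OF X(1)] X1_square(1)[OF X(3)] ae(1) lim(1)[OF insertI1]])
  show "(\<lambda>n. Q (wn n)) \<longlonglongrightarrow> Q w" unfolding Q_def
    by (rule weight_tendsto[OF ab_Lp(2) ab_pos(2) pq'(1) pq(3) m(2,4) X1_square(2)[OF X(2)] X1_square(2)[OF X(4)] ae(2) lim(2)[OF insertI1]])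
qed

lemma abs_functionals:
  defines "abs2 \<equiv> \<lambda>w :: (real^'n \<Rightarrow> real) \<times> (real^'n \<Rightarrow> real). (\<lambda>x. \<bar>fst w x\<bar>, \<lambda>x. \<bar>snd w x\<bar>)"
  assumes "w \<in> W"
  shows "abs2 w \<in> Wp" "A (abs2 w) \<le> A w" "C (abs2 w) = C w" "P (abs2 w) = P w" "Q (abs2 w) = Q w"
  using assms pot1.X1_abs pot2.X1_abs pot1.form_abs_le pot2.form_abs_le
  unfolding Wp_def W_iff A_def C_def P_def Q_def abs2_def by (auto intro: add_mono)

text \<open>The components are treated in turn, the second along the subsequence of the first.
  Absolute values of the limit then give a point of \<open>Wp\<close> with the same
  \<open>C\<close>, \<open>P\<close>, \<open>Q\<close>.\<close>

lemma weak_compact':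
  assumes wn: "\<And>n. wn n \<in> W" "\<And>n. A (wn n) \<le> B"
  shows "\<exists>r w L. strict_mono (r::nat\<Rightarrow>nat) \<and> w \<in> Wp \<and> (\<lambda>n. A (wn (r n))) \<longlonglongrightarrow> L \<and> A w \<le> L \<and>
        (\<lambda>n. C (wn (r n))) \<longlonglongrightarrow> C w \<and> (\<lambda>n. P (wn (r n))) \<longlonglongrightarrow> P w \<and> (\<lambda>n. Q (wn (r n))) \<longlonglongrightarrow> Q w"
proof -
  have X: "fst (wn n) \<in> X1 s V1" "snd (wn n) \<in> X1 s V2" for n using wn W_iff by auto
  have "pot1.form (fst (wn n)) (fst (wn n)) \<le> B" "pot2.form (snd (wn n)) (snd (wn n)) \<le> B" for n
    using wn(2)[of n] pot1.form_nonneg[of "fst (wn n)"] pot2.form_nonneg[of "snd (wn n)"] unfolding A_def by linarith+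
  note B = this
  have g2: "2 \<le> \<alpha> + \<beta>" using \<gamma> by simp
  obtain r1 u L1 where r1: "strict_mono (r1 :: nat \<Rightarrow> nat)" "u \<in> X1 s V1"
    "AE x in lebesgue. (\<lambda>n. fst (wn (r1 n)) x) \<longlonglongrightarrow> u x"
    "(\<lambda>n. pot1.form (fst (wn (r1 n))) (fst (wn (r1 n)))) \<longlonglongrightarrow> L1" "pot1.form u u \<le> L1"
    "(\<lambda>n. LINT x|lebesgue. \<bar>fst (wn (r1 n)) x\<bar> powr 2) \<longlonglongrightarrow> (LINT x|lebesgue. \<bar>u x\<bar> powr 2)"
    "(\<lambda>n. LINT x|lebesgue. \<bar>fst (wn (r1 n)) x\<bar> powr (\<alpha> + \<beta>)) \<longlonglongrightarrow> (LINT x|lebesgue. \<bar>u x\<bar> powr (\<alpha> + \<beta>))"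
    using pot1.X1_compact[of "\<lambda>n. fst (wn n)", OF X(1) B(1) g2 subcritical] by blast
  obtain r2 v L2 where r2: "strict_mono (r2 :: nat \<Rightarrow> nat)" "v \<in> X1 s V2"
    "AE x in lebesgue. (\<lambda>n. snd (wn (r1 (r2 n))) x) \<longlonglongrightarrow> v x"
    "(\<lambda>n. pot2.form (snd (wn (r1 (r2 n)))) (snd (wn (r1 (r2 n))))) \<longlonglongrightarrow> L2" "pot2.form v v \<le> L2"
    "(\<lambda>n. LINT x|lebesgue. \<bar>snd (wn (r1 (r2 n))) x\<bar> powr 2) \<longlonglongrightarrow> (LINT x|lebesgue. \<bar>v x\<bar> powr 2)"
    "(\<lambda>n. LINT x|lebesgue. \<bar>snd (wn (r1 (r2 n))) x\<bar> powr (\<alpha> + \<beta>)) \<longlonglongrightarrow> (LINT x|lebesgue. \<bar>v x\<bar> powr (\<alpha> + \<beta>))"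
    using pot2.X1_compact[of "\<lambda>n. snd (wn (r1 n))", OF X(2) B(2) g2 subcritical] by blast
  define r where "r n = r1 (r2 n)" for n
  have r: "strict_mono r" using strict_mono_o[OF r1(1) r2(1)] unfolding r_def o_def .
  have sub: "(\<lambda>n. f (r1 (r2 n))) \<longlonglongrightarrow> y" if "(\<lambda>n. f (r1 n)) \<longlonglongrightarrow> y" for f :: "nat \<Rightarrow> real" and y
    using LIMSEQ_subseq_LIMSEQ[OF that r2(1)] by (simp add: o_def)
  have ae1: "AE x in lebesgue. (\<lambda>n. fst (wn (r n)) x) \<longlonglongrightarrow> u x"
    using r1(3) unfolding r_def by eventually_elim (rule sub)
  define w where "w = (u, v)"
  have w: "w \<in> W" unfolding w_def W_iff using r1(2) r2(2) by simp
  have lims: "(\<lambda>n. C (wn (r n))) \<longlonglongrightarrow> C w" "(\<lambda>n. P (wn (r n))) \<longlonglongrightarrow> P w" "(\<lambda>n. Q (wn (r n))) \<longlonglongrightarrow> Q w"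
    by (rule functionals_tendsto[OF wn(1) w];
      use ae1 r1(6,7)[THEN sub] r2(3,6,7) in \<open>auto simp: w_def r_def\<close>)+
  have AL: "(\<lambda>n. A (wn (r n))) \<longlonglongrightarrow> L1 + L2"
    unfolding A_def r_def by (intro tendsto_add sub r1(4) r2(4))
  have "A w \<le> L1 + L2" unfolding A_def w_def using r1(5) r2(5) by simp
  then have "A (\<lambda>x. \<bar>fst w x\<bar>, \<lambda>x. \<bar>snd w x\<bar>) \<le> L1 + L2" using abs_functionals(2)[OF w] by linarith
  then show ?thesis using r AL lims abs_functionals[OF w]
    by (intro exI[of _ r] exI[of _ "(\<lambda>x. \<bar>fst w x\<bar>, \<lambda>x. \<bar>snd w x\<bar>)"] exI[of _ "L1 + L2"]) simp
qed

lemma unit_bound': "\<exists>K. \<forall>w\<in>W. A w \<le> 1 \<longrightarrow> C w \<le> K \<and> P w \<le> K \<and> Q w \<le> K"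
proof -
  have g2: "2 \<le> \<alpha> + \<beta>" using \<gamma> by simp
  have one: "0 \<le> (1::real)" by simp
  obtain K1 where K1: "\<And>u. u \<in> X1 s V1 \<Longrightarrow> pot1.form u u \<le> 1 \<Longrightarrow> (LINT x|lebesgue. \<bar>u x\<bar> powr (\<alpha> + \<beta>)) \<le> K1"
    using pot1.X1_powr[OF g2 subcritical one] by metis
  obtain K2 where K2: "\<And>u. u \<in> X1 s V2 \<Longrightarrow> pot2.form u u \<le> 1 \<Longrightarrow> (LINT x|lebesgue. \<bar>u x\<bar> powr (\<alpha> + \<beta>)) \<le> K2"
    using pot2.X1_powr[OF g2 subcritical one] by metis
  obtain K3 where K3: "\<And>u. u \<in> X1 s V1 \<Longrightarrow> pot1.form u u \<le> 1 \<Longrightarrow> (LINT x|lebesgue. \<bar>u x\<bar> powr 2) \<le> K3"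
    using pot1.X1_powr[OF order_refl pot1.two_less_crit one] by metis
  obtain K4 where K4: "\<And>u. u \<in> X1 s V2 \<Longrightarrow> pot2.form u u \<le> 1 \<Longrightarrow> (LINT x|lebesgue. \<bar>u x\<bar> powr 2) \<le> K4"
    using pot2.X1_powr[OF order_refl pot2.two_less_crit one] by metis
  define Ka where "Ka = (LINT x|lebesgue. a x powr (2 / (1 + p)))"
  define Kb where "Kb = (LINT x|lebesgue. b x powr (2 / (1 + q)))"
  show ?thesis
  proof (intro exI[of _ "max (K1 + K2) (max (Ka + K3) (Kb + K4))"] ballI impI)
    fix w assume w: "w \<in> W" "A w \<le> 1"
    have X: "fst w \<in> X1 s V1" "snd w \<in> X1 s V2" using w W_iff by auto
    have f: "pot1.form (fst w) (fst w) \<le> 1" "pot2.form (snd w) (snd w) \<le> 1"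
      using w(2) pot1.form_nonneg[of "fst w"] pot2.form_nonneg[of "snd w"] unfolding A_def by linarith+
    have "C w \<le> K1 + K2"
      using coupling_integrable(2)[of \<alpha> \<beta> "fst w" "snd w"] \<alpha>\<beta> X1_gamma(1)[OF X(1)] X1_gamma(2)[OF X(2)]
        pot1.X1_D(1)[OF X(1)] pot2.X1_D(1)[OF X(2)] K1[OF X(1) f(1)] K2[OF X(2) f(2)] unfolding C_def by linarith
    moreover have "P w \<le> Ka + K3"
      using weight_integrable(2)[OF ab_Lp(1) ab_pos(1) pq(1) pq'(2) pot1.X1_D(1)[OF X(1)] X1_square(1)[OF X(1)]]
        K3[OF X(1) f(1)] unfolding P_def Ka_def by linarith
    moreover have "Q w \<le> Kb + K4"
      using weight_integrable(2)[OF ab_Lp(2) ab_pos(2) pq'(1) pq(3) pot2.X1_D(1)[OF X(2)] X1_square(2)[OF X(2)]]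
        K4[OF X(2) f(2)] unfolding Q_def Kb_def by linarith
    ultimately show "C w \<le> max (K1 + K2) (max (Ka + K3) (Kb + K4)) \<and> P w \<le> max (K1 + K2) (max (Ka + K3) (Kb + K4))
      \<and> Q w \<le> max (K1 + K2) (max (Ka + K3) (Kb + K4))" by auto
  qed
qed

lemma C_pos_ex': "\<exists>w\<in>W. 0 < C w"
proof
  define w :: "(real^'n \<Rightarrow> real) \<times> (real^'n \<Rightarrow> real)" where "w = (bump 1, bump 1)"
  show w: "w \<in> W" unfolding W_iff w_def using pot1.bump_X1 pot2.bump_X1 by simp
  have i: "integrable lebesgue (\<lambda>x::real^'n. \<bar>bump 1 x\<bar> powr \<alpha> * \<bar>bump 1 x\<bar> powr \<beta>)"
    using C_integrable pot1.bump_X1 pot2.bump_X1 by blast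
  show "0 < C w"
  proof (rule ccontr)
    assume "\<not> 0 < C w"
    then have "C w = 0" using PQ_nonneg(3)[of w] by linarith
    then have "AE x in lebesgue. \<bar>bump 1 x\<bar> powr \<alpha> * \<bar>bump 1 (x::real^'n)\<bar> powr \<beta> = 0"
      using integral_nonneg_eq_0_iff_AE[OF i] unfolding C_def w_def by simp
    then have "AE x in lebesgue. x \<notin> ball (0::real^'n) 1"
      by eventually_elim (auto simp: bump_def max_def split: if_splits)
    then have "ball (0::real^'n) 1 \<in> null_sets lebesgue" by (simp add: AE_iff_null_sets)
    then have "emeasure lborel (ball (0::real^'n) 1) = 0" by auto
    moreover have "emeasure lborel (ball (0::real^'n) 1) = ennreal (unit_ball_vol (real CARD('n)))"
      using emeasure_ball[of 1 "0::real^'n"] by simp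
    moreover have "0 < unit_ball_vol (real CARD('n))" by simp
    ultimately show False by simp
  qed
qed

end

sublocale singular_system \<subseteq> fib: fibering W Wp scl A C P Q \<theta> "\<alpha> + \<beta>" p q l
proof unfold_locales
  show "\<theta> > 0" "l > 0" "\<alpha> + \<beta> > 2" "0 < p" "p < 1" "0 < q" "q < 1" using \<theta> l \<gamma> pq pq' by auto
  show "Wp \<subseteq> W" unfolding Wp_def by auto
  fix t w assume t: "t > (0::real)"
  show "w \<in> W \<Longrightarrow> scl t w \<in> W" "w \<in> W \<Longrightarrow> A (scl t w) = t powr 2 * A w" using scl_A t by auto
  show "w \<in> Wp \<Longrightarrow> scl t w \<in> Wp" using scl_A(1)[of w t] t unfolding Wp_def by (auto simp: scl_def)
  show "w \<in> W \<Longrightarrow> C (scl t w) = t powr (\<alpha> + \<beta>) * C w" "w \<in> W \<Longrightarrow> P (scl t w) = t powr (1 - p) * P w"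
    "w \<in> W \<Longrightarrow> Q (scl t w) = t powr (1 - q) * Q w" using scl_functionals[OF t] by auto
next
  show "w \<in> W \<Longrightarrow> 0 \<le> A w" "w \<in> W \<Longrightarrow> 0 \<le> C w" "w \<in> W \<Longrightarrow> 0 \<le> P w" "w \<in> W \<Longrightarrow> 0 \<le> Q w" for w
    using PQ_nonneg by auto
  show "\<exists>K. \<forall>w\<in>W. A w \<le> 1 \<longrightarrow> C w \<le> K \<and> P w \<le> K \<and> Q w \<le> K" by (rule unit_bound')
  show "0 < P w + Q w" if "w \<in> W" "0 < A w" for w
    using PQ_zero(1)[OF that(1)] that(2) PQ_nonneg[of w] by linarith
  show "\<exists>r w L. strict_mono (r::nat\<Rightarrow>nat) \<and> w \<in> Wp \<and> (\<lambda>n. A (wn (r n))) \<longlonglongrightarrow> L \<and> A w \<le> L \<and>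
        (\<lambda>n. C (wn (r n))) \<longlonglongrightarrow> C w \<and> (\<lambda>n. P (wn (r n))) \<longlonglongrightarrow> P w \<and> (\<lambda>n. Q (wn (r n))) \<longlonglongrightarrow> Q w"
    if "\<And>n. wn n \<in> W" "\<And>n. A (wn n) \<le> B" for wn B using weak_compact'[OF that] .
  show "\<exists>t>0. l * (t powr (1 - p) * P w + t powr (1 - q) * Q w) < t powr 2 * A w - \<theta> * t powr (\<alpha> + \<beta>) * C w"
    if "w \<in> W" "0 < C w" for w using below_extremal'[OF that] .
  show "\<exists>w\<in>W. 0 < C w" by (rule C_pos_ex')
qed

subsection \<open>Differentiating the functionals along a line\<close>

text \<open>A fixed null sequence is enough, since \<open>quasi_minimal\<close> speaks of sequences;
  \<open>eps n \<le> 1\<close> makes the domination arguments uniform in \<open>n\<close>.\<close>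

definition eps :: "nat \<Rightarrow> real" where "eps n = inverse (real (Suc n))"

lemma eps_pos: "0 < eps n" and eps_le_1: "eps n \<le> 1" and eps_tendsto: "eps \<longlonglongrightarrow> 0"
  unfolding eps_def using LIMSEQ_inverse_real_of_nat by (simp_all add: inverse_eq_divide)

lemma DERIV_eps:
  assumes "(g has_real_derivative D) (at 0)"
  shows "(\<lambda>n. (g (eps n) - g 0) / eps n) \<longlonglongrightarrow> D"
proof -
  have "filterlim eps (at 0) sequentially"
    unfolding filterlim_at using eps_tendsto eps_pos by (auto simp: less_imp_neq[THEN not_sym])
  then show ?thesis
    using assms[unfolded DERIV_def] filterlim_compose by fastforce
qed

lemma DERIV_line_powr:
  fixes u h k :: real
  assumes "0 < u" shows "((\<lambda>e. (u + e * h) powr k) has_real_derivative k * u powr (k - 1) * h) (at 0)"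
proof (rule DERIV_chain2[where f="\<lambda>z. z powr k"])
  show "((\<lambda>z. z powr k) has_real_derivative k * u powr (k - 1)) (at (u + 0 * h))"
    using has_real_derivative_powr[of u k] assms by simp
  show "((\<lambda>e. u + e * h) has_real_derivative h) (at 0)" by (auto intro!: derivative_eq_intros)
qed

text \<open>A chord of the concave power from \<open>u\<close> to any \<open>y \<ge> 0\<close> has
  slope at most \<open>u powr (- r)\<close>. With \<open>y = \<bar>u + h\<bar>\<close>, whose
  distance from \<open>u\<close> is at most \<open>\<bar>h\<bar>\<close>, this also covers
  \<open>u + h < 0\<close>.\<close>

lemma abs_powr_diff_le:
  fixes u h r :: real
  assumes "u > 0" "0 < r" "r < 1"
  shows "\<bar>\<bar>u + h\<bar> powr (1 - r) - u powr (1 - r)\<bar> \<le> u powr (- r) * \<bar>h\<bar>"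
proof -
  define y where "y = \<bar>u + h\<bar>"
  have y: "y \<ge> 0" "\<bar>y - u\<bar> \<le> \<bar>h\<bar>" unfolding y_def using assms(1) by auto
  have split: "z powr (1 - r) = z * z powr (- r)" if "z \<ge> 0" for z using that by (simp add: powr_mult_base)
  have "\<bar>y powr (1 - r) - u powr (1 - r)\<bar> \<le> u powr (- r) * \<bar>y - u\<bar>"
  proof (cases "u \<le> y")
    case True
    have "y powr (- r) \<le> u powr (- r)" using True assms by (intro powr_mono2') auto
    then have "y * y powr (- r) \<le> y * u powr (- r)" using y by (intro mult_left_mono)
    moreover have "u powr (1 - r) \<le> y powr (1 - r)" using True assms by (intro powr_mono2) auto
    ultimately show ?thesis using True split[of y] split[of u] y assms(1) by (simp add: algebra_simps)
  next
    case False
    have "y * u powr (- r) \<le> y powr (1 - r)"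
    proof (cases "y = 0")
      case False
      then have "u powr (- r) \<le> y powr (- r)" using \<open>\<not> u \<le> y\<close> y assms by (intro powr_mono2') auto
      then show ?thesis using split[of y] y by (simp add: mult_left_mono)
    qed simp
    moreover have "y powr (1 - r) \<le> u powr (1 - r)" using False assms y by (intro powr_mono2) auto
    ultimately show ?thesis using False split[of u] assms(1) by (simp add: algebra_simps)
  qed
  also have "\<dots> \<le> u powr (- r) * \<bar>h\<bar>" using y by (intro mult_left_mono) auto
  finally show ?thesis unfolding y_def .
qed

lemma powr_diff_le:
  fixes x y m k :: real
  assumes "0 \<le> x" "x \<le> m" "0 \<le> y" "y \<le> m" "1 < k"
  shows "\<bar>x powr k - y powr k\<bar> \<le> k * \<bar>x - y\<bar> * m powr (k - 1)"
proof -
  have *: "\<bar>x powr k - y powr k\<bar> \<le> k * \<bar>x - y\<bar> * m powr (k - 1)" if "0 \<le> y" "y < x" "x \<le> m" for x y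
  proof -
    have c: "continuous_on {y..x} (\<lambda>z. z powr k)"
      using that assms by (intro continuous_on_powr' continuous_intros) auto
    have d: "((\<lambda>z. z powr k) has_real_derivative k * z powr (k - 1)) (at z)" if "y < z" "z < x" for z
      using that \<open>0 \<le> y\<close> by (intro has_real_derivative_powr) auto
    obtain l z where z: "y < z" "z < x" "((\<lambda>z. z powr k) has_real_derivative l) (at z)" "x powr k - y powr k = (x - y) * l"
      using MVT[OF \<open>y < x\<close> c] d by (auto simp: real_differentiable_def)
    have "l = k * z powr (k - 1)" using DERIV_unique[OF z(3) d[OF z(1,2)]] .
    moreover have "z powr (k - 1) \<le> m powr (k - 1)" using z that assms by (intro powr_mono2) auto
    moreover have "y powr k \<le> x powr k" using that assms by (intro powr_mono2) auto
    ultimately show ?thesis using z(4) that assms by (simp add: mult_left_mono mult_ac)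
  qed
  consider "y < x" | "x < y" | "x = y" by linarith
  then show ?thesis
  proof cases
    case 1 then show ?thesis using *[of y x] assms by simp
  next
    case 2 then show ?thesis using *[of x y] assms by (simp add: abs_minus_commute)
  qed simp
qed

lemma powr_pert_tendsto:
  fixes f g :: "real^'n \<Rightarrow> real"
  assumes "\<rho> > 0" and [measurable]: "f \<in> borel_measurable lebesgue" "g \<in> borel_measurable lebesgue"
    and i: "integrable lebesgue (\<lambda>x. \<bar>f x\<bar> powr \<rho>)" "integrable lebesgue (\<lambda>x. \<bar>g x\<bar> powr \<rho>)"
  shows "(\<lambda>n. LINT x|lebesgue. \<bar>f x + eps n * g x\<bar> powr \<rho>) \<longlonglongrightarrow> (LINT x|lebesgue. \<bar>f x\<bar> powr \<rho>)"
proof (rule powr_integral_tendsto[OF assms(1)])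
  have e: "\<bar>f x + eps n * g x - f x\<bar> powr \<rho> = eps n powr \<rho> * \<bar>g x\<bar> powr \<rho>" for x n
    using eps_pos[of n] by (simp add: abs_mult powr_mult)
  show "integrable lebesgue (\<lambda>x. \<bar>f x + eps n * g x - f x\<bar> powr \<rho>)" for n unfolding e using i by simp
  show "AE x in lebesgue. (\<lambda>n. f x + eps n * g x) \<longlonglongrightarrow> f x"
  proof (rule AE_I2)
    fix x have "(\<lambda>n. f x + eps n * g x) \<longlonglongrightarrow> f x + 0 * g x" by (intro tendsto_intros eps_tendsto)
    then show "(\<lambda>n. f x + eps n * g x) \<longlonglongrightarrow> f x" by simp
  qed
  have "(\<lambda>n. \<bar>eps n\<bar> powr \<rho> * (LINT x|lebesgue. \<bar>g x\<bar> powr \<rho>)) \<longlonglongrightarrow> \<bar>0\<bar> powr \<rho> * (LINT x|lebesgue. \<bar>g x\<bar> powr \<rho>)"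
    by (intro tendsto_mult abs_powr_tendsto eps_tendsto assms tendsto_const)
  then show "(\<lambda>n. LINT x|lebesgue. \<bar>f x + eps n * g x - f x\<bar> powr \<rho>) \<longlonglongrightarrow> 0"
    unfolding e using eps_pos by (simp add: abs_of_pos)
qed (use i in auto)

text \<open>Where \<open>u = 0 < \<phi>\<close>, the difference quotients of \<open>u \<mapsto> u\<^sup>1\<^sup>-\<^sup>r\<close> in direction \<open>\<phi>\<close> blow up; a bound on their
  integrals therefore forces \<open>u > 0\<close>, and Fatou's lemma gives integrability of the derivative.\<close>

lemma singular_quotient_bound:
  fixes c u \<phi> :: "real^'n \<Rightarrow> real"
  assumes r: "0 < r" "r < 1" and [measurable]: "c \<in> borel_measurable lebesgue" "u \<in> borel_measurable lebesgue" "\<phi> \<in> borel_measurable lebesgue"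
    and nn: "\<And>x. 0 < c x" "\<And>x. 0 \<le> u x" "\<And>x. 0 \<le> \<phi> x"
    and i: "\<And>n. integrable lebesgue (\<lambda>x. c x * \<bar>u x + eps n * \<phi> x\<bar> powr (1 - r))"
      "integrable lebesgue (\<lambda>x. c x * \<bar>u x\<bar> powr (1 - r))"
    and le: "\<forall>\<^sub>F n in sequentially. ((LINT x|lebesgue. c x * \<bar>u x + eps n * \<phi> x\<bar> powr (1 - r)) - (LINT x|lebesgue. c x * \<bar>u x\<bar> powr (1 - r))) / eps n \<le> K"
  shows "AE x in lebesgue. 0 < \<phi> x \<longrightarrow> 0 < u x" "integrable lebesgue (\<lambda>x. c x * u x powr (- r) * \<phi> x)"
proof -
  define h where "h n x = (c x * \<bar>u x + eps n * \<phi> x\<bar> powr (1 - r) - c x * \<bar>u x\<bar> powr (1 - r)) / eps n" for n x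
  have hm [measurable]: "h n \<in> borel_measurable lebesgue" for n unfolding h_def by measurable
  have h0: "0 \<le> h n x" for n x
    unfolding h_def using nn[of x] eps_pos[of n] r
    by (intro divide_nonneg_pos) (auto intro!: mult_left_mono powr_mono2)
  have hi: "integrable lebesgue (h n)" for n unfolding h_def using i by simp
  have hI: "integral\<^sup>L lebesgue (h n) = ((LINT x|lebesgue. c x * \<bar>u x + eps n * \<phi> x\<bar> powr (1 - r)) - (LINT x|lebesgue. c x * \<bar>u x\<bar> powr (1 - r))) / eps n" for n
    unfolding h_def using i by simp
  have "(\<integral>\<^sup>+x. liminf (\<lambda>n. ennreal (h n x)) \<partial>lebesgue) \<le> liminf (\<lambda>n. \<integral>\<^sup>+x. ennreal (h n x) \<partial>lebesgue)"
    by (intro nn_integral_liminf) measurable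
  also have "\<dots> \<le> liminf (\<lambda>n::nat. ennreal K)"
  proof (rule Liminf_mono, use le in eventually_elim)
    case (elim n)
    then show ?case using nn_integral_eq_integral[OF hi[of n]] h0 hI[of n] by (simp add: ennreal_leI)
  qed
  also have "\<dots> = ennreal K" by (simp add: Liminf_const)
  finally have fin: "(\<integral>\<^sup>+x. liminf (\<lambda>n. ennreal (h n x)) \<partial>lebesgue) \<le> ennreal K" .
  then have "AE x in lebesgue. liminf (\<lambda>n. ennreal (h n x)) \<noteq> \<infinity>"
    by (intro nn_integral_PInf_AE) (auto simp: top_unique)
  then show pos: "AE x in lebesgue. 0 < \<phi> x \<longrightarrow> 0 < u x"
  proof eventually_elim
    case (elim x)
    show ?case
    proof (rule impI, rule ccontr)
      assume \<phi>: "0 < \<phi> x" and "\<not> 0 < u x"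
      then have u0: "u x = 0" using nn(2)[of x] by simp
      \<comment> \<open>At a zero of \<open>u\<close> the quotient is a positive multiple of
        \<open>real (Suc n) powr r\<close> and diverges, which contradicts the finite lower
        limit.\<close>
      have e: "h n x = c x * \<phi> x powr (1 - r) * real (Suc n) powr r" for n
      proof -
        have "h n x = c x * (eps n * \<phi> x) powr (1 - r) / eps n"
          unfolding h_def u0 using \<phi> eps_pos[of n] by (simp add: abs_of_pos)
        also have "(eps n * \<phi> x) powr (1 - r) = eps n powr (1 - r) * \<phi> x powr (1 - r)"
          using \<phi> eps_pos[of n] by (simp add: powr_mult)
        also have "eps n powr (1 - r) = eps n * eps n powr (- r)" using eps_pos[of n] by (simp add: powr_mult_base)
        also have "eps n powr (- r) = real (Suc n) powr r" unfolding eps_def powr_minus inverse_powr by simp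
        finally show ?thesis using eps_pos[of n] by simp
      qed
      have "filterlim (\<lambda>n. exp (r * ln (real (Suc n)))) at_top sequentially"
        by (intro filterlim_compose[OF exp_at_top] filterlim_tendsto_pos_mult_at_top[OF tendsto_const r(1)]
            filterlim_compose[OF ln_at_top] filterlim_compose[OF filterlim_real_sequentially filterlim_Suc])
      then have "filterlim (\<lambda>n. real (Suc n) powr r) at_top sequentially" by (simp add: powr_def)
      then have "filterlim (\<lambda>n. c x * \<phi> x powr (1 - r) * real (Suc n) powr r) at_top sequentially"
        using nn(1)[of x] \<phi> by (intro filterlim_tendsto_pos_mult_at_top[OF tendsto_const]) auto
      then have "filterlim (\<lambda>n. h n x) at_top sequentially" unfolding e .
      then have "(\<lambda>n. ennreal (h n x)) \<longlonglongrightarrow> \<infinity>" by (simp add: ennreal_tendsto_top_eq_at_top)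
      then have "liminf (\<lambda>n. ennreal (h n x)) = \<infinity>" by (intro lim_imp_Liminf) auto
      then show False using elim by simp
    qed
  qed
  \<comment> \<open>Where \<open>\<phi>\<close> is positive, so is \<open>u\<close>, and the
    quotients converge to the derivative; where \<open>\<phi>\<close> vanishes, the left-hand side
    is 0.\<close>
  have ptw: "AE x in lebesgue. ennreal ((1 - r) * (c x * u x powr (- r) * \<phi> x)) \<le> liminf (\<lambda>n. ennreal (h n x))"
    using pos
  proof eventually_elim
    case (elim x)
    show ?case
    proof (cases "\<phi> x = 0")
      case False
      then have \<phi>: "\<phi> x > 0" and u: "u x > 0" using nn(3)[of x] elim by auto
      have "((\<lambda>e. c x * (u x + e * \<phi> x) powr (1 - r)) has_real_derivative c x * ((1 - r) * u x powr (- r) * \<phi> x)) (at 0)"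
        using DERIV_cmult[OF DERIV_line_powr[OF u, of "\<phi> x" "1 - r"], of "c x"] by (simp add: mult_ac)
      from DERIV_eps[OF this] have "(\<lambda>n. h n x) \<longlonglongrightarrow> c x * ((1 - r) * u x powr (- r) * \<phi> x)"
        unfolding h_def using u \<phi> eps_pos by (simp add: abs_of_pos add_pos_pos)
      then have "(\<lambda>n. ennreal (h n x)) \<longlonglongrightarrow> ennreal ((1 - r) * (c x * u x powr (- r) * \<phi> x))"
        by (auto dest!: tendsto_ennrealI simp: mult_ac)
      then show ?thesis using lim_imp_Liminf[OF sequentially_bot] by (metis order_refl)
    qed simp
  qed
  have "(\<integral>\<^sup>+x. ennreal ((1 - r) * (c x * u x powr (- r) * \<phi> x)) \<partial>lebesgue) \<le> (\<integral>\<^sup>+x. liminf (\<lambda>n. ennreal (h n x)) \<partial>lebesgue)"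
    by (rule nn_integral_mono_AE[OF ptw])
  also have "\<dots> \<le> ennreal K" by (rule fin)
  finally have "integrable lebesgue (\<lambda>x. (1 - r) * (c x * u x powr (- r) * \<phi> x))"
    using nn r by (intro integrableI_nonneg) (auto intro!: AE_I2 mult_nonneg_nonneg simp: less_imp_le intro: le_less_trans)
  then show "integrable lebesgue (\<lambda>x. c x * u x powr (- r) * \<phi> x)" using r by simp
qed

text \<open>Assumption \<open>d\<close> supplies the dominating function for directions of either
  sign; it will come from \<open>singular_quotient_bound\<close> for the direction
  \<open>\<bar>\<phi> x\<bar>\<close>.\<close>

lemma singular_derivative:
  fixes c u \<phi> :: "real^'n \<Rightarrow> real"
  assumes r: "0 < r" "r < 1" and [measurable]: "c \<in> borel_measurable lebesgue" "u \<in> borel_measurable lebesgue" "\<phi> \<in> borel_measurable lebesgue"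
    and c: "\<And>x. 0 < c x" and u: "AE x in lebesgue. 0 < u x"
    and i: "\<And>n. integrable lebesgue (\<lambda>x. c x * \<bar>u x + eps n * \<phi> x\<bar> powr (1 - r))"
      "integrable lebesgue (\<lambda>x. c x * \<bar>u x\<bar> powr (1 - r))"
    and d: "integrable lebesgue (\<lambda>x. c x * u x powr (- r) * \<bar>\<phi> x\<bar>)"
  shows "(\<lambda>n. ((LINT x|lebesgue. c x * \<bar>u x + eps n * \<phi> x\<bar> powr (1 - r)) - (LINT x|lebesgue. c x * \<bar>u x\<bar> powr (1 - r))) / eps n)
     \<longlonglongrightarrow> (1 - r) * (LINT x|lebesgue. c x * u x powr (- r) * \<phi> x)"
proof -
  define h where "h n x = (c x * \<bar>u x + eps n * \<phi> x\<bar> powr (1 - r) - c x * \<bar>u x\<bar> powr (1 - r)) / eps n" for n x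
  have hm [measurable]: "h n \<in> borel_measurable lebesgue" for n unfolding h_def by measurable
  have hI: "integral\<^sup>L lebesgue (h n) = ((LINT x|lebesgue. c x * \<bar>u x + eps n * \<phi> x\<bar> powr (1 - r)) - (LINT x|lebesgue. c x * \<bar>u x\<bar> powr (1 - r))) / eps n" for n
    unfolding h_def using i by simp
  have "(\<lambda>n. integral\<^sup>L lebesgue (h n)) \<longlonglongrightarrow> (LINT x|lebesgue. (1 - r) * (c x * u x powr (- r) * \<phi> x))"
  proof (rule integral_dominated_convergence[OF _ _ d])
    show "AE x in lebesgue. (\<lambda>n. h n x) \<longlonglongrightarrow> (1 - r) * (c x * u x powr (- r) * \<phi> x)"
      using u
    proof eventually_elim
      case (elim x)
      have "((\<lambda>e. c x * (u x + e * \<phi> x) powr (1 - r)) has_real_derivative c x * ((1 - r) * u x powr (- r) * \<phi> x)) (at 0)"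
        using DERIV_cmult[OF DERIV_line_powr[OF elim, of "\<phi> x" "1 - r"], of "c x"] by (simp add: mult_ac)
      from DERIV_eps[OF this] have 1: "(\<lambda>n. (c x * (u x + eps n * \<phi> x) powr (1 - r) - c x * u x powr (1 - r)) / eps n) \<longlonglongrightarrow> (1 - r) * (c x * u x powr (- r) * \<phi> x)"
        by (simp add: mult_ac)
      have "(\<lambda>n. u x + eps n * \<phi> x) \<longlonglongrightarrow> u x + 0 * \<phi> x" by (intro tendsto_intros eps_tendsto)
      then have "\<forall>\<^sub>F n in sequentially. 0 < u x + eps n * \<phi> x" using elim by (auto dest: order_tendstoD(1))
      then have "\<forall>\<^sub>F n in sequentially. (c x * (u x + eps n * \<phi> x) powr (1 - r) - c x * u x powr (1 - r)) / eps n = h n x"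
        by eventually_elim (use elim in \<open>simp add: h_def abs_of_pos\<close>)
      with 1 show ?case by (rule Lim_transform_eventually)
    qed
    show "AE x in lebesgue. norm (h n x) \<le> c x * u x powr (- r) * \<bar>\<phi> x\<bar>" for n
      using u
    proof eventually_elim
      case (elim x)
      have "norm (h n x) = c x * \<bar>\<bar>u x + eps n * \<phi> x\<bar> powr (1 - r) - u x powr (1 - r)\<bar> / eps n"
        unfolding h_def using elim c[of x] eps_pos[of n] by (simp add: abs_mult right_diff_distrib[symmetric])
      also have "\<dots> \<le> c x * (u x powr (- r) * \<bar>eps n * \<phi> x\<bar>) / eps n"
        using abs_powr_diff_le[OF elim r] c[of x] eps_pos[of n] by (intro divide_right_mono mult_left_mono) auto
      also have "\<dots> = c x * u x powr (- r) * \<bar>\<phi> x\<bar>" using eps_pos[of n] by (simp add: abs_mult)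
      finally show ?case .
    qed
  qed measurable
  then show ?thesis unfolding hI by simp
qed

text \<open>\<open>m\<close> majorizes the functions, the directions and, because
  \<open>eps n \<le> 1\<close>, all perturbed functions, so the difference quotients stay below
  \<open>\<gamma> * m x powr \<gamma>\<close>. Positivity of \<open>u\<close> and \<open>v\<close>
  gives the pointwise derivative, as the exponents \<alpha> - 2 and \<beta> - 2 may be
  negative.\<close>

lemma coupling_derivative:
  fixes u v \<phi> \<psi> :: "real^'n \<Rightarrow> real"
  assumes ab: "1 < \<alpha>" "1 < \<beta>"
    and [measurable]: "u \<in> borel_measurable lebesgue" "v \<in> borel_measurable lebesgue"
      "\<phi> \<in> borel_measurable lebesgue" "\<psi> \<in> borel_measurable lebesgue"
    and pos: "AE x in lebesgue. 0 < u x" "AE x in lebesgue. 0 < v x"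
    and i: "integrable lebesgue (\<lambda>x. \<bar>u x\<bar> powr (\<alpha> + \<beta>))" "integrable lebesgue (\<lambda>x. \<bar>v x\<bar> powr (\<alpha> + \<beta>))"
      "integrable lebesgue (\<lambda>x. \<bar>\<phi> x\<bar> powr (\<alpha> + \<beta>))" "integrable lebesgue (\<lambda>x. \<bar>\<psi> x\<bar> powr (\<alpha> + \<beta>))"
    and j: "\<And>n. integrable lebesgue (\<lambda>x. \<bar>u x + eps n * \<phi> x\<bar> powr \<alpha> * \<bar>v x + eps n * \<psi> x\<bar> powr \<beta>)"
      "integrable lebesgue (\<lambda>x. \<bar>u x\<bar> powr \<alpha> * \<bar>v x\<bar> powr \<beta>)"
  shows "integrable lebesgue (coupling_integrand \<alpha> \<beta> (u, v) (\<phi>, \<psi>))"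
    "(\<lambda>n. ((LINT x|lebesgue. \<bar>u x + eps n * \<phi> x\<bar> powr \<alpha> * \<bar>v x + eps n * \<psi> x\<bar> powr \<beta>) - (LINT x|lebesgue. \<bar>u x\<bar> powr \<alpha> * \<bar>v x\<bar> powr \<beta>)) / eps n)
     \<longlonglongrightarrow> integral\<^sup>L lebesgue (coupling_integrand \<alpha> \<beta> (u, v) (\<phi>, \<psi>))"
proof -
  define h where "h n x = (\<bar>u x + eps n * \<phi> x\<bar> powr \<alpha> * \<bar>v x + eps n * \<psi> x\<bar> powr \<beta> - \<bar>u x\<bar> powr \<alpha> * \<bar>v x\<bar> powr \<beta>) / eps n" for n x
  define m where "m x = (\<bar>u x\<bar> + \<bar>\<phi> x\<bar>) + (\<bar>v x\<bar> + \<bar>\<psi> x\<bar>)" for x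
  define \<gamma> where "\<gamma> = \<alpha> + \<beta>"
  \<comment> \<open>\<open>powr_add_le\<close> applied twice to \<open>m\<close>, which reduces
    integrability to the four given powers.\<close>
  define G where "G x = \<gamma> * (2 powr \<gamma> * (2 powr \<gamma> * (\<bar>u x\<bar> powr \<gamma> + \<bar>\<phi> x\<bar> powr \<gamma>) + 2 powr \<gamma> * (\<bar>v x\<bar> powr \<gamma> + \<bar>\<psi> x\<bar> powr \<gamma>)))" for x
  have \<gamma>: "\<gamma> > 0" unfolding \<gamma>_def using ab by simp
  have Gi: "integrable lebesgue G" unfolding G_def using i unfolding \<gamma>_def by simp
  have mG: "\<gamma> * m x powr \<gamma> \<le> G x" for x
  proof -
    have "m x powr \<gamma> \<le> 2 powr \<gamma> * ((\<bar>u x\<bar> + \<bar>\<phi> x\<bar>) powr \<gamma> + (\<bar>v x\<bar> + \<bar>\<psi> x\<bar>) powr \<gamma>)"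
      unfolding m_def using \<gamma> by (intro powr_add_le) auto
    also have "\<dots> \<le> 2 powr \<gamma> * (2 powr \<gamma> * (\<bar>u x\<bar> powr \<gamma> + \<bar>\<phi> x\<bar> powr \<gamma>) + 2 powr \<gamma> * (\<bar>v x\<bar> powr \<gamma> + \<bar>\<psi> x\<bar> powr \<gamma>))"
      using \<gamma> by (intro mult_left_mono add_mono powr_add_le) auto
    finally show ?thesis unfolding G_def using \<gamma> by (intro mult_left_mono) auto
  qed
  have hI: "integral\<^sup>L lebesgue (h n) = ((LINT x|lebesgue. \<bar>u x + eps n * \<phi> x\<bar> powr \<alpha> * \<bar>v x + eps n * \<psi> x\<bar> powr \<beta>) - (LINT x|lebesgue. \<bar>u x\<bar> powr \<alpha> * \<bar>v x\<bar> powr \<beta>)) / eps n" for n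
    unfolding h_def using j by simp
  have dom: "norm (h n x) \<le> G x" for n x
  proof -
    let ?e = "eps n" and ?m = "m x"
    let ?A1 = "\<bar>u x + eps n * \<phi> x\<bar>" and ?B1 = "\<bar>v x + eps n * \<psi> x\<bar>"
    have e: "0 < ?e" "?e \<le> 1" using eps_pos eps_le_1 by auto
    have le\<phi>: "\<bar>?e * \<phi> x\<bar> \<le> \<bar>\<phi> x\<bar>" "\<bar>?e * \<psi> x\<bar> \<le> \<bar>\<psi> x\<bar>"
      using e mult_right_mono[of ?e 1 "\<bar>\<phi> x\<bar>"] mult_right_mono[of ?e 1 "\<bar>\<psi> x\<bar>"] by (simp_all add: abs_mult)
    have m0: "0 \<le> ?m" unfolding m_def by simp
    have bd: "?A1 \<le> ?m" "?B1 \<le> ?m" "\<bar>u x\<bar> \<le> ?m" "\<bar>v x\<bar> \<le> ?m" "\<bar>\<phi> x\<bar> \<le> ?m" "\<bar>\<psi> x\<bar> \<le> ?m"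
      using le\<phi> unfolding m_def by linarith+
    have one: "m x * m x powr (k - 1) = m x powr k" for k using m0 by (simp add: powr_mult_base)
    have gen: "\<bar>\<bar>y + ?e * z\<bar> powr k - \<bar>y\<bar> powr k\<bar> \<le> ?e * (k * ?m powr k)"
      if "\<bar>y + ?e * z\<bar> \<le> ?m" "\<bar>y\<bar> \<le> ?m" "\<bar>z\<bar> \<le> ?m" "1 < k" for y z k
    proof -
      have "\<bar>\<bar>y + ?e * z\<bar> powr k - \<bar>y\<bar> powr k\<bar> \<le> k * \<bar>\<bar>y + ?e * z\<bar> - \<bar>y\<bar>\<bar> * ?m powr (k - 1)"
        using that by (intro powr_diff_le) auto
      also have "\<dots> \<le> k * (?e * ?m) * ?m powr (k - 1)"
      proof (intro mult_right_mono mult_left_mono)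
        have "\<bar>\<bar>y + ?e * z\<bar> - \<bar>y\<bar>\<bar> \<le> \<bar>?e * z\<bar>" by linarith
        also have "\<dots> = ?e * \<bar>z\<bar>" using e by (simp add: abs_mult)
        also have "\<dots> \<le> ?e * ?m" using e that(3) by (intro mult_left_mono) auto
        finally show "\<bar>\<bar>y + ?e * z\<bar> - \<bar>y\<bar>\<bar> \<le> ?e * ?m" .
      qed (use that in auto)
      also have "\<dots> = ?e * (k * ?m powr k)" using one[of k] by (simp add: mult_ac)
      finally show ?thesis .
    qed
    have "\<bar>?A1 powr \<alpha> * ?B1 powr \<beta> - \<bar>u x\<bar> powr \<alpha> * \<bar>v x\<bar> powr \<beta>\<bar>
      = \<bar>(?A1 powr \<alpha> - \<bar>u x\<bar> powr \<alpha>) * ?B1 powr \<beta> + \<bar>u x\<bar> powr \<alpha> * (?B1 powr \<beta> - \<bar>v x\<bar> powr \<beta>)\<bar>"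
      by (simp add: algebra_simps)
    also have "\<dots> \<le> \<bar>?A1 powr \<alpha> - \<bar>u x\<bar> powr \<alpha>\<bar> * ?B1 powr \<beta> + \<bar>u x\<bar> powr \<alpha> * \<bar>?B1 powr \<beta> - \<bar>v x\<bar> powr \<beta>\<bar>"
      by (rule order_trans[OF abs_triangle_ineq]) (simp add: abs_mult)
    also have "\<dots> \<le> ?e * (\<alpha> * ?m powr \<alpha>) * ?m powr \<beta> + ?m powr \<alpha> * (?e * (\<beta> * ?m powr \<beta>))"
    proof (intro add_mono mult_mono)
      show "?B1 powr \<beta> \<le> ?m powr \<beta>" "\<bar>u x\<bar> powr \<alpha> \<le> ?m powr \<alpha>"
        using bd ab by (auto intro!: powr_mono2)
    qed (use gen[OF bd(1,3,5) ab(1)] gen[OF bd(2,4,6) ab(2)] e ab in simp_all)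
    also have "\<dots> = ?e * (\<gamma> * ?m powr \<gamma>)" unfolding \<gamma>_def powr_add by (simp add: algebra_simps)
    finally have "\<bar>?A1 powr \<alpha> * ?B1 powr \<beta> - \<bar>u x\<bar> powr \<alpha> * \<bar>v x\<bar> powr \<beta>\<bar> / ?e \<le> \<gamma> * ?m powr \<gamma>"
      using e by (simp add: pos_divide_le_eq mult.commute)
    then show ?thesis unfolding h_def using e mG[of x] by (simp add: abs_divide)
  qed
  have lim: "AE x in lebesgue. (\<lambda>n. h n x) \<longlonglongrightarrow> coupling_integrand \<alpha> \<beta> (u, v) (\<phi>, \<psi>) x"
    using pos
  proof eventually_elim
    case (elim x)
    have D: "((\<lambda>e. (u x + e * \<phi> x) powr \<alpha> * (v x + e * \<psi> x) powr \<beta>) has_real_derivative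
      \<alpha> * u x powr (\<alpha> - 1) * \<phi> x * v x powr \<beta> + u x powr \<alpha> * (\<beta> * v x powr (\<beta> - 1) * \<psi> x)) (at 0)"
      using DERIV_mult[OF DERIV_line_powr[OF elim(1), of "\<phi> x" \<alpha>] DERIV_line_powr[OF elim(2), of "\<psi> x" \<beta>]]
      by (simp add: mult_ac add.commute)
    have "x powr (k - 2) * x = x powr (k - 1)" if "x > 0" for x k :: real
      using powr_mult_base[of x "k - 2"] that by (simp add: mult.commute)
    then have "\<alpha> * u x powr (\<alpha> - 1) * \<phi> x * v x powr \<beta> + u x powr \<alpha> * (\<beta> * v x powr (\<beta> - 1) * \<psi> x)
      = coupling_integrand \<alpha> \<beta> (u, v) (\<phi>, \<psi>) x"
      unfolding coupling_integrand_def using elim by (simp add: abs_of_pos mult.assoc[symmetric]) (simp add: mult_ac)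
    with DERIV_eps[OF D] have 1: "(\<lambda>n. ((u x + eps n * \<phi> x) powr \<alpha> * (v x + eps n * \<psi> x) powr \<beta> - u x powr \<alpha> * v x powr \<beta>) / eps n)
      \<longlonglongrightarrow> coupling_integrand \<alpha> \<beta> (u, v) (\<phi>, \<psi>) x" by simp
    have "(\<lambda>n. u x + eps n * \<phi> x) \<longlonglongrightarrow> u x + 0 * \<phi> x" "(\<lambda>n. v x + eps n * \<psi> x) \<longlonglongrightarrow> v x + 0 * \<psi> x"
      by (intro tendsto_intros eps_tendsto)+
    then have "\<forall>\<^sub>F n in sequentially. 0 < u x + eps n * \<phi> x" "\<forall>\<^sub>F n in sequentially. 0 < v x + eps n * \<psi> x"
      using elim by (auto dest: order_tendstoD(1))
    then have "\<forall>\<^sub>F n in sequentially. ((u x + eps n * \<phi> x) powr \<alpha> * (v x + eps n * \<psi> x) powr \<beta> - u x powr \<alpha> * v x powr \<beta>) / eps n = h n x"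
      by eventually_elim (use elim in \<open>simp add: h_def abs_of_pos\<close>)
    with 1 show ?case by (rule Lim_transform_eventually)
  qed
  have m1: "coupling_integrand \<alpha> \<beta> (u, v) (\<phi>, \<psi>) \<in> borel_measurable lebesgue"
    unfolding coupling_integrand_def by simp
  have m2: "h n \<in> borel_measurable lebesgue" for n unfolding h_def by measurable
  show "integrable lebesgue (coupling_integrand \<alpha> \<beta> (u, v) (\<phi>, \<psi>))"
    by (rule integrable_dominated_convergence[OF m1 m2 Gi lim]) (use dom in auto)
  show "(\<lambda>n. ((LINT x|lebesgue. \<bar>u x + eps n * \<phi> x\<bar> powr \<alpha> * \<bar>v x + eps n * \<psi> x\<bar> powr \<beta>) - (LINT x|lebesgue. \<bar>u x\<bar> powr \<alpha> * \<bar>v x\<bar> powr \<beta>)) / eps n)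
     \<longlonglongrightarrow> integral\<^sup>L lebesgue (coupling_integrand \<alpha> \<beta> (u, v) (\<phi>, \<psi>))"
    unfolding hI[symmetric]
    by (rule integral_dominated_convergence[OF m1 m2 Gi lim]) (use dom in auto)
qed

subsection \<open>Quasi-minimal points are positive weak solutions\<close>

context singular_system begin

definition pert :: "(real^'n \<Rightarrow> real) \<times> (real^'n \<Rightarrow> real) \<Rightarrow> (real^'n \<Rightarrow> real) \<times> (real^'n \<Rightarrow> real) \<Rightarrow> nat \<Rightarrow>
    (real^'n \<Rightarrow> real) \<times> (real^'n \<Rightarrow> real)" where
  "pert w \<phi> n = (\<lambda>x. fst w x + eps n * fst \<phi> x, \<lambda>x. snd w x + eps n * snd \<phi> x)"

definition B :: "(real^'n \<Rightarrow> real) \<times> (real^'n \<Rightarrow> real) \<Rightarrow> (real^'n \<Rightarrow> real) \<times> (real^'n \<Rightarrow> real) \<Rightarrow> real" where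
  "B w \<phi> = pot1.form (fst w) (fst \<phi>) + pot2.form (snd w) (snd \<phi>)"

lemma pert_W: "w \<in> W \<Longrightarrow> \<phi> \<in> W \<Longrightarrow> pert w \<phi> n \<in> W"
  unfolding W_iff pert_def using pot1.X1_add_scale pot2.X1_add_scale by simp

lemma A_pert: "w \<in> W \<Longrightarrow> \<phi> \<in> W \<Longrightarrow> A (pert w \<phi> n) = A w + 2 * eps n * B w \<phi> + (eps n)\<^sup>2 * A \<phi>"
  unfolding W_iff pert_def A_def B_def using pot1.form_add_scale pot2.form_add_scale by (simp add: algebra_simps)

lemma pert_conv:
  assumes "w \<in> W" "\<phi> \<in> W" shows "fib.conv (pert w \<phi>) w"
proof -
  have X: "fst w \<in> X1 s V1" "snd w \<in> X1 s V2" "fst \<phi> \<in> X1 s V1" "snd \<phi> \<in> X1 s V2" using assms W_iff by auto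
  note m = pot1.X1_D(1)[OF X(1)] pot2.X1_D(1)[OF X(2)] pot1.X1_D(1)[OF X(3)] pot2.X1_D(1)[OF X(4)]
  have t: "(\<lambda>n. f + eps n * g) \<longlonglongrightarrow> f" for f g
  proof -
    have "(\<lambda>n. f + eps n * g) \<longlonglongrightarrow> f + 0 * g" by (intro tendsto_intros eps_tendsto)
    then show ?thesis by simp
  qed
  have "(\<lambda>n. A w + 2 * eps n * B w \<phi> + (eps n)\<^sup>2 * A \<phi>) \<longlonglongrightarrow> A w + 2 * 0 * B w \<phi> + 0\<^sup>2 * A \<phi>"
    by (intro tendsto_intros eps_tendsto)
  then have lA: "(\<lambda>n. A (pert w \<phi> n)) \<longlonglongrightarrow> A w" unfolding A_pert[OF assms] by simp
  have lim1: "(\<lambda>n. LINT x|lebesgue. \<bar>fst (pert w \<phi> n) x\<bar> powr \<rho>) \<longlonglongrightarrow> (LINT x|lebesgue. \<bar>fst w x\<bar> powr \<rho>)"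
    if "\<rho> \<in> {2, \<alpha> + \<beta>}" for \<rho>
    unfolding pert_def fst_conv using that m X1_square(1)[OF X(1)] X1_square(1)[OF X(3)] X1_gamma(1)[OF X(1)] X1_gamma(1)[OF X(3)] \<gamma>
    by (intro powr_pert_tendsto) auto
  have lim2: "(\<lambda>n. LINT x|lebesgue. \<bar>snd (pert w \<phi> n) x\<bar> powr \<rho>) \<longlonglongrightarrow> (LINT x|lebesgue. \<bar>snd w x\<bar> powr \<rho>)"
    if "\<rho> \<in> {2, \<alpha> + \<beta>}" for \<rho>
    unfolding pert_def snd_conv using that m X1_square(2)[OF X(2)] X1_square(2)[OF X(4)] X1_gamma(2)[OF X(2)] X1_gamma(2)[OF X(4)] \<gamma>
    by (intro powr_pert_tendsto) auto
  have ae: "AE x in lebesgue. (\<lambda>n. fst (pert w \<phi> n) x) \<longlonglongrightarrow> fst w x" "AE x in lebesgue. (\<lambda>n. snd (pert w \<phi> n) x) \<longlonglongrightarrow> snd w x"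
    unfolding pert_def using t by auto
  show ?thesis unfolding fib.conv_def
    using lA functionals_tendsto[of "pert w \<phi>" w, OF pert_W[OF assms] assms(1) ae lim1 lim2] by simp
qed

text \<open>Quasi-minimality divided by \<open>eps n\<close>. The common rescaling survives only in
  exponential factors tending to 1, so no derivative of a projection appears; the difference
  quotients themselves need not converge yet.\<close>

lemma first_variation:
  assumes w: "w \<in> W" and \<phi>: "\<phi> \<in> W" and qm: "fib.quasi_minimal w"
  obtains \<sigma> where "\<sigma> \<longlonglongrightarrow> 0"
    "\<forall>\<^sub>F n in sequentially. \<theta> / (\<alpha> + \<beta>) * exp ((\<alpha> + \<beta>) * \<sigma> n) * ((C (pert w \<phi> n) - C w) / eps n)
       + l / (1 - p) * exp ((1 - p) * \<sigma> n) * ((P (pert w \<phi> n) - P w) / eps n)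
       + l / (1 - q) * exp ((1 - q) * \<sigma> n) * ((Q (pert w \<phi> n) - Q w) / eps n)
      \<le> exp (2 * \<sigma> n) * (B w \<phi> + eps n / 2 * A \<phi>)"
proof -
  obtain \<sigma> where \<sigma>: "\<sigma> \<longlonglongrightarrow> 0" "\<forall>\<^sub>F n in sequentially. fib.J (scl (exp (\<sigma> n)) w) \<le> fib.J (scl (exp (\<sigma> n)) (pert w \<phi> n))"
    using qm[unfolded fib.quasi_minimal_def, rule_format, of "pert w \<phi>", OF pert_W[OF w \<phi>] pert_conv[OF w \<phi>]] by blast
  show ?thesis
  proof (rule that[OF \<sigma>(1)], use \<sigma>(2) in eventually_elim)
    case (elim n)
    let ?e = "eps n" and ?E = "\<lambda>k. exp (k * \<sigma> n)"
    have div: "(x * y / 2 - k1 * c - k2 * d - k3 * f) / ?e = x * (y / (2 * ?e)) - k1 * (c / ?e) - k2 * (d / ?e) - k3 * (f / ?e)"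
      for x y k1 c k2 d k3 f :: real by (simp add: diff_divide_distrib)
    have "0 \<le> (fib.J (scl (exp (\<sigma> n)) (pert w \<phi> n)) - fib.J (scl (exp (\<sigma> n)) w)) / ?e"
      using elim eps_pos[of n] by simp
    also have "fib.J (scl (exp (\<sigma> n)) (pert w \<phi> n)) - fib.J (scl (exp (\<sigma> n)) w)
      = ?E 2 * (A (pert w \<phi> n) - A w) / 2 - \<theta> / (\<alpha> + \<beta>) * ?E (\<alpha> + \<beta>) * (C (pert w \<phi> n) - C w)
       - l / (1 - p) * ?E (1 - p) * (P (pert w \<phi> n) - P w) - l / (1 - q) * ?E (1 - q) * (Q (pert w \<phi> n) - Q w)"
      unfolding fib.J_S[OF w] fib.J_S[OF pert_W[OF w \<phi>]] by (simp add: algebra_simps diff_divide_distrib)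
    also have "\<dots> / ?e = ?E 2 * ((A (pert w \<phi> n) - A w) / (2 * ?e)) - \<theta> / (\<alpha> + \<beta>) * ?E (\<alpha> + \<beta>) * ((C (pert w \<phi> n) - C w) / ?e)
       - l / (1 - p) * ?E (1 - p) * ((P (pert w \<phi> n) - P w) / ?e) - l / (1 - q) * ?E (1 - q) * ((Q (pert w \<phi> n) - Q w) / ?e)"
      by (rule div)
    also have "(A (pert w \<phi> n) - A w) / (2 * ?e) = B w \<phi> + ?e / 2 * A \<phi>"
      unfolding A_pert[OF w \<phi>] using eps_pos[of n] by (simp add: power2_eq_square field_simps)
    finally show ?case by linarith
  qed
qed

lemma exp_tendsto_1: "\<sigma> \<longlonglongrightarrow> 0 \<Longrightarrow> (\<lambda>n. exp (k * \<sigma> n)) \<longlonglongrightarrow> 1" for k :: real and \<sigma> :: "nat \<Rightarrow> real"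
  using tendsto_exp[OF tendsto_mult[OF tendsto_const[of k], of \<sigma> 0]] by simp

lemma Lp_measurable: "a \<in> borel_measurable lebesgue" "b \<in> borel_measurable lebesgue"
  using ab_Lp unfolding Lp_def by auto

text \<open>In a nonnegative direction all three quotients on the left of
  \<open>first_variation\<close> are nonnegative, so its right-hand side bounds each singular one
  separately.\<close>

lemma singular_bounds:
  assumes w: "w \<in> Wp" and \<phi>: "\<phi> \<in> Wp" and qm: "fib.quasi_minimal w"
  shows "AE x in lebesgue. 0 < fst \<phi> x \<longrightarrow> 0 < fst w x" "integrable lebesgue (\<lambda>x. a x * fst w x powr (- p) * fst \<phi> x)"
    "AE x in lebesgue. 0 < snd \<phi> x \<longrightarrow> 0 < snd w x" "integrable lebesgue (\<lambda>x. b x * snd w x powr (- q) * snd \<phi> x)"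
proof -
  have wW: "w \<in> W" "\<phi> \<in> W" and nn: "\<And>x. 0 \<le> fst w x" "\<And>x. 0 \<le> snd w x" "\<And>x. 0 \<le> fst \<phi> x" "\<And>x. 0 \<le> snd \<phi> x"
    using w \<phi> unfolding Wp_def by auto
  have X: "fst w \<in> X1 s V1" "snd w \<in> X1 s V2" "fst \<phi> \<in> X1 s V1" "snd \<phi> \<in> X1 s V2" using wW W_iff by auto
  note m = pot1.X1_D(1)[OF X(1)] pot2.X1_D(1)[OF X(2)] pot1.X1_D(1)[OF X(3)] pot2.X1_D(1)[OF X(4)]
  have pX: "fst (pert w \<phi> n) \<in> X1 s V1" "snd (pert w \<phi> n) \<in> X1 s V2" for n using pert_W[OF wW] W_iff by auto
  obtain \<sigma> where \<sigma>: "\<sigma> \<longlonglongrightarrow> 0"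
    "\<forall>\<^sub>F n in sequentially. \<theta> / (\<alpha> + \<beta>) * exp ((\<alpha> + \<beta>) * \<sigma> n) * ((C (pert w \<phi> n) - C w) / eps n)
       + l / (1 - p) * exp ((1 - p) * \<sigma> n) * ((P (pert w \<phi> n) - P w) / eps n)
       + l / (1 - q) * exp ((1 - q) * \<sigma> n) * ((Q (pert w \<phi> n) - Q w) / eps n)
      \<le> exp (2 * \<sigma> n) * (B w \<phi> + eps n / 2 * A \<phi>)"
    using first_variation[OF wW qm] by blast
  have le: "fst w x \<le> fst (pert w \<phi> n) x" "snd w x \<le> snd (pert w \<phi> n) x" for x n
    unfolding pert_def using nn[of x] eps_pos[of n] by simp_all
  have mono: "\<bar>fst w x\<bar> powr k \<le> \<bar>fst (pert w \<phi> n) x\<bar> powr k" "\<bar>snd w x\<bar> powr k \<le> \<bar>snd (pert w \<phi> n) x\<bar> powr k"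
    if "k > 0" for x n k
    using le[of x n] nn[of x] that by (intro powr_mono2; simp)+
  have dC: "0 \<le> (C (pert w \<phi> n) - C w) / eps n" for n
    unfolding C_def using eps_pos[of n] mono[of \<alpha>] mono[of \<beta>] \<alpha>\<beta>
    by (intro divide_nonneg_pos) (auto intro!: integral_mono C_integrable X pX mult_mono)
  have dP: "0 \<le> (P (pert w \<phi> n) - P w) / eps n" for n
    unfolding P_def using eps_pos[of n] mono(1)[of "1 - p"] pq pq' ab_pos
    by (intro divide_nonneg_pos) (auto intro!: integral_mono P_integrable X pX mult_left_mono simp: less_imp_le)
  have dQ: "0 \<le> (Q (pert w \<phi> n) - Q w) / eps n" for n
    unfolding Q_def using eps_pos[of n] mono(2)[of "1 - q"] pq pq' ab_pos
    by (intro divide_nonneg_pos) (auto intro!: integral_mono Q_integrable X pX mult_left_mono simp: less_imp_le)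
  \<comment> \<open>Strictly above the limit \<open>B w \<phi>\<close> of the right-hand
    side.\<close>
  define M where "M = max 0 (B w \<phi>) + 1"
  have "(\<lambda>n. exp (2 * \<sigma> n) * (B w \<phi> + eps n / 2 * A \<phi>)) \<longlonglongrightarrow> 1 * (B w \<phi> + 0 / 2 * A \<phi>)"
    by (intro tendsto_intros exp_tendsto_1 \<sigma> eps_tendsto) simp
  then have evM: "\<forall>\<^sub>F n in sequentially. exp (2 * \<sigma> n) * (B w \<phi> + eps n / 2 * A \<phi>) < M"
    unfolding M_def by (intro order_tendstoD(2)) auto
  \<comment> \<open>The factor 2 absorbs the exponential, which eventually exceeds 1/2.\<close>
  have gen: "\<forall>\<^sub>F n in sequentially. d n \<le> 2 * (1 - r) / l * M"
    if r: "r < 1" and d0: "\<And>n. 0 \<le> d n" and le: "\<forall>\<^sub>F n in sequentially. l / (1 - r) * exp ((1 - r) * \<sigma> n) * d n \<le> M" for r d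
  proof -
    have "\<forall>\<^sub>F n in sequentially. 1/2 < exp ((1 - r) * \<sigma> n)"
      using order_tendstoD(1)[OF exp_tendsto_1[OF \<sigma>(1)], of "1/2"] by simp
    with le show ?thesis
    proof eventually_elim
      case (elim n)
      have "l / (1 - r) * (1/2) * d n \<le> l / (1 - r) * exp ((1 - r) * \<sigma> n) * d n"
        using elim d0[of n] l(1) r by (intro mult_right_mono mult_left_mono) auto
      with elim(1) have "l / (1 - r) * (1/2) * d n \<le> M" by linarith
      then show ?case using l(1) r by (simp add: field_simps)
    qed
  qed
  have t1: "0 \<le> \<theta> / (\<alpha> + \<beta>) * exp ((\<alpha> + \<beta>) * \<sigma> n) * ((C (pert w \<phi> n) - C w) / eps n)" for n
    using dC[of n] \<theta> \<gamma> by (intro mult_nonneg_nonneg) auto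
  have t2: "0 \<le> l / (1 - p) * exp ((1 - p) * \<sigma> n) * ((P (pert w \<phi> n) - P w) / eps n)" for n
    using dP[of n] l(1) pq' by (intro mult_nonneg_nonneg) auto
  have t3: "0 \<le> l / (1 - q) * exp ((1 - q) * \<sigma> n) * ((Q (pert w \<phi> n) - Q w) / eps n)" for n
    using dQ[of n] l(1) pq by (intro mult_nonneg_nonneg) auto
  have evP: "\<forall>\<^sub>F n in sequentially. (P (pert w \<phi> n) - P w) / eps n \<le> 2 * (1 - p) / l * M"
  proof (rule gen[OF pq'(2) dP], use \<sigma>(2) evM in eventually_elim)
    case (elim n) then show ?case using t1[of n] t3[of n] by linarith
  qed
  have evQ: "\<forall>\<^sub>F n in sequentially. (Q (pert w \<phi> n) - Q w) / eps n \<le> 2 * (1 - q) / l * M"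
  proof (rule gen[OF pq(3) dQ], use \<sigma>(2) evM in eventually_elim)
    case (elim n) then show ?case using t1[of n] t2[of n] by linarith
  qed
  note iP = P_integrable[OF pX(1), unfolded pert_def fst_conv] and iQ = Q_integrable[OF pX(2), unfolded pert_def snd_conv]
  note 1 = singular_quotient_bound[OF pq(1) pq'(2) Lp_measurable(1) m(1,3) ab_pos(1) nn(1,3) iP P_integrable[OF X(1)]
      evP[unfolded P_def pert_def fst_conv]]
  note 2 = singular_quotient_bound[OF pq'(1) pq(3) Lp_measurable(2) m(2,4) ab_pos(2) nn(2,4) iQ Q_integrable[OF X(2)]
      evQ[unfolded Q_def pert_def snd_conv]]
  show "AE x in lebesgue. 0 < fst \<phi> x \<longrightarrow> 0 < fst w x" "integrable lebesgue (\<lambda>x. a x * fst w x powr (- p) * fst \<phi> x)"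
    "AE x in lebesgue. 0 < snd \<phi> x \<longrightarrow> 0 < snd w x" "integrable lebesgue (\<lambda>x. b x * snd w x powr (- q) * snd \<phi> x)"
    using 1 2 by auto
qed

text \<open>Directions are tents of integer radius: each point lies where one of them is positive,
  and only countably many null sets have to be collected.\<close>

lemma quasi_minimal_pos:
  assumes w: "w \<in> Wp" and qm: "fib.quasi_minimal w"
  shows "AE x in lebesgue. 0 < fst w x" "AE x in lebesgue. 0 < snd w x"
proof -
  have b: "(bump (real R), bump (real R)) \<in> Wp" for R
    unfolding Wp_def W_iff using pot1.bump_X1 pot2.bump_X1 by (simp add: bump_def)
  have "AE x in lebesgue. \<forall>R. 0 < bump (real R) x \<longrightarrow> 0 < fst w x"
    unfolding AE_all_countable using singular_bounds(1)[OF w b qm] by simp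
  moreover have "AE x in lebesgue. \<forall>R. 0 < bump (real R) x \<longrightarrow> 0 < snd w x"
    unfolding AE_all_countable using singular_bounds(3)[OF w b qm] by simp
  moreover have "\<exists>R. 0 < bump (real R) x" for x :: "real^'n"
    using reals_Archimedean2[of "norm x"] unfolding bump_def by (simp add: less_max_iff_disj)
  ultimately show "AE x in lebesgue. 0 < fst w x" "AE x in lebesgue. 0 < snd w x"
    by (auto elim!: eventually_mono)
qed

text \<open>With \<open>w\<close> positive, directions of either sign are accessible: the
  nonnegative direction of absolute values has already supplied the integrable bound for the
  singular quotients, so all limits in \<open>first_variation\<close> can be taken.\<close>

lemma euler_lagrange:
  assumes w: "w \<in> Wp" and qm: "fib.quasi_minimal w" and \<phi>: "\<phi> \<in> W"
  shows "integrable lebesgue (coupling_integrand \<alpha> \<beta> w \<phi>)"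
    "integrable lebesgue (\<lambda>x. a x * fst w x powr (- p) * fst \<phi> x)" "integrable lebesgue (\<lambda>x. b x * snd w x powr (- q) * snd \<phi> x)"
    "\<theta> / (\<alpha> + \<beta>) * integral\<^sup>L lebesgue (coupling_integrand \<alpha> \<beta> w \<phi>)
      + l * (LINT x|lebesgue. a x * fst w x powr (- p) * fst \<phi> x) + l * (LINT x|lebesgue. b x * snd w x powr (- q) * snd \<phi> x) \<le> B w \<phi>"
proof -
  have wW: "w \<in> W" using w unfolding Wp_def by auto
  have X: "fst w \<in> X1 s V1" "snd w \<in> X1 s V2" "fst \<phi> \<in> X1 s V1" "snd \<phi> \<in> X1 s V2" using wW \<phi> W_iff by auto
  note m = pot1.X1_D(1)[OF X(1)] pot2.X1_D(1)[OF X(2)] pot1.X1_D(1)[OF X(3)] pot2.X1_D(1)[OF X(4)]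
  note [measurable] = m Lp_measurable
  have pX: "fst (pert w \<phi> n) \<in> X1 s V1" "snd (pert w \<phi> n) \<in> X1 s V2" for n using pert_W[OF wW \<phi>] W_iff by auto
  note pos = quasi_minimal_pos[OF w qm]
  note sb = singular_bounds[OF w abs_functionals(1)[OF \<phi>] qm]
  have i1: "integrable lebesgue (\<lambda>x. a x * fst w x powr (- p) * \<bar>fst \<phi> x\<bar>)" using sb(2) by simp
  have i2: "integrable lebesgue (\<lambda>x. b x * snd w x powr (- q) * \<bar>snd \<phi> x\<bar>)" using sb(4) by simp
  show "integrable lebesgue (\<lambda>x. a x * fst w x powr (- p) * fst \<phi> x)"
    by (rule Bochner_Integration.integrable_bound[OF i1]) (auto simp: abs_mult)
  show "integrable lebesgue (\<lambda>x. b x * snd w x powr (- q) * snd \<phi> x)"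
    by (rule Bochner_Integration.integrable_bound[OF i2]) (auto simp: abs_mult)
  note iP = P_integrable[OF pX(1), unfolded pert_def fst_conv] and iQ = Q_integrable[OF pX(2), unfolded pert_def snd_conv]
  note dP = singular_derivative[OF pq(1) pq'(2) Lp_measurable(1) m(1,3) ab_pos(1) pos(1) iP P_integrable[OF X(1)] i1]
  note dQ = singular_derivative[OF pq'(1) pq(3) Lp_measurable(2) m(2,4) ab_pos(2) pos(2) iQ Q_integrable[OF X(2)] i2]
  note dC = coupling_derivative[OF \<alpha>\<beta> m pos X1_gamma(1)[OF X(1)] X1_gamma(2)[OF X(2)] X1_gamma(1)[OF X(3)] X1_gamma(2)[OF X(4)]
      C_integrable[OF pX, unfolded pert_def fst_conv snd_conv] C_integrable[OF X(1,2)], unfolded prod.collapse]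
  show "integrable lebesgue (coupling_integrand \<alpha> \<beta> w \<phi>)" by (rule dC(1))
  obtain \<sigma> where \<sigma>: "\<sigma> \<longlonglongrightarrow> 0"
    "\<forall>\<^sub>F n in sequentially. \<theta> / (\<alpha> + \<beta>) * exp ((\<alpha> + \<beta>) * \<sigma> n) * ((C (pert w \<phi> n) - C w) / eps n)
       + l / (1 - p) * exp ((1 - p) * \<sigma> n) * ((P (pert w \<phi> n) - P w) / eps n)
       + l / (1 - q) * exp ((1 - q) * \<sigma> n) * ((Q (pert w \<phi> n) - Q w) / eps n)
      \<le> exp (2 * \<sigma> n) * (B w \<phi> + eps n / 2 * A \<phi>)"
    using first_variation[OF wW \<phi> qm] by blast
  have lC: "(\<lambda>n. (C (pert w \<phi> n) - C w) / eps n) \<longlonglongrightarrow> integral\<^sup>L lebesgue (coupling_integrand \<alpha> \<beta> w \<phi>)"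
    using dC(2) unfolding C_def pert_def by simp
  have lP: "(\<lambda>n. (P (pert w \<phi> n) - P w) / eps n) \<longlonglongrightarrow> (1 - p) * (LINT x|lebesgue. a x * fst w x powr (- p) * fst \<phi> x)"
    using dP unfolding P_def pert_def by simp
  have lQ: "(\<lambda>n. (Q (pert w \<phi> n) - Q w) / eps n) \<longlonglongrightarrow> (1 - q) * (LINT x|lebesgue. b x * snd w x powr (- q) * snd \<phi> x)"
    using dQ unfolding Q_def pert_def by simp
  note e1 = exp_tendsto_1[OF \<sigma>(1)]
  \<comment> \<open>The factors \<open>1 - p\<close> and \<open>1 - q\<close> of the limits will
    cancel the denominators inherited from \<open>J\<close>.\<close>
  have L: "(\<lambda>n. \<theta> / (\<alpha> + \<beta>) * exp ((\<alpha> + \<beta>) * \<sigma> n) * ((C (pert w \<phi> n) - C w) / eps n)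
       + l / (1 - p) * exp ((1 - p) * \<sigma> n) * ((P (pert w \<phi> n) - P w) / eps n)
       + l / (1 - q) * exp ((1 - q) * \<sigma> n) * ((Q (pert w \<phi> n) - Q w) / eps n)) \<longlonglongrightarrow>
     \<theta> / (\<alpha> + \<beta>) * 1 * integral\<^sup>L lebesgue (coupling_integrand \<alpha> \<beta> w \<phi>)
      + l / (1 - p) * 1 * ((1 - p) * (LINT x|lebesgue. a x * fst w x powr (- p) * fst \<phi> x))
      + l / (1 - q) * 1 * ((1 - q) * (LINT x|lebesgue. b x * snd w x powr (- q) * snd \<phi> x))"
    by (intro tendsto_add tendsto_mult tendsto_const e1 lC lP lQ)
  have R: "(\<lambda>n. exp (2 * \<sigma> n) * (B w \<phi> + eps n / 2 * A \<phi>)) \<longlonglongrightarrow> 1 * (B w \<phi> + 0 / 2 * A \<phi>)"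
    by (intro tendsto_intros e1 eps_tendsto) simp
  have "\<theta> / (\<alpha> + \<beta>) * 1 * integral\<^sup>L lebesgue (coupling_integrand \<alpha> \<beta> w \<phi>)
      + l / (1 - p) * 1 * ((1 - p) * (LINT x|lebesgue. a x * fst w x powr (- p) * fst \<phi> x))
      + l / (1 - q) * 1 * ((1 - q) * (LINT x|lebesgue. b x * snd w x powr (- q) * snd \<phi> x)) \<le> 1 * (B w \<phi> + 0 / 2 * A \<phi>)"
    by (rule tendsto_le[OF _ R L \<sigma>(2)]) simp
  then show "\<theta> / (\<alpha> + \<beta>) * integral\<^sup>L lebesgue (coupling_integrand \<alpha> \<beta> w \<phi>)
      + l * (LINT x|lebesgue. a x * fst w x powr (- p) * fst \<phi> x) + l * (LINT x|lebesgue. b x * snd w x powr (- q) * snd \<phi> x) \<le> B w \<phi>"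
    using pq pq' by simp
qed

text \<open>The inequality of \<open>euler_lagrange\<close> for a direction and for its negative
  gives equality.\<close>

lemma quasi_minimal_weak_solution:
  assumes w: "w \<in> Wp" and qm: "fib.quasi_minimal w"
  shows "weak_solution s V1 V2 \<theta> \<alpha> \<beta> p q a b l w"
proof -
  obtain u v where uv: "w = (u, v)" by fastforce
  have wX: "(u, v) \<in> X s V1 V2" using w uv unfolding Wp_def W_def by auto
  then have X: "u \<in> X1 s V1" "v \<in> X1 s V2" unfolding X_def by auto
  have pos: "AE x in lebesgue. 0 < u x" "AE x in lebesgue. 0 < v x" using quasi_minimal_pos[OF w qm] uv by auto
  have "integrable lebesgue (gagliardo2 s (u, v) (\<phi>, \<psi>)) \<and>
        integrable lebesgue (\<lambda>x. V1 x * u x * \<phi> x + V2 x * v x * \<psi> x) \<and>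
        integrable lebesgue (coupling_integrand \<alpha> \<beta> (u, v) (\<phi>, \<psi>)) \<and>
        ext_integrable (singular_integrand p q a b (u, v) (\<phi>, \<psi>)) \<and>
        X_inner s V1 V2 (u, v) (\<phi>, \<psi>)
          - \<theta> / (\<alpha> + \<beta>) * integral\<^sup>L lebesgue (coupling_integrand \<alpha> \<beta> (u, v) (\<phi>, \<psi>))
          - l * ext_integral (singular_integrand p q a b (u, v) (\<phi>, \<psi>)) = 0"
    if \<phi>X: "(\<phi>, \<psi>) \<in> X s V1 V2" for \<phi> \<psi>
  proof -
    have Y: "\<phi> \<in> X1 s V1" "\<psi> \<in> X1 s V2" using \<phi>X unfolding X_def by auto
    note [measurable] = pot1.X1_D(1)[OF X(1)] pot2.X1_D(1)[OF X(2)] pot1.X1_D(1)[OF Y(1)] pot2.X1_D(1)[OF Y(2)] Lp_measurable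
    have \<phi>W: "(\<phi>, \<psi>) \<in> W" using \<phi>X unfolding W_def .
    have nW: "(\<lambda>x. - \<phi> x, \<lambda>x. - \<psi> x) \<in> W"
      unfolding W_iff using pot1.X1_scale[OF Y(1), of "-1"] pot2.X1_scale[OF Y(2), of "-1"] by simp
    note E = euler_lagrange[OF w qm \<phi>W, unfolded uv fst_conv snd_conv]
    note En = euler_lagrange(4)[OF w qm nW, unfolded uv fst_conv snd_conv]
    have cn: "coupling_integrand \<alpha> \<beta> (u, v) (\<lambda>x. - \<phi> x, \<lambda>x. - \<psi> x) = (\<lambda>x. - coupling_integrand \<alpha> \<beta> (u, v) (\<phi>, \<psi>) x)"
      unfolding coupling_integrand_def by auto
    have gn: "gagliardo s f (\<lambda>x. - g x) = (\<lambda>z. - gagliardo s f g z)" for f g :: "real^'n \<Rightarrow> real"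
      unfolding gagliardo_def by (auto simp: minus_divide_left algebra_simps)
    have Bn: "B (u, v) (\<lambda>x. - \<phi> x, \<lambda>x. - \<psi> x) = - B (u, v) (\<phi>, \<psi>)"
      unfolding B_def pot1.form_def pot2.form_def fst_conv snd_conv gn by simp
    define S where "S x = a x * u x powr (- p) * \<phi> x + b x * v x powr (- q) * \<psi> x" for x
    have Si: "integrable lebesgue S" unfolding S_def using E(2,3) by simp
    have SI: "integral\<^sup>L lebesgue S = (LINT x|lebesgue. a x * u x powr (- p) * \<phi> x) + (LINT x|lebesgue. b x * v x powr (- q) * \<psi> x)"
      unfolding S_def using E(2,3) by simp
    have "\<theta> / (\<alpha> + \<beta>) * integral\<^sup>L lebesgue (coupling_integrand \<alpha> \<beta> (u, v) (\<phi>, \<psi>)) + l * integral\<^sup>L lebesgue S \<le> B (u, v) (\<phi>, \<psi>)"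
      using E(4) unfolding SI by (simp add: distrib_left)
    moreover have "B (u, v) (\<phi>, \<psi>) \<le> \<theta> / (\<alpha> + \<beta>) * integral\<^sup>L lebesgue (coupling_integrand \<alpha> \<beta> (u, v) (\<phi>, \<psi>)) + l * integral\<^sup>L lebesgue S"
      using En unfolding SI cn Bn by (simp add: distrib_left)
    ultimately have eq: "B (u, v) (\<phi>, \<psi>) = \<theta> / (\<alpha> + \<beta>) * integral\<^sup>L lebesgue (coupling_integrand \<alpha> \<beta> (u, v) (\<phi>, \<psi>)) + l * integral\<^sup>L lebesgue S"
      by linarith
    let ?g = "singular_integrand p q a b (u, v) (\<phi>, \<psi>)"
    \<comment> \<open>Positivity almost everywhere makes the extended-real integrand finite off a
      null set, where it agrees with \<open>S\<close>.\<close>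
    have ae: "AE x in lebesgue. ?g x = ereal (S x)"
      using pos by eventually_elim (simp add: singular_integrand_def neg_pow_def S_def abs_of_pos)
    have npm: "(\<lambda>x. neg_pow (f x) r) \<in> borel_measurable lebesgue" if [measurable]: "f \<in> borel_measurable lebesgue" for f :: "real^'n \<Rightarrow> real" and r
      unfolding neg_pow_def by measurable
    have gm: "?g \<in> borel_measurable lebesgue"
    proof -
      have [measurable]: "(\<lambda>x. neg_pow (u x) p) \<in> borel_measurable lebesgue" "(\<lambda>x. neg_pow (v x) q) \<in> borel_measurable lebesgue"
        by (intro npm; simp)+
      show ?thesis unfolding singular_integrand_def by simp
    qed
    have "(\<integral>\<^sup>+x. e2ennreal \<bar>?g x\<bar> \<partial>lebesgue) = (\<integral>\<^sup>+x. ennreal \<bar>S x\<bar> \<partial>lebesgue)"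
      by (rule nn_integral_cong_AE) (use ae in \<open>eventually_elim, simp\<close>)
    also have "\<dots> < \<infinity>" using Si by (simp add: integrable_iff_bounded)
    finally have ei: "ext_integrable ?g" unfolding ext_integrable_def using gm by simp
    have "ext_integral ?g = integral\<^sup>L lebesgue S"
      unfolding ext_integral_def
      by (rule integral_cong_AE) (use gm Si ae in \<open>auto elim!: eventually_mono\<close>)
    moreover have "X_inner s V1 V2 (u, v) (\<phi>, \<psi>) = B (u, v) (\<phi>, \<psi>)"
      using X_inner_eq(3)[OF wX \<phi>X] unfolding B_def by simp
    ultimately show ?thesis using X_inner_eq(1,2)[OF wX \<phi>X] E(1) ei eq by simp
  qed
  then show ?thesis unfolding weak_solution_def uv using wX by auto
qed

lemma two_solutions:
  "\<exists>u v z w. weak_solution s V1 V2 \<theta> \<alpha> \<beta> p q a b l (u, v) \<and> weak_solution s V1 V2 \<theta> \<alpha> \<beta> p q a b l (z, w) \<and>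
     \<not> (AE x in lebesgue. u x = z x \<and> v x = w x) \<and> (AE x in lebesgue. u x > 0 \<and> v x > 0 \<and> z x > 0 \<and> w x > 0)"
proof -
  obtain w1 where w1: "w1 \<in> Wp" "0 < fib.F' w1" "fib.quasi_minimal w1" using fib.ex_quasi_minimal_plus by blast
  obtain w2 where w2: "w2 \<in> Wp" "fib.F' w2 < 0" "fib.quasi_minimal w2" using fib.ex_quasi_minimal_minus by blast
  have "\<not> (AE x in lebesgue. fst w1 x = fst w2 x \<and> snd w1 x = snd w2 x)"
  proof
    assume ae: "AE x in lebesgue. fst w1 x = fst w2 x \<and> snd w1 x = snd w2 x"
    have X: "fst w1 \<in> X1 s V1" "snd w1 \<in> X1 s V2" "fst w2 \<in> X1 s V1" "snd w2 \<in> X1 s V2"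
      using w1(1) w2(1) W_iff unfolding Wp_def by auto
    note [measurable] = pot1.X1_D(1)[OF X(1)] pot2.X1_D(1)[OF X(2)] pot1.X1_D(1)[OF X(3)] pot2.X1_D(1)[OF X(4)] Lp_measurable
    \<comment> \<open>\<open>F'\<close> is built from these three integrals, so it cannot change
      sign between pairs that agree almost everywhere.\<close>
    have "C w1 = C w2" unfolding C_def
      by (rule integral_cong_AE, simp, simp, use ae in eventually_elim) simp
    moreover have "P w1 = P w2" unfolding P_def
      by (rule integral_cong_AE, simp, simp, use ae in eventually_elim) simp
    moreover have "Q w1 = Q w2" unfolding Q_def
      by (rule integral_cong_AE, simp, simp, use ae in eventually_elim) simp
    ultimately show False using w1(2) w2(2) unfolding fib.F'_def by simp
  qed
  moreover have "AE x in lebesgue. fst w1 x > 0 \<and> snd w1 x > 0 \<and> fst w2 x > 0 \<and> snd w2 x > 0"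
    using quasi_minimal_pos[OF w1(1,3)] quasi_minimal_pos[OF w2(1,3)] by eventually_elim simp
  ultimately show ?thesis
    using quasi_minimal_weak_solution[OF w1(1,3)] quasi_minimal_weak_solution[OF w2(1,3)]
    by (intro exI[of _ "fst w1"] exI[of _ "snd w1"] exI[of _ "fst w2"] exI[of _ "snd w2"]) simp
qed

end

theorem theorem1p3:
  fixes s \<alpha> \<beta> p q \<theta> V0 :: real
    and a b V1 V2 :: "real^'n \<Rightarrow> real"
  assumes "0 < s" "s < 1" "real CARD('n) > 2 * s"
    and "\<alpha> > 1" "\<beta> > 1"
    and "2 < \<alpha> + \<beta>" "\<alpha> + \<beta> < 2 * real CARD('n) / (real CARD('n) - 2 * s)"
    and "0 < p" "p \<le> q" "q < 1" "\<theta> > 0"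
    and "a \<in> Lp (2 / (1 + p))" "b \<in> Lp (2 / (1 + q))"
    and "\<And>x. a x > 0" "\<And>x. b x > 0"
    and "continuous_on UNIV V1" "continuous_on UNIV V2"
    and "V0 > 0" "\<And>x. V1 x \<ge> V0" "\<And>x. V2 x \<ge> V0"
    and "\<And>M. M > 0 \<Longrightarrow> emeasure lebesgue {x. V1 x \<le> M} < \<infinity>"
    and "\<And>M. M > 0 \<Longrightarrow> emeasure lebesgue {x. V2 x \<le> M} < \<infinity>"
  shows "\<forall>l::real. 0 < l \<and> ereal l < lambda_star s V1 V2 \<theta> \<alpha> \<beta> p q a b \<longrightarrow>
    (\<exists>u v z w.
       weak_solution s V1 V2 \<theta> \<alpha> \<beta> p q a b l (u, v) \<and>
       weak_solution s V1 V2 \<theta> \<alpha> \<beta> p q a b l (z, w) \<and>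
       \<not> (AE x in lebesgue. u x = z x \<and> v x = w x) \<and>
       (AE x in lebesgue. u x > 0 \<and> v x > 0 \<and> z x > 0 \<and> w x > 0))"
proof (intro allI impI)
  fix l :: real assume "0 < l \<and> ereal l < lambda_star s V1 V2 \<theta> \<alpha> \<beta> p q a b"
  then interpret singular_system s \<alpha> \<beta> p q \<theta> V0 l a b V1 V2
    using assms by unfold_locales auto
  show "\<exists>u v z w.
       weak_solution s V1 V2 \<theta> \<alpha> \<beta> p q a b l (u, v) \<and>
       weak_solution s V1 V2 \<theta> \<alpha> \<beta> p q a b l (z, w) \<and>
       \<not> (AE x in lebesgue. u x = z x \<and> v x = w x) \<and>
       (AE x in lebesgue. u x > 0 \<and> v x > 0 \<and> z x > 0 \<and> w x > 0)"
    by (rule two_solutions)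
qed

end
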